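(* A finite graph $\Gamma$ is a connected, cubic, simple graph with a cyclic group of automorphisms $G\le\mathrm{Aut}(\Gamma)$ having at most $3$ orbits on vertices if and only if it is isomorphic to one of the following graphs: (1) $\Gamma_7(2)$, $\Gamma_9(4)$, $\Gamma_{10}(2)$, $\Gamma_{11}(4)$, $\Gamma_{15}(6)$ or $\Gamma_{16}(1)$; (2) $\Gamma_1(m;r)$ with $m$ even, $m\ge 4$, $r\ne0$, $\gcd(\tfrac m2,r)=1$; (3) $\Gamma_i(m;r)$ with $i\in\{3,12,13,14,18,20,21\}$, $m$ even, $r\neq 0$, $\gcd(\tfrac m2,r)=1$; (4) $\Gamma_i(m;r)$ with $i\in\{6,19\}$, $r\ne 0$, $\gcd(m,r)=1$; (5) $\Gamma_8(m;r)$ with $\gcd(m,r)=1$; (6) $\Gamma_i(m;r,s)$ with $i\in\{2,17\}$, $m\ge3$, $r\neq0\neq s$, $\gcd(m,r,s)=1$; (7) $\Gamma_4(m;r,s)$ with $m\ge3$, $0<r<s$, $\gcd(m,r,s)=1$; (8) $\Gamma_5(m;r)$ with $m$ even, $r\ne0$, $\gcd(\tfrac m2,r)=1$; (9) $\Gamma_{23}(m;r,s)$ with $m$ even, $r\ne s$, $\gcd(\tfrac m2,r,s)=1$; (10) $\Gamma_{24}(m;r)$ with $m$ even, $\gcd(\tfrac m2,r)=1$; (11) $\Gamma_i(m;r,s)$ with $i\in\{22,25\}$, $m$ even, $m\ge4$, $r\ne0\ne s$, $\gcd(\tfrac m2,r,s)=1$. Here $m$ is a positive integer and the parameters $r,s$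 range over the sets described in the context.
   Context: Notation. In each graph below the vertex set is a disjoint union of sets ("fibres") $U=\{u_i: i\in\mathbb Z_{|U|}\}$, $V=\{v_i:i\in\mathbb Z_{|V|}\}$, $W=\{w_i: i\in \mathbb Z_{|W|}\}$, whose sizes are specified. The index of a vertex is always reduced modulo the size of its fibre. Adjacency is symmetric. The following abbreviations for sets of edges are used. - "$X\text{--}Y$" for two fibres $X=\{x_i\},Y=\{y_j\}$: $x_i\sim y_j$ if and only if $i\equiv j\pmod{\gcd(|X|,|Y|)}$. - "$X\text{--}Y$ with shift $r$" for fibres of equal size: $x_i\sim y_{i+r}$ for all $i$. - "loop $r$ at $X$": $x_i\sim x_{i+r}$ and $x_i\sim x_{i-r}$ for all $i$. - "semi at $X$" ($|X|$ even): $x_i\sim x_{i+|X|/2}$ for all $i$. Standing convention on parameters: a parameter $r$ (or $s$) is an integer with $0\le r<N$, where $N$ is the size of the fibre (or of each of the two equal-sized fibres) on which it is used. If the parameter is used as a loop at $X$, it is moreover assumed to be different from $0$ and from $|X|/2$. Definitions of the graphs: - $\Gamma_1(m;r)$: $|U|=m$; loop $r$ at $U$, semi at $U$. - $\Gamma_2(m;r,s)$: $|U|=|V|=m$; loop $r$ at $U$, loop $s$ at $V$, $U$--$V$. - $\Gamma_3(m;r)$: $|U|=|V|=m$; $U$--$V$, $U$--$V$ with shift $r$, semi at $U$, semi at $V$. - $\Gamma_4(m;r,s)$: $|U|=|V|=m$; $U$--$V$, $U$--$V$ with shift $r$, $U$--$V$ with shift $s$. - $\Gamma_5(m;r)$: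 $|U|=2m$, $|V|=m$; loop $r$ at $U$, $U$--$V$, semi at $V$. - $\Gamma_6(m;r)$: $|U|=3m$, $|V|=m$; loop $r$ at $U$, $U$--$V$. - $\Gamma_7(2)$: $|U|=6$, $|V|=4$; $U$--$V$, semi at $U$. - $\Gamma_8(m;r)$: $|U|=2m$, $|V|=|W|=m$; semi at $U$, $U$--$V$, $U$--$W$, $V$--$W$ with shift $r$. - $\Gamma_9(4)$: $|U|=4$, $|V|=|W|=2$; semi at each of $U,V,W$; $U$--$V$, $U$--$W$. - $\Gamma_{10}(2)$: $|U|=6$, $|V|=|W|=2$; semi at $U$; $U$--$V$, $U$--$W$. - $\Gamma_{11}(4)$: $|U|=12$, $|V|=6$, $|W|=4$; semi at $U$, semi at $V$; $U$--$V$, $U$--$W$. - $\Gamma_{12}(m;r)$: $|U|=|V|=2m$, $|W|=m$; semi at $U$, loop $r$ at $V$, semi at $W$; $U$--$V$, $U$--$W$. - $\Gamma_{13}(m;r)$: $|U|=|V|=3m$, $|W|=m$; semi at $U$, loop $r$ at $V$; $U$--$V$, $U$--$W$. - $\Gamma_{14}(m;r)$: $|U|=|V|=3m/2$, $|W|=m$; loop $r$ at $V$; $U$--$V$, $U$--$W$. - $\Gamma_{15}(6)$: $|U|=12$, $|V|=8$, $|W|=6$; semi at $W$; $U$--$V$, $U$--$W$. - $\Gamma_{16}(1)$: $|U|=3$, $|V|=2$, $|W|=1$; $U$--$V$, $U$--$W$. - $\Gamma_{17}(m;r,s)$: $|U|=|V|=m$, $|W|=2m$; loop $r$ at $V$,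 loop $s$ at $W$; $U$--$V$, $U$--$W$. - $\Gamma_{18}(m;r)$: $|U|=4m$, $|V|=2m$, $|W|=m$; loop $r$ at $U$, semi at $W$; $U$--$V$, $V$--$W$. - $\Gamma_{19}(m;r)$: $|U|=6m$, $|V|=3m$, $|W|=m$; loop $r$ at $U$; $U$--$V$, $V$--$W$. - $\Gamma_{20}(m;r)$: $|U|=|V|=3m$, $|W|=m$; semi at $V$; $U$--$V$, $U$--$V$ with shift $r$, $U$--$W$. - $\Gamma_{21}(m;r)$: $|U|=|V|=2m$, $|W|=m$; semi at $V$, semi at $W$; $U$--$V$, $U$--$V$ with shift $r$, $U$--$W$. - $\Gamma_{22}(m;r,s)$: $|U|=|V|=|W|=m$; loop $s$ at $U$, $U$--$V$, $V$--$W$, $V$--$W$ with shift $r$, semi at $W$. - $\Gamma_{23}(m;r,s)$: $|U|=|V|=|W|=m$; $U$--$V$ with shift $r$, $U$--$V$ with shift $s$, $U$--$W$, $V$--$W$, semi at $W$. - $\Gamma_{24}(m;r)$: $|U|=|V|=|W|=m$; $U$--$V$, $V$--$W$, $W$--$U$ with shift $r$, semi at each of $U,V,W$. - $\Gamma_{25}(m;r,s)$: $|U|=|V|=|W|=m$; loop $r$ at $U$, loop $s$ at $W$, $U$--$V$, $V$--$W$, semi at $V$. *)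

theory Defs
  imports
    "Graph_Theory.Graph_Theory"
    "HOL-Algebra.Elementary_Groups"
    "HOL-Algebra.Group_Action"
    "HOL-Number_Theory.Cong"
begin

text \<open>
  Graphs are symmetric pair digraphs. The locale \<^locale>\<open>pair_pseudo_graph\<close> describes the finite
  graphs, possibly with loops, and \<^locale>\<open>pair_graph\<close> the finite simple ones.
\<close>

abbreviation graph_iso :: "'a pair_pre_digraph \<Rightarrow> 'b pair_pre_digraph \<Rightarrow> bool" where
  "graph_iso G H \<equiv> digraph_iso (with_proj G) (with_proj H)"

definition cubic :: "'a pair_pre_digraph \<Rightarrow> bool" where
  "cubic G \<longleftrightarrow> (\<forall>v \<in> pverts G. out_degree (with_proj G) v = 3)"

text \<open>As in \<^const>\<open>Bij\<close>, automorphisms are extensional, i.e. undefined outside the vertex set.\<close>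

definition Aut :: "'a pair_pre_digraph \<Rightarrow> ('a \<Rightarrow> 'a) monoid" where
  "Aut G = BijGroup (pverts G)
     \<lparr>carrier := {f \<in> Bij (pverts G).
        \<forall>u \<in> pverts G. \<forall>v \<in> pverts G. (f u, f v) \<in> parcs G \<longleftrightarrow> (u, v) \<in> parcs G}\<rparr>"

definition cyclic_aut_group_with_orbits :: "'a pair_pre_digraph \<Rightarrow> nat \<Rightarrow> bool" where
  "cyclic_aut_group_with_orbits G k \<longleftrightarrow>
     (\<exists>H. subgroup H (Aut G) \<and> cyclic_group (Aut G\<lparr>carrier := H\<rparr>) \<and>
          card (orbits (Aut G\<lparr>carrier := H\<rparr>) (pverts G) (\<lambda>g. g)) = k)"

datatype fibre = FU | FV | FW

datatype edge_rule =
    Join fibre fibre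
  | Shift fibre fibre nat
  | Loop fibre nat
  | Semi fibre

text \<open>
  A scheme \<open>Scheme a b c rs\<close> prescribes fibres \<open>U\<close>, \<open>V\<close>, \<open>W\<close> of sizes \<open>a\<close>, \<open>b\<close>, \<open>c\<close> (size \<open>0\<close> for
  an absent fibre) and the edges between them. The vertex \<open>x\<^sub>i\<close> of the fibre \<open>X\<close> is \<open>(X, i)\<close>, where
  \<open>i\<close> is the least non-negative residue modulo the size of \<open>X\<close>.
\<close>

datatype scheme = Scheme nat nat nat (rules: "edge_rule list")

fun size_of :: "scheme \<Rightarrow> fibre \<Rightarrow> nat" where
  "size_of (Scheme a b c rs) FU = a"
| "size_of (Scheme a b c rs) FV = b"
| "size_of (Scheme a b c rs) FW = c"

fun rule_arcs :: "(fibre \<Rightarrow> nat) \<Rightarrow> edge_rule \<Rightarrow> ((fibre \<times> nat) \<times> (fibre \<times> nat)) set" where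
  "rule_arcs n (Join X Y) =
     {((X, i), (Y, j)) | i j. i < n X \<and> j < n Y \<and> [i = j] (mod gcd (n X) (n Y))}"
| "rule_arcs n (Shift X Y r) =
     {((X, i), (Y, j)) | i j. i < n X \<and> j < n Y \<and> [j = i + r] (mod n Y)}"
| "rule_arcs n (Loop X r) =
     {((X, i), (X, j)) | i j. i < n X \<and> j < n X \<and> ([j = i + r] (mod n X) \<or> [j + r = i] (mod n X))}"
| "rule_arcs n (Semi X) =
     {((X, i), (X, j)) | i j. i < n X \<and> j < n X \<and> [j = i + n X div 2] (mod n X)}"

definition scheme_graph :: "scheme \<Rightarrow> (fibre \<times> nat) pair_pre_digraph" where
  "scheme_graph S =
     (let A = (\<Union>e \<in> set (rules S). rule_arcs (size_of S) e)
      in \<lparr>pverts = {(X, i). i < size_of S X}, parcs = A \<union> A\<inverse>\<rparr>)"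

text \<open>
  The standing convention on parameters: a parameter is reduced modulo the size of the fibre on
  which it is used, and a loop parameter differs from \<open>0\<close> and from half the size of its fibre (so
  that it contributes valency two). The equal sizes needed by \<^const>\<open>Shift\<close> and the even size
  needed by \<^const>\<open>Semi\<close> hold for every graph below under the hypotheses of the classification.
\<close>

fun rule_param_ok :: "(fibre \<Rightarrow> nat) \<Rightarrow> edge_rule \<Rightarrow> bool" where
  "rule_param_ok n (Join X Y) \<longleftrightarrow> True"
| "rule_param_ok n (Shift X Y r) \<longleftrightarrow> r < n X"
| "rule_param_ok n (Loop X r) \<longleftrightarrow> r < n X \<and> r \<noteq> 0 \<and> 2 * r \<noteq> n X"
| "rule_param_ok n (Semi X) \<longleftrightarrow> True"

definition params_ok :: "scheme \<Rightarrow> bool" where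
  "params_ok S \<longleftrightarrow> (\<forall>e \<in> set (rules S). rule_param_ok (size_of S) e)"

definition Gamma1 :: "nat \<Rightarrow> nat \<Rightarrow> scheme" where
  "Gamma1 m r = Scheme m 0 0 [Loop FU r, Semi FU]"

definition Gamma2 :: "nat \<Rightarrow> nat \<Rightarrow> nat \<Rightarrow> scheme" where
  "Gamma2 m r s = Scheme m m 0 [Loop FU r, Loop FV s, Join FU FV]"

definition Gamma3 :: "nat \<Rightarrow> nat \<Rightarrow> scheme" where
  "Gamma3 m r = Scheme m m 0 [Join FU FV, Shift FU FV r, Semi FU, Semi FV]"

definition Gamma4 :: "nat \<Rightarrow> nat \<Rightarrow> nat \<Rightarrow> scheme" where
  "Gamma4 m r s = Scheme m m 0 [Join FU FV, Shift FU FV r, Shift FU FV s]"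

definition Gamma5 :: "nat \<Rightarrow> nat \<Rightarrow> scheme" where
  "Gamma5 m r = Scheme (2 * m) m 0 [Loop FU r, Join FU FV, Semi FV]"

definition Gamma6 :: "nat \<Rightarrow> nat \<Rightarrow> scheme" where
  "Gamma6 m r = Scheme (3 * m) m 0 [Loop FU r, Join FU FV]"

definition Gamma7_2 :: scheme where
  "Gamma7_2 = Scheme 6 4 0 [Join FU FV, Semi FU]"

definition Gamma8 :: "nat \<Rightarrow> nat \<Rightarrow> scheme" where
  "Gamma8 m r = Scheme (2 * m) m m [Semi FU, Join FU FV, Join FU FW, Shift FV FW r]"

definition Gamma9_4 :: scheme where
  "Gamma9_4 = Scheme 4 2 2 [Semi FU, Semi FV, Semi FW, Join FU FV, Join FU FW]"

definition Gamma10_2 :: scheme where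
  "Gamma10_2 = Scheme 6 2 2 [Semi FU, Join FU FV, Join FU FW]"

definition Gamma11_4 :: scheme where
  "Gamma11_4 = Scheme 12 6 4 [Semi FU, Semi FV, Join FU FV, Join FU FW]"

definition Gamma12 :: "nat \<Rightarrow> nat \<Rightarrow> scheme" where
  "Gamma12 m r = Scheme (2 * m) (2 * m) m [Semi FU, Loop FV r, Semi FW, Join FU FV, Join FU FW]"

definition Gamma13 :: "nat \<Rightarrow> nat \<Rightarrow> scheme" where
  "Gamma13 m r = Scheme (3 * m) (3 * m) m [Semi FU, Loop FV r, Join FU FV, Join FU FW]"

definition Gamma14 :: "nat \<Rightarrow> nat \<Rightarrow> scheme" where
  "Gamma14 m r = Scheme (3 * m div 2) (3 * m div 2) m [Loop FV r, Join FU FV, Join FU FW]"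

definition Gamma15_6 :: scheme where
  "Gamma15_6 = Scheme 12 8 6 [Semi FW, Join FU FV, Join FU FW]"

definition Gamma16_1 :: scheme where
  "Gamma16_1 = Scheme 3 2 1 [Join FU FV, Join FU FW]"

definition Gamma17 :: "nat \<Rightarrow> nat \<Rightarrow> nat \<Rightarrow> scheme" where
  "Gamma17 m r s = Scheme m m (2 * m) [Loop FV r, Loop FW s, Join FU FV, Join FU FW]"

definition Gamma18 :: "nat \<Rightarrow> nat \<Rightarrow> scheme" where
  "Gamma18 m r = Scheme (4 * m) (2 * m) m [Loop FU r, Semi FW, Join FU FV, Join FV FW]"

definition Gamma19 :: "nat \<Rightarrow> nat \<Rightarrow> scheme" where
  "Gamma19 m r = Scheme (6 * m) (3 * m) m [Loop FU r, Join FU FV, Join FV FW]"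

definition Gamma20 :: "nat \<Rightarrow> nat \<Rightarrow> scheme" where
  "Gamma20 m r = Scheme (3 * m) (3 * m) m [Semi FV, Join FU FV, Shift FU FV r, Join FU FW]"

definition Gamma21 :: "nat \<Rightarrow> nat \<Rightarrow> scheme" where
  "Gamma21 m r =
     Scheme (2 * m) (2 * m) m [Semi FV, Semi FW, Join FU FV, Shift FU FV r, Join FU FW]"

definition Gamma22 :: "nat \<Rightarrow> nat \<Rightarrow> nat \<Rightarrow> scheme" where
  "Gamma22 m r s = Scheme m m m [Loop FU s, Join FU FV, Join FV FW, Shift FV FW r, Semi FW]"

definition Gamma23 :: "nat \<Rightarrow> nat \<Rightarrow> nat \<Rightarrow> scheme" where
  "Gamma23 m r s =
     Scheme m m m [Shift FU FV r, Shift FU FV s, Join FU FW, Join FV FW, Semi FW]"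

definition Gamma24 :: "nat \<Rightarrow> nat \<Rightarrow> scheme" where
  "Gamma24 m r =
     Scheme m m m [Join FU FV, Join FV FW, Shift FW FU r, Semi FU, Semi FV, Semi FW]"

definition Gamma25 :: "nat \<Rightarrow> nat \<Rightarrow> nat \<Rightarrow> scheme" where
  "Gamma25 m r s = Scheme m m m [Loop FU r, Loop FW s, Join FU FV, Join FV FW, Semi FV]"

end

theory Submission
  imports Defs
begin

text \<open>
  The theorem rests on the remark that a graph with a cyclic group of automorphisms is determined by
  very little data. Let \<open>\<rho>\<close> generate the group. Fixing a base point \<open>x\<close> in each orbit and writing \<open>x\<^sub>i\<close>
  for its image under \<open>\<rho>\<^sup>i\<close> indexes the vertices of the orbit by the integers modulo its size, and
  whether \<open>x\<^sub>i\<close> and \<open>y\<^sub>j\<close> are adjacent depends only on \<open>j - i\<close>. Thus the graph is given by the sizes of the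
  orbits and, for every pair of orbits, by a set of differences that is periodic modulo the gcd of the
  two sizes; \<open>exists_indexing\<close> extracts these data. Conversely, for any graph given in this way the
  rotation \<open>i \<mapsto> i + 1\<close> generates a group of automorphisms with these orbits (\<open>cyclic_aut_group\<close>). Join,
  shift, loop and semi rules are just names for the simplest such sets.

  Valency \<open>3\<close> leaves few possibilities for them. Inside an orbit the differences are closed under
  negation, so there is at most one loop and at most one semi rule, the latter on an orbit of even
  size (\<open>semi_structure\<close>, \<open>loop_structure\<close>, \<open>loop_semi_structure\<close>). Between two orbits, counting edges
  from both sides shows that the two degrees determine the ratio of the sizes, and that unequal degrees
  come from a single class of differences (\<open>join_sizes\<close>). Since the graph is connected, one of at most
  three orbits is adjacent to all others. The base points of the others can be moved so that the
  difference \<open>0\<close> occurs towards each of them (\<open>rebase_star\<close>), and running through the possible degrees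
  gives exactly the families of the list, with parameters of the remaining classes of differences
  (\<open>classify\<close>).

  What is left is connectedness. When one orbit reaches every other one along arcs of difference \<open>0\<close>,
  the graph is connected if and only if no integer \<open>d > 1\<close> divides all sizes and all differences
  (\<open>connected_iff_gcd\<close>): such a \<open>d\<close> would give an invariant residue of the index, and otherwise the
  differences of closed walks generate all integers. For each family this is the stated coprimality
  condition, and for the sporadic graphs it fixes the scale. The converse is then a matter of counting
  valencies and of reading the same criterion backwards (\<open>scheme_graph_sound\<close>).
\<close>

section \<open>Subgroups of the integers\<close>

text \<open>
  Division with remainder by the least positive element stays inside the subgroup.
\<close>

lemma int_subgroup_eq_multiples:
  fixes H :: "int set"
  assumes add: "\<And>s t. s \<in> H \<Longrightarrow> t \<in> H \<Longrightarrow> s + t \<in> H"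
    and neg: "\<And>t. t \<in> H \<Longrightarrow> - t \<in> H"
    and pos: "0 < q" "q \<in> H"
  obtains p :: nat where "0 < p" "\<And>t. t \<in> H \<longleftrightarrow> int p dvd t"
proof -
  have zero: "0 \<in> H" using add[OF pos(2) neg[OF pos(2)]] by simp
  have mult: "k * t \<in> H" if "t \<in> H" for k t
  proof -
    have *: "int m * t \<in> H" for m
      by (induction m) (use zero add[OF that] in \<open>simp_all add: distrib_right\<close>)
    show ?thesis
    proof (cases k rule: int_cases2)
      case (nonneg m) then show ?thesis using * by simp
    next
      case (nonpos m) then show ?thesis using neg[OF *[of m]] by simp
    qed
  qed
  define p where "p = (LEAST p. 0 < p \<and> int p \<in> H)"
  have ex: "\<exists>p. 0 < p \<and> int p \<in> H" using pos by (intro exI[of _ "nat q"]) auto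
  then have p: "0 < p" "int p \<in> H" using LeastI_ex[OF ex] by (simp_all add: p_def)
  have min: "p \<le> q" if "0 < q" "int q \<in> H" for q
    unfolding p_def using that by (simp add: Least_le)
  have "int p dvd t" if "t \<in> H" for t
  proof -
    have "t + - (t div int p) * int p \<in> H" by (rule add[OF that mult[OF p(2)]])
    then have "t mod int p \<in> H" by (simp add: minus_div_mult_eq_mod)
    moreover have "0 \<le> t mod int p" "t mod int p < int p" using p by simp_all
    ultimately have "t mod int p = 0"
      using min[of "nat (t mod int p)"] by (cases "t mod int p = 0") auto
    then show ?thesis by (rule mod_0_imp_dvd)
  qed
  moreover have "t \<in> H" if "int p dvd t" for t
    using mult[OF p(2)] that by (auto elim!: dvdE simp: mult.commute)
  ultimately show thesis using that p(1) by blast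
qed

section \<open>Valency and connectedness in terms of arcs\<close>

lemma pair_graph_iff_loopfree:
  assumes "pair_pseudo_graph \<Gamma>"
  shows "pair_graph \<Gamma> \<longleftrightarrow> (\<forall>v. (v, v) \<notin> parcs \<Gamma>)"
proof -
  interpret pair_pseudo_graph \<Gamma> by fact
  show ?thesis
  proof
    assume "pair_graph \<Gamma>"
    then interpret pair_graph \<Gamma> .
    show "\<forall>v. (v, v) \<notin> parcs \<Gamma>" using pair_no_loops by fastforce
  next
    assume "\<forall>v. (v, v) \<notin> parcs \<Gamma>"
    then show "pair_graph \<Gamma>" by unfold_locales auto
  qed
qed

lemma arcs_sym:
  assumes "pair_pseudo_graph \<Gamma>" "(u, v) \<in> parcs \<Gamma>"
  shows "(v, u) \<in> parcs \<Gamma>"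
proof -
  interpret pair_pseudo_graph \<Gamma> by fact
  show ?thesis using assms(2) pair_sym_arcs by (auto simp: symmetric_def dest: symD)
qed

lemma cubic_iff_card_neighbours:
  "cubic \<Gamma> \<longleftrightarrow> (\<forall>v \<in> pverts \<Gamma>. card {w. (v, w) \<in> parcs \<Gamma>} = 3)"
proof -
  have "out_degree (with_proj \<Gamma>) v = card {w. (v, w) \<in> parcs \<Gamma>}" for v
  proof -
    have "out_arcs (with_proj \<Gamma>) v = Pair v ` {w. (v, w) \<in> parcs \<Gamma>}"
      by (auto simp: out_arcs_def)
    then show ?thesis by (simp add: out_degree_def card_image inj_on_def)
  qed
  then show ?thesis by (simp add: cubic_def)
qed

lemma connected_iff_rtrancl:
  assumes "pair_pseudo_graph \<Gamma>"
  shows "connected (with_proj \<Gamma>) \<longleftrightarrow>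
    pverts \<Gamma> \<noteq> {} \<and> (\<forall>u \<in> pverts \<Gamma>. \<forall>v \<in> pverts \<Gamma>. (u, v) \<in> (parcs \<Gamma>)\<^sup>*)"
proof -
  interpret pair_pseudo_graph \<Gamma> by fact
  have sym: "parcs (mk_symmetric (with_proj \<Gamma>)) = parcs \<Gamma>"
    using pair_sym_arcs by (auto simp: parcs_mk_symmetric symmetric_def dest: symD)
  have "(u, v) \<in> rtrancl_on (pverts \<Gamma>) (parcs \<Gamma>) \<longleftrightarrow> (u, v) \<in> (parcs \<Gamma>)\<^sup>*" if "u \<in> pverts \<Gamma>" for u v
  proof
    assume "(u, v) \<in> rtrancl_on (pverts \<Gamma>) (parcs \<Gamma>)"
    then show "(u, v) \<in> (parcs \<Gamma>)\<^sup>*"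
      by induct auto
  next
    assume "(u, v) \<in> (parcs \<Gamma>)\<^sup>*"
    then show "(u, v) \<in> rtrancl_on (pverts \<Gamma>) (parcs \<Gamma>)"
      by induct (use that in \<open>auto intro: rtrancl_on_into_rtrancl_on dest: in_arcsD2\<close>)
  qed
  then show ?thesis
    by (auto simp: connected_def strongly_connected_def reachable_def sym)
qed

section \<open>Indexing orbits by the integers\<close>

text \<open>
  The integers act on the graph through a generator of the cyclic group, and \<open>\<phi> X i\<close> is the
  translate by \<open>i\<close> of a base point of the orbit \<open>X\<close>, an orbit of size \<open>n X\<close>; size \<open>0\<close> marks an absent
  orbit. Adjacency is invariant under the action, so it depends only on the difference of the indices,
  and \<open>D X Y\<close> collects the differences that occur from \<open>X\<close> to \<open>Y\<close>. Integer indices instead of residues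
  turn the action into addition and leave all reduction to the periodicity of \<open>D\<close>.
\<close>

locale indexing =
  fixes \<Gamma> :: "'a pair_pre_digraph"
    and n :: "fibre \<Rightarrow> nat"
    and D :: "fibre \<Rightarrow> fibre \<Rightarrow> int set"
    and \<phi> :: "fibre \<Rightarrow> int \<Rightarrow> 'a"
  assumes pseudo: "pair_pseudo_graph \<Gamma>"
    and verts: "pverts \<Gamma> = {\<phi> X i | X i. 0 < n X}"
    and eq_iff: "0 < n X \<Longrightarrow> 0 < n Y \<Longrightarrow> \<phi> X i = \<phi> Y j \<longleftrightarrow> X = Y \<and> int (n X) dvd i - j"
    and arc_iff: "0 < n X \<Longrightarrow> 0 < n Y \<Longrightarrow> (\<phi> X i, \<phi> Y j) \<in> parcs \<Gamma> \<longleftrightarrow> j - i \<in> D X Y"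
begin

lemma arc_cases:
  assumes "(u, v) \<in> parcs \<Gamma>"
  obtains X i Y j where "0 < n X" "0 < n Y" "u = \<phi> X i" "v = \<phi> Y j" "j - i \<in> D X Y"
proof -
  interpret pair_pseudo_graph \<Gamma> by (rule pseudo)
  have "u \<in> pverts \<Gamma>" "v \<in> pverts \<Gamma>" using assms by (auto dest: in_arcsD1 in_arcsD2)
  then obtain X i Y j where "0 < n X" "0 < n Y" "u = \<phi> X i" "v = \<phi> Y j"
    unfolding verts by auto
  then show thesis using that assms arc_iff by auto
qed

lemma diff_sym:
  assumes "0 < n X" "0 < n Y"
  shows "- t \<in> D Y X \<longleftrightarrow> t \<in> D X Y"
proof -
  have "(\<phi> X 0, \<phi> Y t) \<in> parcs \<Gamma> \<longleftrightarrow> (\<phi> Y t, \<phi> X 0) \<in> parcs \<Gamma>"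
    using arcs_sym[OF pseudo] by blast
  then show ?thesis using assms by (simp add: arc_iff)
qed

text \<open>
  The period of either orbit may be added to a difference, hence by Bezout so may their gcd.
\<close>

lemma diff_cong:
  assumes "0 < n X" "0 < n Y" "int (gcd (n X) (n Y)) dvd s - t"
  shows "s \<in> D X Y \<longleftrightarrow> t \<in> D X Y"
proof -
  from assms(3) obtain k where k: "s - t = int (gcd (n X) (n Y)) * k" by (elim dvdE)
  obtain a b where ab: "a * int (n X) + b * int (n Y) = gcd (int (n X)) (int (n Y))"
    using bezout_int by blast
  have st: "s = t + k * a * int (n X) + k * b * int (n Y)"
    using k by (simp flip: ab gcd_int_int_eq add: algebra_simps)
  have "s \<in> D X Y \<longleftrightarrow> (\<phi> X (- k * a * int (n X)), \<phi> Y (t + k * b * int (n Y))) \<in> parcs \<Gamma>"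
    using assms by (simp add: arc_iff st algebra_simps)
  also have "\<phi> X (- k * a * int (n X)) = \<phi> X 0" using assms by (simp add: eq_iff)
  also have "\<phi> Y (t + k * b * int (n Y)) = \<phi> Y t" using assms by (simp add: eq_iff)
  finally show ?thesis using assms by (simp add: arc_iff)
qed

lemma pair_graph_iff: "pair_graph \<Gamma> \<longleftrightarrow> (\<forall>X. 0 < n X \<longrightarrow> 0 \<notin> D X X)"
proof -
  have "(\<exists>v. (v, v) \<in> parcs \<Gamma>) \<longleftrightarrow> (\<exists>X. 0 < n X \<and> 0 \<in> D X X)"
  proof
    assume "\<exists>v. (v, v) \<in> parcs \<Gamma>"
    then obtain v where v: "(v, v) \<in> parcs \<Gamma>" ..
    then obtain X i Y j where "0 < n X" "v = \<phi> X i" by (elim arc_cases)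
    then show "\<exists>X. 0 < n X \<and> 0 \<in> D X X" using v arc_iff[of X X i i] by auto
  next
    assume "\<exists>X. 0 < n X \<and> 0 \<in> D X X"
    then obtain X where "0 < n X" "0 \<in> D X X" by auto
    then have "(\<phi> X 0, \<phi> X 0) \<in> parcs \<Gamma>" by (simp add: arc_iff)
    then show "\<exists>v. (v, v) \<in> parcs \<Gamma>" ..
  qed
  then show ?thesis using pair_graph_iff_loopfree[OF pseudo] by auto
qed

text \<open>
  A neighbour in the orbit \<open>Y\<close> is determined by the residue of its index difference modulo \<open>n Y\<close>.
\<close>

lemma card_neighbours:
  assumes X: "0 < n X"
  shows "card {w. (\<phi> X i, w) \<in> parcs \<Gamma>} = (\<Sum>Y \<in> {FU, FV, FW}. card (D X Y \<inter> {0..<int (n Y)}))"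
proof -
  let ?A = "SIGMA Y:{FU, FV, FW}. D X Y \<inter> {0..<int (n Y)}"
  have "bij_betw (\<lambda>(Y, t). \<phi> Y (i + t)) ?A {w. (\<phi> X i, w) \<in> parcs \<Gamma>}"
    unfolding bij_betw_def
  proof
    show "inj_on (\<lambda>(Y, t). \<phi> Y (i + t)) ?A"
    proof (rule inj_onI, clarify)
      fix Y t Z s
      assume Y: "t \<in> {0..<int (n Y)}" and Z: "s \<in> {0..<int (n Z)}"
        and eq: "\<phi> Y (i + t) = \<phi> Z (i + s)"
      have "Y = Z" "int (n Y) dvd t - s" using eq Y Z eq_iff[of Y Z] by auto
      moreover from this have "t = s"
        using Y Z zdvd_imp_le[of "int (n Y)" "t - s"] zdvd_imp_le[of "int (n Y)" "s - t"]
        by (cases t s rule: linorder_cases) (auto simp: dvd_diff_commute)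
      ultimately show "Y = Z \<and> t = s" by simp
    qed
    show "(\<lambda>(Y, t). \<phi> Y (i + t)) ` ?A = {w. (\<phi> X i, w) \<in> parcs \<Gamma>}"
    proof (intro equalityI subsetI)
      fix w assume "w \<in> (\<lambda>(Y, t). \<phi> Y (i + t)) ` ?A"
      then obtain Y t where "t \<in> D X Y" "t \<in> {0..<int (n Y)}" "w = \<phi> Y (i + t)" by auto
      then show "w \<in> {w. (\<phi> X i, w) \<in> parcs \<Gamma>}" using X arc_iff[of X Y i "i + t"] by auto
    next
      fix w assume "w \<in> {w. (\<phi> X i, w) \<in> parcs \<Gamma>}"
      then have w: "(\<phi> X i, w) \<in> parcs \<Gamma>" by simp
      then obtain Y j where Y: "0 < n Y" "w = \<phi> Y j" by (elim arc_cases)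
      define t where "t = (j - i) mod int (n Y)"
      have *: "\<phi> Y (i + t) = w"
      proof -
        have "int (n Y) dvd (j - i) mod int (n Y) - (j - i)"
          using mod_eq_dvd_iff mod_mod_trivial by blast
        then show ?thesis using Y by (simp add: eq_iff t_def algebra_simps)
      qed
      then have "t \<in> D X Y" using w X Y arc_iff[of X Y i "i + t"] by simp
      moreover have "Y \<in> {FU, FV, FW}" by (cases Y) auto
      moreover have "t \<in> {0..<int (n Y)}" using Y by (simp add: t_def)
      ultimately show "w \<in> (\<lambda>(Y, t). \<phi> Y (i + t)) ` ?A"
        using * by (auto intro!: image_eqI[of _ _ "(Y, t)"])
    qed
  qed
  then have "card {w. (\<phi> X i, w) \<in> parcs \<Gamma>} = card ?A" by (simp add: bij_betw_same_card)
  also have "\<dots> = (\<Sum>Y \<in> {FU, FV, FW}. card (D X Y \<inter> {0..<int (n Y)}))"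
    by (subst card_SigmaI) auto
  finally show ?thesis .
qed

lemma cubic_iff:
  "cubic \<Gamma> \<longleftrightarrow>
    (\<forall>X. 0 < n X \<longrightarrow> (\<Sum>Y \<in> {FU, FV, FW}. card (D X Y \<inter> {0..<int (n Y)})) = 3)"
proof -
  have "cubic \<Gamma> \<longleftrightarrow> (\<forall>X i. 0 < n X \<longrightarrow> card {w. (\<phi> X i, w) \<in> parcs \<Gamma>} = 3)"
    unfolding cubic_iff_card_neighbours verts by blast
  then show ?thesis using card_neighbours by (metis (no_types, lifting))
qed

text \<open>
  Walks can be translated, because adding \<open>k\<close> to all indices is an automorphism.
\<close>

lemma reachable_shift:
  assumes "(\<phi> X i, \<phi> Y j) \<in> (parcs \<Gamma>)\<^sup>*" "0 < n X" "0 < n Y"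
  shows "(\<phi> X (i + k), \<phi> Y (j + k)) \<in> (parcs \<Gamma>)\<^sup>*"
proof -
  have "\<forall>Y j. 0 < n Y \<longrightarrow> v = \<phi> Y j \<longrightarrow> (\<phi> X (i + k), \<phi> Y (j + k)) \<in> (parcs \<Gamma>)\<^sup>*"
    if "(\<phi> X i, v) \<in> (parcs \<Gamma>)\<^sup>*" for v
    using that
  proof (induction rule: rtrancl_induct)
    case base
    show ?case
    proof (intro allI impI)
      fix Y j assume "0 < n Y" "\<phi> X i = \<phi> Y j"
      then have "X = Y" "int (n X) dvd (i + k) - (j + k)" using assms(2) by (auto simp: eq_iff)
      then have "\<phi> X (i + k) = \<phi> Y (j + k)" using assms(2) eq_iff by blast
      then show "(\<phi> X (i + k), \<phi> Y (j + k)) \<in> (parcs \<Gamma>)\<^sup>*" by simp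
    qed
  next
    case (step u v)
    show ?case
    proof (intro allI impI)
      fix Y j assume Y: "0 < n Y" "v = \<phi> Y j"
      obtain Z l where Z: "0 < n Z" "u = \<phi> Z l" using step(2) by (elim arc_cases)
      have "(\<phi> Z (l + k), \<phi> Y (j + k)) \<in> parcs \<Gamma>"
        using step(2) Y Z arc_iff[of Z Y] by simp
      moreover have "(\<phi> X (i + k), \<phi> Z (l + k)) \<in> (parcs \<Gamma>)\<^sup>*" using step.IH Z by blast
      ultimately show "(\<phi> X (i + k), \<phi> Y (j + k)) \<in> (parcs \<Gamma>)\<^sup>*" by (rule rtrancl.rtrancl_into_rtrancl[rotated])
    qed
  qed
  then show ?thesis using assms by blast
qed

lemma reachable_sym: "(u, v) \<in> (parcs \<Gamma>)\<^sup>* \<Longrightarrow> (v, u) \<in> (parcs \<Gamma>)\<^sup>*"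
  by (metis arcs_sym pseudo sym_rtrancl symD symI)

text \<open>
  If \<open>d\<close> divides all sizes and all differences, the residue of the index modulo \<open>d\<close> is constant on
  connected components. Conversely, the differences realised by walks from \<open>C\<close> back to \<open>C\<close> form a
  subgroup of the integers. The arcs of difference \<open>0\<close> from \<open>C\<close> allow every walk to be prolonged
  into one that starts and ends in \<open>C\<close> without changing its total difference, so this subgroup
  contains all sizes and all differences, and its generator is a common divisor.
\<close>

lemma connected_iff_gcd:
  assumes C: "0 < n C"
    and star: "\<And>X. 0 < n X \<Longrightarrow> X \<noteq> C \<Longrightarrow> 0 \<in> D C X"
  shows "connected (with_proj \<Gamma>) \<longleftrightarrow>
    (\<forall>d. (\<forall>X. 0 < n X \<longrightarrow> d dvd int (n X)) \<and>
         (\<forall>X Y. 0 < n X \<longrightarrow> 0 < n Y \<longrightarrow> (\<forall>t \<in> D X Y. d dvd t)) \<longrightarrow> is_unit d)"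
    (is "_ \<longleftrightarrow> (\<forall>d. ?common d \<longrightarrow> is_unit d)")
proof
  assume conn: "connected (with_proj \<Gamma>)"
  show "\<forall>d. ?common d \<longrightarrow> is_unit d"
  proof (intro allI impI)
    fix d assume d: "?common d"
    \<comment> \<open>The residue of the index modulo \<open>d\<close> is constant along arcs, hence on the whole graph.\<close>
    have "(\<phi> C 0, \<phi> C 1) \<in> (parcs \<Gamma>)\<^sup>*"
      using conn C unfolding connected_iff_rtrancl[OF pseudo] verts by blast
    then have "\<forall>Y j. 0 < n Y \<longrightarrow> \<phi> C 1 = \<phi> Y j \<longrightarrow> d dvd j"
    proof (induction rule: rtrancl_induct)
      case base
      then show ?case using d C by (auto simp: eq_iff dvd_trans)
    next
      case (step u v)
      show ?case
      proof (intro allI impI)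
        fix Y j assume Y: "0 < n Y" "v = \<phi> Y j"
        obtain Z l where Z: "0 < n Z" "u = \<phi> Z l" using step(2) by (elim arc_cases)
        then have "j - l \<in> D Z Y" using step(2) Y by (simp add: arc_iff)
        then have "d dvd j - l" using d Y Z by blast
        moreover have "d dvd l" using step.IH Z by blast
        ultimately show "d dvd j" by (metis dvd_add diff_add_cancel)
      qed
    qed
    then have "d dvd 1" using C by blast
    then show "is_unit d" .
  qed
next
  assume unit: "\<forall>d. ?common d \<longrightarrow> is_unit d"
  let ?reach = "\<lambda>X Y t. (\<phi> X 0, \<phi> Y t) \<in> (parcs \<Gamma>)\<^sup>*"
  define H where "H = {t. ?reach C C t}"
  have trans: "?reach X Z (s + t)" if "?reach X Y s" "?reach Y Z t" "0 < n X" "0 < n Y" "0 < n Z" for X Y Z s t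
    using that reachable_shift[of Y 0 Z t s] by (auto simp: add.commute)
  have neg: "?reach Y X (- t)" if "?reach X Y t" "0 < n X" "0 < n Y" for X Y t
    using reachable_sym[OF reachable_shift[of X 0 Y t "- t"]] that by simp
  have star': "?reach C X 0" if "0 < n X" for X
    using that C star[of X] arc_iff[of C X 0 0] by (cases "X = C") auto
  have to_H: "t \<in> H" if "?reach X Y t" "0 < n X" "0 < n Y" for X Y t
  proof -
    have "?reach C Y (0 + t)" by (rule trans[OF star'[OF that(2)] that(1) C that(2,3)])
    moreover have "?reach Y C (- 0)" by (rule neg[OF star'[OF that(3)] C that(3)])
    ultimately have "?reach C C ((0 + t) + - 0)" by (rule trans[OF _ _ C that(3) C])
    then show ?thesis by (simp add: H_def)
  qed
  have gens: "int (n X) \<in> H" if "0 < n X" for X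
  proof -
    have "\<phi> X (int (n X)) = \<phi> X 0" using that by (simp add: eq_iff)
    then show ?thesis using to_H[of X X "int (n X)"] that by simp
  qed
  obtain p :: nat where p: "0 < p" "\<And>t. t \<in> H \<longleftrightarrow> int p dvd t"
  proof (rule int_subgroup_eq_multiples[of H "int (n C)"])
    show "s + t \<in> H" if "s \<in> H" "t \<in> H" for s t
      using trans[OF _ _ C C C] that by (simp add: H_def)
    show "- t \<in> H" if "t \<in> H" for t
      using neg[OF _ C C] that by (simp add: H_def)
    show "0 < int (n C)" "int (n C) \<in> H" using C gens by simp_all
  qed blast
  have "?common (int p)"
  proof (intro conjI allI impI ballI)
    fix X assume "0 < n X" then show "int p dvd int (n X)" using gens p(2) by blast
  next
    fix X Y t assume XY: "0 < n X" "0 < n Y" "t \<in> D X Y"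
    then have "(\<phi> X 0, \<phi> Y t) \<in> parcs \<Gamma>" by (simp add: arc_iff)
    then show "int p dvd t" using to_H[OF r_into_rtrancl XY(1,2)] p(2) by blast
  qed
  then have "is_unit (int p)" using unit by blast
  then have all: "t \<in> H" for t using p(2) by (simp add: unit_imp_dvd)
  show "connected (with_proj \<Gamma>)"
    unfolding connected_iff_rtrancl[OF pseudo]
  proof (intro conjI ballI)
    show "pverts \<Gamma> \<noteq> {}" using C verts by blast
    fix u v assume "u \<in> pverts \<Gamma>" "v \<in> pverts \<Gamma>"
    then obtain X i Y j where u: "0 < n X" "u = \<phi> X i" and v: "0 < n Y" "v = \<phi> Y j"
      unfolding verts by blast
    have "?reach C C (j - i)" using all by (simp add: H_def)
    have "?reach X Y (j - i)"
    proof -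
      have "?reach X C (- 0)" by (rule neg[OF star'[OF u(1)] C u(1)])
      then have "?reach X C (- 0 + (j - i))"
        by (rule trans[OF _ \<open>?reach C C (j - i)\<close> u(1) C C])
      then have "?reach X Y (- 0 + (j - i) + 0)"
        by (rule trans[OF _ star'[OF v(1)] u(1) C v(1)])
      then show ?thesis by simp
    qed
    then show "(u, v) \<in> (parcs \<Gamma>)\<^sup>*" using reachable_shift[of X 0 Y "j - i" i] u v by simp
  qed
qed

end

section \<open>Cyclic groups of automorphisms\<close>

text \<open>
  Only the closure under inverses needs an argument: a bijection reflects adjacency exactly when its
  inverse preserves it.
\<close>

lemma subgroup_Aut:
  "subgroup {f \<in> Bij (pverts \<Gamma>). \<forall>u \<in> pverts \<Gamma>. \<forall>v \<in> pverts \<Gamma>.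
     (f u, f v) \<in> parcs \<Gamma> \<longleftrightarrow> (u, v) \<in> parcs \<Gamma>} (BijGroup (pverts \<Gamma>))"
    (is "subgroup ?A ?B")
proof (rule group.subgroupI[OF group_BijGroup])
  show "?A \<subseteq> carrier ?B" by (auto simp: BijGroup_def)
  have "(\<lambda>v\<in>pverts \<Gamma>. v) \<in> ?A" by (auto simp: id_Bij)
  then show "?A \<noteq> {}" by blast
next
  fix f assume "f \<in> ?A"
  then have f: "f \<in> Bij (pverts \<Gamma>)"
    and arc: "\<And>u v. u \<in> pverts \<Gamma> \<Longrightarrow> v \<in> pverts \<Gamma> \<Longrightarrow> (f u, f v) \<in> parcs \<Gamma> \<longleftrightarrow> (u, v) \<in> parcs \<Gamma>"
    by blast+
  define g where "g = (\<lambda>v\<in>pverts \<Gamma>. inv_into (pverts \<Gamma>) f v)"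
  have img: "f ` pverts \<Gamma> = pverts \<Gamma>" using f unfolding Bij_def bij_betw_def by blast
  have g: "g v \<in> pverts \<Gamma>" "f (g v) = v" if "v \<in> pverts \<Gamma>" for v
    using inv_into_into[of v f "pverts \<Gamma>"] f_inv_into_f[of v f "pverts \<Gamma>"] that
    unfolding img by (simp_all add: g_def)
  have "(g u, g v) \<in> parcs \<Gamma> \<longleftrightarrow> (u, v) \<in> parcs \<Gamma>" if "u \<in> pverts \<Gamma>" "v \<in> pverts \<Gamma>" for u v
    using arc[OF g(1)[OF that(1)] g(1)[OF that(2)]] unfolding g(2)[OF that(1)] g(2)[OF that(2)] by (rule sym)
  moreover have "g \<in> Bij (pverts \<Gamma>)" unfolding g_def by (rule restrict_inv_into_Bij[OF f])
  ultimately show "inv\<^bsub>?B\<^esub> f \<in> ?A"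
    unfolding inv_BijGroup[OF f] g_def[symmetric] by blast
next
  fix f g assume f: "f \<in> ?A" and g: "g \<in> ?A"
  then have Bij: "f \<in> Bij (pverts \<Gamma>)" "g \<in> Bij (pverts \<Gamma>)" by blast+
  have "compose (pverts \<Gamma>) f g \<in> ?A"
  proof (intro CollectI conjI ballI)
    show "compose (pverts \<Gamma>) f g \<in> Bij (pverts \<Gamma>)" by (rule compose_Bij[OF Bij])
    fix u v assume uv: "u \<in> pverts \<Gamma>" "v \<in> pverts \<Gamma>"
    have "g u \<in> pverts \<Gamma>" "g v \<in> pverts \<Gamma>" using Bij_imp_funcset[OF Bij(2)] uv by blast+
    then show "(compose (pverts \<Gamma>) f g u, compose (pverts \<Gamma>) f g v) \<in> parcs \<Gamma> \<longleftrightarrow> (u, v) \<in> parcs \<Gamma>"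
      using f g uv by (simp add: compose_eq)
  qed
  then show "f \<otimes>\<^bsub>?B\<^esub> g \<in> ?A" using Bij by (simp add: BijGroup_def)
qed

lemma group_Aut: "group (Aut \<Gamma>)"
  unfolding Aut_def by (rule subgroup.subgroup_is_group[OF subgroup_Aut group_BijGroup])

lemma Aut_carrier:
  "f \<in> carrier (Aut \<Gamma>) \<longleftrightarrow> f \<in> extensional (pverts \<Gamma>) \<and> bij_betw f (pverts \<Gamma>) (pverts \<Gamma>) \<and>
     (\<forall>u \<in> pverts \<Gamma>. \<forall>v \<in> pverts \<Gamma>. (f u, f v) \<in> parcs \<Gamma> \<longleftrightarrow> (u, v) \<in> parcs \<Gamma>)"
  by (auto simp: Aut_def Bij_def)

lemma Aut_mult:
  "f \<in> carrier (Aut \<Gamma>) \<Longrightarrow> g \<in> carrier (Aut \<Gamma>) \<Longrightarrow> f \<otimes>\<^bsub>Aut \<Gamma>\<^esub> g = compose (pverts \<Gamma>) f g"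
  by (auto simp: Aut_def BijGroup_def)

lemma Aut_one: "\<one>\<^bsub>Aut \<Gamma>\<^esub> = (\<lambda>v \<in> pverts \<Gamma>. v)"
  by (simp add: Aut_def BijGroup_def)

context indexing
begin

lemma index_in_verts: "0 < n X \<Longrightarrow> \<phi> X i \<in> pverts \<Gamma>"
  using verts by blast

lemma verts_cases:
  assumes "v \<in> pverts \<Gamma>"
  obtains X i where "0 < n X" "v = \<phi> X i"
  using assms verts by blast

definition rotation :: "int \<Rightarrow> 'a \<Rightarrow> 'a" where
  "rotation k = (\<lambda>v \<in> pverts \<Gamma>. THE w. \<exists>X i. 0 < n X \<and> v = \<phi> X i \<and> w = \<phi> X (i + k))"

lemma rotation_index:
  assumes "0 < n X"
  shows "rotation k (\<phi> X i) = \<phi> X (i + k)"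
proof -
  have "(THE w. \<exists>Y j. 0 < n Y \<and> \<phi> X i = \<phi> Y j \<and> w = \<phi> Y (j + k)) = \<phi> X (i + k)"
    using assms by (intro the_equality) (auto simp: eq_iff dvd_diff_commute)
  then show ?thesis using index_in_verts[OF assms] by (simp add: rotation_def)
qed

lemma rotation_in_Aut: "rotation k \<in> carrier (Aut \<Gamma>)"
  unfolding Aut_carrier
proof (intro conjI ballI)
  show "rotation k \<in> extensional (pverts \<Gamma>)" by (simp add: rotation_def)
  show "bij_betw (rotation k) (pverts \<Gamma>) (pverts \<Gamma>)"
  proof (rule bij_betwI[where g = "rotation (- k)"])
    show "rotation k \<in> pverts \<Gamma> \<rightarrow> pverts \<Gamma>" "rotation (- k) \<in> pverts \<Gamma> \<rightarrow> pverts \<Gamma>"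
      by (auto elim!: verts_cases simp: rotation_index index_in_verts)
    show "rotation (- k) (rotation k v) = v" "rotation k (rotation (- k) v) = v" if "v \<in> pverts \<Gamma>" for v
      using that by (auto elim!: verts_cases simp: rotation_index)
  qed
  fix u v assume "u \<in> pverts \<Gamma>" "v \<in> pverts \<Gamma>"
  then show "(rotation k u, rotation k v) \<in> parcs \<Gamma> \<longleftrightarrow> (u, v) \<in> parcs \<Gamma>"
    by (auto elim!: verts_cases simp: rotation_index arc_iff)
qed

lemma rotation_hom: "rotation \<in> hom integer_group (Aut \<Gamma>)"
proof (rule homI)
  show "rotation k \<in> carrier (Aut \<Gamma>)" for k by (rule rotation_in_Aut)
  fix k l :: int
  have "rotation (k + l) v = compose (pverts \<Gamma>) (rotation k) (rotation l) v" for v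
  proof (cases "v \<in> pverts \<Gamma>")
    case True
    then show ?thesis
      unfolding compose_eq[OF True] by (elim verts_cases) (simp add: rotation_index algebra_simps)
  qed (simp add: rotation_def compose_def)
  then show "rotation (k \<otimes>\<^bsub>integer_group\<^esub> l) = rotation k \<otimes>\<^bsub>Aut \<Gamma>\<^esub> rotation l"
    by (simp add: Aut_mult rotation_in_Aut integer_group_def fun_eq_iff)
qed

text \<open>
  The rotations are the image of the integers under a homomorphism, and their orbits are the ranges
  of the maps \<open>\<phi> X\<close>, of which there are at most three.
\<close>

lemma cyclic_aut_group: "\<exists>k \<le> 3. cyclic_aut_group_with_orbits \<Gamma> k"
proof -
  let ?H = "range rotation"
  let ?K = "Aut \<Gamma>\<lparr>carrier := ?H\<rparr>"
  interpret group_hom integer_group "Aut \<Gamma>" rotation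
    by (intro group_hom.intro group_hom_axioms.intro rotation_hom group_Aut group_integer_group)
  have sub: "subgroup ?H (Aut \<Gamma>)" using img_is_subgroup by (simp add: integer_group_def)
  have grp: "group ?K" by (rule subgroup.subgroup_is_group[OF sub group_Aut])
  have "rotation \<in> epi integer_group ?K"
    using rotation_hom by (auto simp: epi_def hom_def integer_group_def)
  then have cyc: "cyclic_group ?K"
    using group.cyclic_group_epimorphic_image[OF group_integer_group _ cyclic_integer_group grp] by blast
  have "orbits ?K (pverts \<Gamma>) (\<lambda>g. g) \<subseteq> (\<lambda>X. range (\<phi> X)) ` {FU, FV, FW}"
  proof
    fix orb assume "orb \<in> orbits ?K (pverts \<Gamma>) (\<lambda>g. g)"
    then obtain v where v: "v \<in> pverts \<Gamma>" "orb = orbit ?K (\<lambda>g. g) v" by (auto simp: orbits_def)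
    then obtain X i where X: "0 < n X" "v = \<phi> X i" by (elim verts_cases)
    then have "orb = range (\<lambda>k. \<phi> X (i + k))"
      unfolding v(2) orbit_def using rotation_index[OF X(1), of _ i] by (auto simp: X(2)) (metis rangeI)
    also have "\<dots> = range (\<phi> X)"
    proof
      show "range (\<phi> X) \<subseteq> range (\<lambda>k. \<phi> X (i + k))"
        by (rule image_subsetI) (rule range_eqI[where x = "_ - i"], simp)
    qed auto
    finally have "orb = range (\<phi> X)" .
    moreover have "X \<in> {FU, FV, FW}" by (cases X) auto
    ultimately show "orb \<in> (\<lambda>X. range (\<phi> X)) ` {FU, FV, FW}" by blast
  qed
  then have "card (orbits ?K (pverts \<Gamma>) (\<lambda>g. g)) \<le> card ((\<lambda>X. range (\<phi> X)) ` {FU, FV, FW})"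
    by (rule card_mono[rotated]) simp
  also have "\<dots> \<le> card {FU, FV, FW}" by (rule card_image_le) simp
  also have "\<dots> = 3" by simp
  finally show ?thesis unfolding cyclic_aut_group_with_orbits_def using sub cyc by blast
qed

end

text \<open>
  A base point is chosen in every orbit, and the orbits, being at most three, are labelled injectively
  by fibres.
\<close>

lemma exists_indexing:
  assumes pseudo: "pair_pseudo_graph \<Gamma>"
    and cyc: "cyclic_aut_group_with_orbits \<Gamma> k" "k \<le> 3"
  shows "\<exists>n D \<phi>. indexing \<Gamma> n D \<phi>"
proof -
  interpret pair_pseudo_graph \<Gamma> by fact
  obtain H where sub: "subgroup H (Aut \<Gamma>)" and cyclic: "cyclic_group (Aut \<Gamma>\<lparr>carrier := H\<rparr>)"
    and orb: "card (orbits (Aut \<Gamma>\<lparr>carrier := H\<rparr>) (pverts \<Gamma>) (\<lambda>g. g)) = k"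
    using cyc(1) unfolding cyclic_aut_group_with_orbits_def by (elim exE conjE)
  define K where "K = Aut \<Gamma>\<lparr>carrier := H\<rparr>"
  interpret K: group K unfolding K_def by (rule subgroup.subgroup_is_group[OF sub group_Aut])
  obtain x where x: "x \<in> carrier K" "carrier K = range (\<lambda>t::int. x [^]\<^bsub>K\<^esub> t)"
    using cyclic unfolding K_def[symmetric] K.cyclic_group by (elim bexE)
  define a where "a t = x [^]\<^bsub>K\<^esub> t" for t :: int
  have aut: "a t \<in> carrier (Aut \<Gamma>)" for t
  proof -
    have "a t \<in> carrier K" unfolding a_def by (rule K.int_pow_closed[OF x(1)])
    then have "a t \<in> H" by (simp add: K_def)
    then show ?thesis using subgroup.subset[OF sub] by blast
  qed
  have a_mem: "a t v \<in> pverts \<Gamma>" if "v \<in> pverts \<Gamma>" for t v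
    using aut[of t] that bij_betwE unfolding Aut_carrier by blast
  have a_0: "a 0 v = v" if "v \<in> pverts \<Gamma>" for v
  proof -
    have "a 0 = \<one>\<^bsub>K\<^esub>" by (simp add: a_def)
    also have "\<dots> = (\<lambda>v \<in> pverts \<Gamma>. v)" by (simp add: K_def Aut_one)
    finally show ?thesis using that by simp
  qed
  have a_add: "a (s + t) v = a s (a t v)" if "v \<in> pverts \<Gamma>" for s t v
  proof -
    have "a (s + t) = a s \<otimes>\<^bsub>K\<^esub> a t" unfolding a_def by (rule K.int_pow_mult[OF x(1)])
    also have "\<dots> = compose (pverts \<Gamma>) (a s) (a t)" using Aut_mult[OF aut aut] by (simp add: K_def)
    finally show ?thesis using that by (simp add: compose_eq)
  qed
  have a_arc: "(a t u, a t v) \<in> parcs \<Gamma> \<longleftrightarrow> (u, v) \<in> parcs \<Gamma>"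
    if "u \<in> pverts \<Gamma>" "v \<in> pverts \<Gamma>" for t u v
    using aut[of t] that by (simp add: Aut_carrier)
  define orb where "orb v = range (\<lambda>t. a t v)" for v
  have orbits: "orbits K (pverts \<Gamma>) (\<lambda>g. g) = orb ` pverts \<Gamma>"
  proof -
    have "orbit K (\<lambda>g. g) v = orb v" for v
    proof -
      have "orbit K (\<lambda>g. g) v = (\<lambda>g. g v) ` carrier K"
        unfolding orbit_def by (simp only: Setcompr_eq_image Collect_mem_eq)
      then show ?thesis by (simp only: x(2) image_image orb_def a_def)
    qed
    then show ?thesis unfolding orbits_def by (simp only: Setcompr_eq_image Collect_mem_eq)
  qed
  have "card (orb ` pverts \<Gamma>) \<le> card {FU, FV, FW}"
    using orb cyc(2) unfolding K_def[symmetric] orbits by simp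
  then have "\<exists>f. f ` orb ` pverts \<Gamma> \<subseteq> {FU, FV, FW} \<and> inj_on f (orb ` pverts \<Gamma>)"
    by (intro card_le_inj finite_imageI pair_finite_verts) simp_all
  then obtain f :: "'a set \<Rightarrow> fibre" where f: "inj_on f (orb ` pverts \<Gamma>)" by metis
  \<comment> \<open>In a finite set every orbit of the integers is periodic.\<close>
  have "\<exists>p>0. \<forall>t. a t v = v \<longleftrightarrow> int p dvd t" if v: "v \<in> pverts \<Gamma>" for v
  proof -
    have neg: "a (- t) v = v" if "a t v = v" for t using a_add[OF v, of "- t" t] a_0[OF v] that by simp
    have "range (\<lambda>t. a t v) \<subseteq> pverts \<Gamma>" using a_mem[OF v] by blast
    then have "finite (range (\<lambda>t. a t v))" using pair_finite_verts by (rule finite_subset)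
    then have "\<not> inj (\<lambda>t. a t v)" using finite_imageD[of "\<lambda>t. a t v" UNIV] by auto
    then obtain s t where "s < t" "a s v = a t v"
      unfolding inj_on_def by (metis linorder_neqE)
    then have "a (t - s) v = v"
      using a_add[OF v, of "- s" t] a_add[OF v, of "- s" s] a_0[OF v] by simp
    with \<open>s < t\<close> have pos: "0 < t - s" "t - s \<in> {t. a t v = v}" by simp_all
    obtain p where "0 < p" "\<And>t. t \<in> {t. a t v = v} \<longleftrightarrow> int p dvd t"
    proof (rule int_subgroup_eq_multiples[OF _ _ pos])
      show "s + t \<in> {t. a t v = v}" if "s \<in> {t. a t v = v}" "t \<in> {t. a t v = v}" for s t
        using a_add[OF v, of s t] that by simp
      show "- t \<in> {t. a t v = v}" if "t \<in> {t. a t v = v}" for t using neg that by simp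
    qed blast
    then show ?thesis by auto
  qed
  then obtain p where p: "\<forall>v \<in> pverts \<Gamma>. 0 < p v \<and> (\<forall>t. a t v = v \<longleftrightarrow> int (p v) dvd t)"
    using bchoice[of "pverts \<Gamma>" "\<lambda>v p. 0 < p \<and> (\<forall>t. a t v = v \<longleftrightarrow> int p dvd t)"] by blast
  define b where "b X = (SOME v. v \<in> pverts \<Gamma> \<and> f (orb v) = X)" for X
  \<comment> \<open>A fibre that labels no orbit gets size \<open>0\<close>, whatever base point the choice returns.\<close>
  define n where "n X = (if X \<in> f ` orb ` pverts \<Gamma> then p (b X) else 0)" for X
  define \<phi> where "\<phi> X i = a i (b X)" for X i
  have b: "b X \<in> pverts \<Gamma> \<and> f (orb (b X)) = X" if "0 < n X" for X
  proof -
    have "\<exists>v. v \<in> pverts \<Gamma> \<and> f (orb v) = X" using that by (auto simp: n_def split: if_splits)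
    then show ?thesis unfolding b_def by (rule someI_ex)
  qed
  have n: "a t (b X) = b X \<longleftrightarrow> int (n X) dvd t" if "0 < n X" for X t
  proof -
    have "n X = p (b X)" using that by (simp add: n_def split: if_splits)
    then show ?thesis using p b[OF that] by simp
  qed
  have orb_shift: "orb (a i v) = orb v" if "v \<in> pverts \<Gamma>" for i v
  proof -
    have "orb (a i v) = range (\<lambda>t. a (t + i) v)" using that by (simp add: orb_def a_add)
    also have "\<dots> = orb v"
    proof
      show "orb v \<subseteq> range (\<lambda>t. a (t + i) v)"
        unfolding orb_def by (rule image_subsetI) (rule range_eqI[where x = "_ - i"], simp)
    qed (auto simp: orb_def)
    finally show ?thesis .
  qed
  have "indexing \<Gamma> n (\<lambda>X Y. {t. (b X, a t (b Y)) \<in> parcs \<Gamma>}) \<phi>"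
  proof (rule indexing.intro)
    show "pair_pseudo_graph \<Gamma>" by (rule pseudo)
    show "pverts \<Gamma> = {\<phi> X i |X i. 0 < n X}"
    proof (intro equalityI subsetI)
      fix v assume v: "v \<in> pverts \<Gamma>"
      let ?X = "f (orb v)"
      have "0 < n ?X"
      proof -
        have "b ?X \<in> pverts \<Gamma> \<and> f (orb (b ?X)) = ?X" unfolding b_def by (rule someI[of _ v]) (use v in simp)
        then show ?thesis using v p by (auto simp: n_def)
      qed
      then have "orb (b ?X) = orb v" using b[of ?X] f v by (auto dest: inj_onD)
      moreover have "v \<in> orb v" using a_0[OF v] unfolding orb_def by (metis rangeI)
      ultimately have "v \<in> orb (b ?X)" by simp
      then obtain i where "v = \<phi> ?X i" unfolding orb_def \<phi>_def by blast
      then show "v \<in> {\<phi> X i |X i. 0 < n X}" using \<open>0 < n ?X\<close> by blast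
    next
      fix v assume "v \<in> {\<phi> X i |X i. 0 < n X}"
      then show "v \<in> pverts \<Gamma>" using b a_mem by (auto simp: \<phi>_def)
    qed
    fix X Y i j assume XY: "0 < n X" "0 < n Y"
    have move: "a (- i) (a i (b X)) = b X" "a (- i) (a j (b Y)) = a (j - i) (b Y)"
      using a_add[of "b X" "- i" i] a_add[of "b Y" "- i" j] b[OF XY(1)] b[OF XY(2)] a_0 by simp_all
    show "(\<phi> X i, \<phi> Y j) \<in> parcs \<Gamma> \<longleftrightarrow> j - i \<in> {t. (b X, a t (b Y)) \<in> parcs \<Gamma>}"
      using a_arc[of "a i (b X)" "a j (b Y)" "- i"] move b[OF XY(1)] b[OF XY(2)] a_mem
      by (simp add: \<phi>_def)
    show "\<phi> X i = \<phi> Y j \<longleftrightarrow> X = Y \<and> int (n X) dvd i - j"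
    proof -
      have XeqY: "X = Y" if "\<phi> X i = \<phi> Y j"
      proof -
        have "orb (b X) = orb (b Y)"
          using that orb_shift[of "b X" i] orb_shift[of "b Y" j] b[OF XY(1)] b[OF XY(2)]
          by (simp add: \<phi>_def)
        then show ?thesis using b[OF XY(1)] b[OF XY(2)] by metis
      qed
      have "\<phi> X i = \<phi> X j \<longleftrightarrow> a (i - j) (b X) = b X"
      proof
        assume "\<phi> X i = \<phi> X j"
        then have "a (- j) (a i (b X)) = a (- j) (a j (b X))" by (simp add: \<phi>_def)
        then show "a (i - j) (b X) = b X"
          using a_add[of "b X" "- j" i] a_add[of "b X" "- j" j] b[OF XY(1)] a_0 by simp
      next
        assume "a (i - j) (b X) = b X"
        then show "\<phi> X i = \<phi> X j"
          using a_add[of "b X" j "i - j"] b[OF XY(1)] by (simp add: \<phi>_def)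
      qed
      then show ?thesis using XeqY n[OF XY(1)] by blast
    qed
  qed
  then show ?thesis by blast
qed

section \<open>Isomorphic graphs have the same indexings\<close>

text \<open>
  In a digraph isomorphism the map on arcs is determined by the map on vertices, since an arc is the
  pair of its ends.
\<close>

lemma graph_iso_iff:
  assumes "pair_pseudo_graph \<Gamma>" "pair_pseudo_graph \<Gamma>'"
  shows "graph_iso \<Gamma> \<Gamma>' \<longleftrightarrow> (\<exists>f. bij_betw f (pverts \<Gamma>) (pverts \<Gamma>') \<and>
    (\<forall>u \<in> pverts \<Gamma>. \<forall>v \<in> pverts \<Gamma>. (f u, f v) \<in> parcs \<Gamma>' \<longleftrightarrow> (u, v) \<in> parcs \<Gamma>))"
    (is "_ \<longleftrightarrow> (\<exists>f. ?iso f)")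
proof
  interpret G: pair_pseudo_graph \<Gamma> by fact
  assume "graph_iso \<Gamma> \<Gamma>'"
  then obtain h where h: "pre_digraph.digraph_isomorphism (with_proj \<Gamma>) h"
    and eq: "with_proj \<Gamma>' = app_iso h (with_proj \<Gamma>)"
    by (auto simp: digraph_iso_def)
  let ?f = "iso_verts h"
  have V: "pverts \<Gamma>' = ?f ` pverts \<Gamma>" and A: "parcs \<Gamma>' = iso_arcs h ` parcs \<Gamma>"
    and ends: "iso_tail h = fst" "iso_head h = snd"
    using arg_cong[OF eq, of verts] arg_cong[OF eq, of arcs] arg_cong[OF eq, of tail] arg_cong[OF eq, of head]
    by simp_all
  have inj: "inj_on ?f (pverts \<Gamma>)"
    using h by (simp add: pre_digraph.digraph_isomorphism_def)
  have arcs: "iso_arcs h (u, v) = (?f u, ?f v)" if "(u, v) \<in> parcs \<Gamma>" for u v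
  proof -
    have "?f u = fst (iso_arcs h (u, v))" "?f v = snd (iso_arcs h (u, v))"
      using h that by (force simp: pre_digraph.digraph_isomorphism_def ends)+
    then show ?thesis by simp
  qed
  have "?iso ?f"
  proof (intro conjI ballI)
    show "bij_betw ?f (pverts \<Gamma>) (pverts \<Gamma>')" using inj V by (simp add: bij_betw_def)
    fix u v assume uv: "u \<in> pverts \<Gamma>" "v \<in> pverts \<Gamma>"
    show "(?f u, ?f v) \<in> parcs \<Gamma>' \<longleftrightarrow> (u, v) \<in> parcs \<Gamma>"
    proof
      assume "(?f u, ?f v) \<in> parcs \<Gamma>'"
      then obtain x y where xy: "(x, y) \<in> parcs \<Gamma>" "(?f u, ?f v) = iso_arcs h (x, y)"
        unfolding A by (metis imageE surj_pair)
      have "x \<in> pverts \<Gamma>" "y \<in> pverts \<Gamma>" using xy(1) G.in_arcsD1 G.in_arcsD2 by blast+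
      then have "u = x" "v = y" using xy arcs[OF xy(1)] uv inj by (auto dest: inj_onD)
      then show "(u, v) \<in> parcs \<Gamma>" using xy by simp
    next
      assume "(u, v) \<in> parcs \<Gamma>"
      then show "(?f u, ?f v) \<in> parcs \<Gamma>'" unfolding A using arcs[of u v] by (metis imageI)
    qed
  qed
  then show "\<exists>f. ?iso f" by blast
next
  interpret G: pair_pseudo_graph \<Gamma> by fact
  interpret G': pair_pseudo_graph \<Gamma>' by fact
  assume "\<exists>f. ?iso f"
  then obtain f where bij: "bij_betw f (pverts \<Gamma>) (pverts \<Gamma>')"
    and arc: "\<And>u v. u \<in> pverts \<Gamma> \<Longrightarrow> v \<in> pverts \<Gamma> \<Longrightarrow> (f u, f v) \<in> parcs \<Gamma>' \<longleftrightarrow> (u, v) \<in> parcs \<Gamma>"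
    by blast
  have inj: "inj_on f (pverts \<Gamma>)" and V: "f ` pverts \<Gamma> = pverts \<Gamma>'"
    using bij by (simp_all add: bij_betw_def)
  let ?h = "\<lparr>iso_verts = f, iso_arcs = (\<lambda>(u, v). (f u, f v)), iso_head = snd, iso_tail = fst\<rparr>"
  have sub: "parcs \<Gamma> \<subseteq> pverts \<Gamma> \<times> pverts \<Gamma>"
    using G.in_arcsD1 G.in_arcsD2 by (meson mem_Sigma_iff subrelI)
  have "inj_on (\<lambda>(u, v). (f u, f v)) (pverts \<Gamma> \<times> pverts \<Gamma>)"
    using inj by (auto simp: inj_on_def)
  then have "inj_on (\<lambda>(u, v). (f u, f v)) (parcs \<Gamma>)" using sub by (rule inj_on_subset)
  then have "pre_digraph.digraph_isomorphism (with_proj \<Gamma>) ?h"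
    using inj G.wf_digraph_axioms by (simp add: pre_digraph.digraph_isomorphism_def split: prod.split)
  moreover have "parcs \<Gamma>' = (\<lambda>(u, v). (f u, f v)) ` parcs \<Gamma>"
  proof (intro equalityI subsetI)
    fix e assume e: "e \<in> parcs \<Gamma>'"
    obtain x y where xy: "e = (x, y)" by (cases e)
    have "x \<in> pverts \<Gamma>'" "y \<in> pverts \<Gamma>'" using e xy G'.in_arcsD1 G'.in_arcsD2 by blast+
    then obtain u v where "u \<in> pverts \<Gamma>" "v \<in> pverts \<Gamma>" "x = f u" "y = f v"
      unfolding V[symmetric] by blast
    then show "e \<in> (\<lambda>(u, v). (f u, f v)) ` parcs \<Gamma>"
      using arc[of u v] e xy by (intro image_eqI[of _ _ "(u, v)"]) auto
  next
    fix e assume "e \<in> (\<lambda>(u, v). (f u, f v)) ` parcs \<Gamma>"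
    then obtain u v where "(u, v) \<in> parcs \<Gamma>" "e = (f u, f v)" by auto
    moreover from this have "u \<in> pverts \<Gamma>" "v \<in> pverts \<Gamma>" using sub by blast+
    ultimately show "e \<in> parcs \<Gamma>'" using arc by simp
  qed
  then have "with_proj \<Gamma>' = app_iso ?h (with_proj \<Gamma>)"
    by (simp add: with_proj_def app_iso_def V)
  ultimately show "graph_iso \<Gamma> \<Gamma>'" unfolding digraph_iso_def by blast
qed

lemma indexing_transport:
  assumes "indexing \<Gamma>' n D \<phi>" and pseudo: "pair_pseudo_graph \<Gamma>"
    and bij: "bij_betw f (pverts \<Gamma>) (pverts \<Gamma>')"
    and arc: "\<And>u v. u \<in> pverts \<Gamma> \<Longrightarrow> v \<in> pverts \<Gamma> \<Longrightarrow> (f u, f v) \<in> parcs \<Gamma>' \<longleftrightarrow> (u, v) \<in> parcs \<Gamma>"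
  shows "indexing \<Gamma> n D (\<lambda>X i. inv_into (pverts \<Gamma>) f (\<phi> X i))"
proof -
  interpret I: indexing \<Gamma>' n D \<phi> by fact
  let ?g = "inv_into (pverts \<Gamma>) f"
  have bij': "bij_betw ?g (pverts \<Gamma>') (pverts \<Gamma>)" by (rule bij_betw_inv_into[OF bij])
  have g: "?g v \<in> pverts \<Gamma>" "f (?g v) = v" if "v \<in> pverts \<Gamma>'" for v
    using bij_betw_apply[OF bij' that] bij_betw_inv_into_right[OF bij that] by simp_all
  have inj: "?g u = ?g v \<longleftrightarrow> u = v" if "u \<in> pverts \<Gamma>'" "v \<in> pverts \<Gamma>'" for u v
    using g(2)[OF that(1)] g(2)[OF that(2)] by metis
  show ?thesis
  proof (rule indexing.intro)
    show "pair_pseudo_graph \<Gamma>" by fact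
    have "pverts \<Gamma> = ?g ` pverts \<Gamma>'" using bij' by (simp add: bij_betw_def)
    then show "pverts \<Gamma> = {?g (\<phi> X i) |X i. 0 < n X}" unfolding I.verts by blast
    fix X Y i j assume XY: "0 < n X" "0 < n Y"
    note V = I.index_in_verts[OF XY(1), of i] I.index_in_verts[OF XY(2), of j]
    show "?g (\<phi> X i) = ?g (\<phi> Y j) \<longleftrightarrow> X = Y \<and> int (n X) dvd i - j"
      unfolding inj[OF V] by (rule I.eq_iff[OF XY])
    show "(?g (\<phi> X i), ?g (\<phi> Y j)) \<in> parcs \<Gamma> \<longleftrightarrow> j - i \<in> D X Y"
      using arc[OF g(1)[OF V(1)] g(1)[OF V(2)]] I.arc_iff[OF XY, of i j]
      unfolding g(2)[OF V(1)] g(2)[OF V(2)] by simp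
  qed
qed

text \<open>
  The sizes and the differences determine the graph: vertices with equal indices correspond.
\<close>

lemma indexings_isomorphic:
  assumes "indexing \<Gamma> n D \<phi>" "indexing \<Gamma>' n' D' \<phi>'"
    and n: "\<And>X. n X = n' X"
    and D: "\<And>X Y. 0 < n X \<Longrightarrow> 0 < n Y \<Longrightarrow> D X Y = D' X Y"
  shows "graph_iso \<Gamma> \<Gamma>'"
proof -
  interpret I: indexing \<Gamma> n D \<phi> by fact
  interpret J: indexing \<Gamma>' n' D' \<phi>' by fact
  have same: "\<phi>' X i = \<phi>' Y j \<longleftrightarrow> \<phi> X i = \<phi> Y j" if "0 < n X" "0 < n Y" for X Y i j
    using I.eq_iff[OF that] J.eq_iff[OF that[unfolded n]] by (simp add: n)
  have "\<exists>w. \<exists>X i. 0 < n X \<and> v = \<phi> X i \<and> w = \<phi>' X i" if "v \<in> pverts \<Gamma>" for v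
    using that by (elim I.verts_cases) blast
  then obtain f where f: "\<And>v. v \<in> pverts \<Gamma> \<Longrightarrow> \<exists>X i. 0 < n X \<and> v = \<phi> X i \<and> f v = \<phi>' X i" by metis
  have f_index: "f (\<phi> X i) = \<phi>' X i" if X: "0 < n X" for X i
  proof -
    obtain Y j where Y: "0 < n Y" "\<phi> X i = \<phi> Y j" "f (\<phi> X i) = \<phi>' Y j"
      using f[OF I.index_in_verts[OF X, of i]] by blast
    then have "\<phi>' X i = \<phi>' Y j" using same[OF X Y(1)] by simp
    then show ?thesis using Y(3) by simp
  qed
  have "bij_betw f (pverts \<Gamma>) (pverts \<Gamma>')"
    unfolding bij_betw_def
  proof
    show "inj_on f (pverts \<Gamma>)"
    proof (rule inj_onI)
      fix u v assume "u \<in> pverts \<Gamma>" "v \<in> pverts \<Gamma>" and eq: "f u = f v"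
      then obtain X i Y j where u: "0 < n X" "u = \<phi> X i" and v: "0 < n Y" "v = \<phi> Y j"
        by (elim I.verts_cases)
      have "\<phi>' X i = \<phi>' Y j" using eq u v f_index by simp
      then show "u = v" using same[OF u(1) v(1)] u(2) v(2) by simp
    qed
    show "f ` pverts \<Gamma> = pverts \<Gamma>'"
      unfolding I.verts J.verts using f_index n by (auto simp: image_iff) metis
  qed
  moreover have "(f u, f v) \<in> parcs \<Gamma>' \<longleftrightarrow> (u, v) \<in> parcs \<Gamma>"
    if uv: "u \<in> pverts \<Gamma>" "v \<in> pverts \<Gamma>" for u v
  proof -
    obtain X i where u: "0 < n X" "u = \<phi> X i" using uv(1) by (elim I.verts_cases)
    obtain Y j where v: "0 < n Y" "v = \<phi> Y j" using uv(2) by (elim I.verts_cases)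
    show ?thesis
      using u v f_index D[OF u(1) v(1)] n I.arc_iff[OF u(1) v(1), of i j] J.arc_iff[of X Y i j] by simp
  qed
  ultimately show ?thesis using graph_iso_iff[OF I.pseudo J.pseudo] by blast
qed

section \<open>Schemes in terms of index differences\<close>

definition coset :: "nat \<Rightarrow> int \<Rightarrow> int set" where
  "coset g r = {t. int g dvd t - r}"

lemma mem_coset [simp]: "t \<in> coset g r \<longleftrightarrow> int g dvd t - r"
  by (simp add: coset_def)

lemma coset_eqI:
  assumes rs: "int g dvd r - s"
  shows "coset g r = coset g s"
proof (rule Set.set_eqI)
  fix t
  have "t - s = (r - s) + (t - r)" by simp
  then show "t \<in> coset g r \<longleftrightarrow> t \<in> coset g s" using dvd_add_right_iff[OF rs, of "t - r"] by simp
qed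

text \<open>
  The index differences from \<open>X\<close> to \<open>Y\<close> along the arcs of a rule. Arcs are used in both directions,
  which is why a shift counts negatively from its second fibre to its first.
\<close>

fun rule_diffs :: "(fibre \<Rightarrow> nat) \<Rightarrow> edge_rule \<Rightarrow> fibre \<Rightarrow> fibre \<Rightarrow> int set" where
  "rule_diffs n (Join A B) X Y =
     (if X = A \<and> Y = B \<or> X = B \<and> Y = A then coset (gcd (n A) (n B)) 0 else {})"
| "rule_diffs n (Shift A B r) X Y =
     (if X = A \<and> Y = B then coset (n A) (int r)
      else if X = B \<and> Y = A then coset (n A) (- int r) else {})"
| "rule_diffs n (Loop A r) X Y =
     (if X = A \<and> Y = A then coset (n A) (int r) \<union> coset (n A) (- int r) else {})"
| "rule_diffs n (Semi A) X Y =
     (if X = A \<and> Y = A then coset (n A) (int (n A div 2)) else {})"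

text \<open>
  Beyond the bounds on the parameter, this asks for the sizes that give the rule its intended meaning
  and valency, and it makes every fibre that a rule mentions nonempty.
\<close>

fun rule_wf :: "(fibre \<Rightarrow> nat) \<Rightarrow> edge_rule \<Rightarrow> bool" where
  "rule_wf n (Join A B) \<longleftrightarrow> A \<noteq> B \<and> 0 < n A \<and> 0 < n B"
| "rule_wf n (Shift A B r) \<longleftrightarrow> A \<noteq> B \<and> n A = n B \<and> r < n A"
| "rule_wf n (Loop A r) \<longleftrightarrow> 0 < r \<and> r < n A \<and> 2 * r \<noteq> n A"
| "rule_wf n (Semi A) \<longleftrightarrow> 0 < n A \<and> even (n A)"

definition scheme_diffs :: "scheme \<Rightarrow> fibre \<Rightarrow> fibre \<Rightarrow> int set" where
  "scheme_diffs S X Y = (\<Union>e \<in> set (rules S). rule_diffs (size_of S) e X Y)"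

definition scheme_wf :: "scheme \<Rightarrow> bool" where
  "scheme_wf S \<longleftrightarrow> (\<forall>e \<in> set (rules S). rule_wf (size_of S) e)"

lemma cong_nat_iff_int_dvd: "[a = b] (mod m) \<longleftrightarrow> int m dvd int a - int b"
  by (simp flip: cong_int_iff add: cong_iff_dvd_diff)

text \<open>
  The symmetric closure changes nothing for a loop, whose residues come in a pair \<open>r\<close>, \<open>-r\<close>, nor for a
  semi rule, as half the size is its own negative.
\<close>

lemma rule_arcs_iff_diffs:
  assumes "rule_wf n e"
  shows "((X, i), (Y, j)) \<in> rule_arcs n e \<union> (rule_arcs n e)\<inverse> \<longleftrightarrow>
    i < n X \<and> j < n Y \<and> int j - int i \<in> rule_diffs n e X Y"
proof (cases e)
  case (Join A B)
  have "int g dvd int a - int b \<longleftrightarrow> int g dvd int b - int a" for g a b by (rule dvd_diff_commute)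
  then show ?thesis using assms by (auto simp: Join cong_nat_iff_int_dvd)
next
  case (Shift A B r)
  have "int a - (int b + int r) = - (int b - int a + int r)" for a b by simp
  then have "int m dvd int a - (int b + int r) \<longleftrightarrow> int m dvd int b - int a + int r" for m a b
    by (metis dvd_minus_iff)
  then show ?thesis using assms by (auto simp: Shift cong_nat_iff_int_dvd algebra_simps)
next
  case (Loop A r)
  have "int a + int r - int b = - (int b - int a - int r)" for a b by simp
  then have "int m dvd int a + int r - int b \<longleftrightarrow> int m dvd int b - int a - int r" for m a b
    by (metis dvd_minus_iff)
  moreover have "int a - (int b + int r) = - (int b - int a + int r)" for a b by simp
  then have "int m dvd int a - (int b + int r) \<longleftrightarrow> int m dvd int b - int a + int r" for m a b
    by (metis dvd_minus_iff)
  ultimately show ?thesis by (auto simp: Loop cong_nat_iff_int_dvd algebra_simps)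
next
  case (Semi A)
  define h where "h = n A div 2"
  have h: "n A = 2 * h" using assms by (simp add: Semi h_def)
  have "int a - int b - int h = - (int b - int a - int h) - int (n A)" for a b by (simp add: h)
  then have "int (n A) dvd int a - int b - int h \<longleftrightarrow> int (n A) dvd int b - int a - int h" for a b
    by (metis dvd_minus_iff dvd_refl dvd_diff_left_iff)
  then have sw: "int (n A) dvd int a - (int b + int h) \<longleftrightarrow> int (n A) dvd int b - (int a + int h)" for a b
    by (simp add: diff_diff_eq)
  show ?thesis
    unfolding Semi rule_arcs.simps rule_diffs.simps h_def[symmetric] cong_nat_iff_int_dvd of_nat_add
    using sw by (auto simp: diff_diff_eq)
qed

lemma scheme_diffs_cong:
  assumes "scheme_wf S" "int (gcd (size_of S X) (size_of S Y)) dvd s - t"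
  shows "s \<in> scheme_diffs S X Y \<longleftrightarrow> t \<in> scheme_diffs S X Y"
proof -
  have coset: "s \<in> coset g r \<longleftrightarrow> t \<in> coset g r" if "g dvd gcd (size_of S X) (size_of S Y)" for g r
  proof -
    have "int g dvd s - t" using assms(2) that by (metis dvd_trans of_nat_dvd_iff)
    moreover have "s - r = (s - t) + (t - r)" by simp
    ultimately show ?thesis by (metis dvd_add_right_iff mem_coset)
  qed
  have "s \<in> rule_diffs (size_of S) e X Y \<longleftrightarrow> t \<in> rule_diffs (size_of S) e X Y"
    if "rule_wf (size_of S) e" for e
    using that
  proof (cases e)
    case (Join A B)
    then show ?thesis using coset[of "gcd (size_of S A) (size_of S B)" 0] by (auto simp: gcd.commute)
  next
    case (Shift A B r)
    then show ?thesis
      using that coset[of "size_of S A" "int r"] coset[of "size_of S A" "- int r"] by auto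
  next
    case (Loop A r)
    then show ?thesis
      using coset[of "size_of S A" "int r"] coset[of "size_of S A" "- int r"] by auto
  next
    case (Semi A)
    then show ?thesis using coset[of "size_of S A"] by auto
  qed
  then show ?thesis using assms(1) by (auto simp: scheme_diffs_def scheme_wf_def)
qed

lemma scheme_arc_iff:
  assumes "scheme_wf S"
  shows "((X, i), (Y, j)) \<in> parcs (scheme_graph S) \<longleftrightarrow>
    i < size_of S X \<and> j < size_of S Y \<and> int j - int i \<in> scheme_diffs S X Y"
proof -
  have "((X, i), (Y, j)) \<in> parcs (scheme_graph S) \<longleftrightarrow>
     (\<exists>e \<in> set (rules S). ((X, i), (Y, j)) \<in> rule_arcs (size_of S) e \<union> (rule_arcs (size_of S) e)\<inverse>)"
    by (auto simp: scheme_graph_def Let_def)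
  also have "\<dots> \<longleftrightarrow> (\<exists>e \<in> set (rules S). i < size_of S X \<and> j < size_of S Y \<and>
      int j - int i \<in> rule_diffs (size_of S) e X Y)"
    using assms rule_arcs_iff_diffs[of "size_of S" _ X i Y j] unfolding scheme_wf_def by blast
  finally show ?thesis by (auto simp: scheme_diffs_def)
qed

lemma pverts_scheme: "pverts (scheme_graph S) = {(X, i). i < size_of S X}"
  by (simp add: scheme_graph_def Let_def)

lemma finite_fibres: "finite (UNIV :: fibre set)"
proof -
  have "(UNIV :: fibre set) = {FU, FV, FW}" using fibre.exhaust by blast
  then show ?thesis by (metis finite.emptyI finite.insertI)
qed

lemma scheme_pseudo_graph:
  assumes "scheme_wf S"
  shows "pair_pseudo_graph (scheme_graph S)"
proof -
  let ?V = "pverts (scheme_graph S)"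
  have "?V = Sigma UNIV (\<lambda>X. {..<size_of S X})" by (auto simp: pverts_scheme)
  then have fin: "finite ?V" using finite_fibres by simp
  have sub: "parcs (scheme_graph S) \<subseteq> ?V \<times> ?V"
    using scheme_arc_iff[OF assms] by (auto simp: pverts_scheme)
  have "sym (parcs (scheme_graph S))"
    by (simp add: scheme_graph_def Let_def sym_Un_converse)
  then show ?thesis
    using sub fin finite_subset[OF sub]
    by (unfold_locales) (auto simp: symmetric_def)
qed

lemma scheme_indexing:
  assumes "scheme_wf S"
  shows "indexing (scheme_graph S) (size_of S) (scheme_diffs S) (\<lambda>X i. (X, nat (i mod int (size_of S X))))"
    (is "indexing _ _ _ ?\<phi>")
proof (rule indexing.intro)
  show "pair_pseudo_graph (scheme_graph S)" by (rule scheme_pseudo_graph[OF assms])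
  show "pverts (scheme_graph S) = {?\<phi> X i |X i. 0 < size_of S X}"
  proof (intro equalityI subsetI)
    fix v assume "v \<in> pverts (scheme_graph S)"
    then obtain X i where v: "v = (X, i)" "i < size_of S X" by (auto simp: pverts_scheme)
    then have "v = ?\<phi> X (int i)" by simp
    then show "v \<in> {?\<phi> X i |X i. 0 < size_of S X}" using v by fastforce
  qed (auto simp: pverts_scheme nat_less_iff)
  fix X Y i j assume XY: "0 < size_of S X" "0 < size_of S Y"
  have "nat (i mod int (size_of S X)) = nat (j mod int (size_of S X)) \<longleftrightarrow> int (size_of S X) dvd i - j"
    using XY by (simp add: eq_nat_nat_iff mod_eq_dvd_iff)
  then show "?\<phi> X i = ?\<phi> Y j \<longleftrightarrow> X = Y \<and> int (size_of S X) dvd i - j" by auto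
  let ?g = "int (gcd (size_of S X) (size_of S Y))"
  have residue: "?g dvd k mod int m - k" if "?g dvd int m" for k m
  proof -
    have "k mod int m - k = - (int m * (k div int m))" by (simp add: minus_mult_div_eq_mod[symmetric])
    then show ?thesis using that by (simp only: dvd_minus_iff dvd_mult2)
  qed
  have "?g dvd (j mod int (size_of S Y) - j) - (i mod int (size_of S X) - i)"
    by (intro dvd_diff residue) simp_all
  then have "?g dvd (j mod int (size_of S Y) - i mod int (size_of S X)) - (j - i)"
    by (simp add: algebra_simps)
  then have "j mod int (size_of S Y) - i mod int (size_of S X) \<in> scheme_diffs S X Y \<longleftrightarrow> j - i \<in> scheme_diffs S X Y"
    by (rule scheme_diffs_cong[OF assms])
  then show "(?\<phi> X i, ?\<phi> Y j) \<in> parcs (scheme_graph S) \<longleftrightarrow> j - i \<in> scheme_diffs S X Y"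
    using XY by (simp add: scheme_arc_iff[OF assms] nat_less_iff)
qed

text \<open>
  From here on scheme graphs are handled only through their sizes and differences.
\<close>

lemma graph_iso_scheme_iff:
  assumes "scheme_wf S" "pair_pseudo_graph \<Gamma>"
  shows "graph_iso \<Gamma> (scheme_graph S) \<longleftrightarrow> (\<exists>\<phi>. indexing \<Gamma> (size_of S) (scheme_diffs S) \<phi>)"
proof
  assume "graph_iso \<Gamma> (scheme_graph S)"
  then obtain f where f: "bij_betw f (pverts \<Gamma>) (pverts (scheme_graph S))"
    "\<forall>u \<in> pverts \<Gamma>. \<forall>v \<in> pverts \<Gamma>. (f u, f v) \<in> parcs (scheme_graph S) \<longleftrightarrow> (u, v) \<in> parcs \<Gamma>"
    unfolding graph_iso_iff[OF assms(2) scheme_pseudo_graph[OF assms(1)]] by (elim exE conjE)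
  have "indexing \<Gamma> (size_of S) (scheme_diffs S)
      (\<lambda>X i. inv_into (pverts \<Gamma>) f (X, nat (i mod int (size_of S X))))"
    using f(2) by (intro indexing_transport[OF scheme_indexing[OF assms(1)] assms(2) f(1)]) simp
  then show "\<exists>\<phi>. indexing \<Gamma> (size_of S) (scheme_diffs S) \<phi>" by blast
next
  assume "\<exists>\<phi>. indexing \<Gamma> (size_of S) (scheme_diffs S) \<phi>"
  then show "graph_iso \<Gamma> (scheme_graph S)"
    using indexings_isomorphic[OF _ scheme_indexing[OF assms(1)]] by blast
qed

section \<open>Relabelling fibres and moving base points\<close>

context indexing
begin

lemma indexing_permute:
  assumes "bij \<pi>"
  shows "indexing \<Gamma> (\<lambda>X. n (\<pi> X)) (\<lambda>X Y. D (\<pi> X) (\<pi> Y)) (\<lambda>X. \<phi> (\<pi> X))"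
proof (rule indexing.intro)
  show "pair_pseudo_graph \<Gamma>" by (rule pseudo)
  show "pverts \<Gamma> = {\<phi> (\<pi> X) i |X i. 0 < n (\<pi> X)}"
  proof (intro equalityI subsetI)
    fix v assume "v \<in> pverts \<Gamma>"
    then obtain X i where X: "0 < n X" "v = \<phi> X i" by (elim verts_cases)
    moreover obtain Y where "X = \<pi> Y" using assms by (metis bij_pointE)
    ultimately show "v \<in> {\<phi> (\<pi> X) i |X i. 0 < n (\<pi> X)}" by blast
  qed (auto simp: index_in_verts)
  fix X Y i j assume XY: "0 < n (\<pi> X)" "0 < n (\<pi> Y)"
  have "\<pi> X = \<pi> Y \<longleftrightarrow> X = Y" using assms by (simp add: bij_def inj_eq)
  then show "\<phi> (\<pi> X) i = \<phi> (\<pi> Y) j \<longleftrightarrow> X = Y \<and> int (n (\<pi> X)) dvd i - j"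
    using eq_iff[OF XY] by simp
  show "(\<phi> (\<pi> X) i, \<phi> (\<pi> Y) j) \<in> parcs \<Gamma> \<longleftrightarrow> j - i \<in> D (\<pi> X) (\<pi> Y)" by (rule arc_iff[OF XY])
qed

lemma indexing_rebase:
  "indexing \<Gamma> n (\<lambda>X Y. {t. t + c Y - c X \<in> D X Y}) (\<lambda>X i. \<phi> X (i + c X))"
proof (rule indexing.intro)
  show "pair_pseudo_graph \<Gamma>" by (rule pseudo)
  show "pverts \<Gamma> = {\<phi> X (i + c X) |X i. 0 < n X}"
  proof (intro equalityI subsetI)
    fix v assume "v \<in> pverts \<Gamma>"
    then obtain X i where X: "0 < n X" "v = \<phi> X i" by (elim verts_cases)
    then have "v = \<phi> X ((i - c X) + c X)" by simp
    with X(1) show "v \<in> {\<phi> X (i + c X) |X i. 0 < n X}" by blast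
  qed (auto simp: index_in_verts)
  fix X Y i j assume XY: "0 < n X" "0 < n Y"
  show "\<phi> X (i + c X) = \<phi> Y (j + c Y) \<longleftrightarrow> X = Y \<and> int (n X) dvd i - j"
    using eq_iff[OF XY, of "i + c X" "j + c Y"] by auto
  show "(\<phi> X (i + c X), \<phi> Y (j + c Y)) \<in> parcs \<Gamma> \<longleftrightarrow> j - i \<in> {t. t + c Y - c X \<in> D X Y}"
    using arc_iff[OF XY, of "i + c X" "j + c Y"] by (simp add: algebra_simps)
qed

end

section \<open>Valency in scheme graphs\<close>

lemma card_coset_Int:
  assumes "0 < g"
  shows "card (coset g r \<inter> {0..<int (k * g)}) = k"
proof -
  define s where "s = r mod int g"
  have s: "0 \<le> s" "s < int g" using assms by (simp_all add: s_def)
  have "coset g r = coset g s"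
    by (rule coset_eqI) (simp add: s_def minus_mod_eq_mult_div)
  moreover have "bij_betw (\<lambda>i. int i * int g + s) {..<k} (coset g s \<inter> {0..<int (k * g)})"
  proof (rule bij_betw_byWitness[where f' = "\<lambda>t. nat (t div int g)"])
    show "\<forall>i\<in>{..<k}. nat ((int i * int g + s) div int g) = i"
      using s assms by simp
    show "\<forall>t\<in>coset g s \<inter> {0..<int (k * g)}. int (nat (t div int g)) * int g + s = t"
    proof
      fix t assume t: "t \<in> coset g s \<inter> {0..<int (k * g)}"
      then have "t mod int g = s" using s by (simp add: mod_eq_dvd_iff[symmetric])
      moreover have "0 \<le> t div int g" using t assms by (simp add: pos_imp_zdiv_nonneg_iff)
      ultimately show "int (nat (t div int g)) * int g + s = t" by (metis div_mult_mod_eq int_nat_eq)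
    qed
    show "(\<lambda>i. int i * int g + s) ` {..<k} \<subseteq> coset g s \<inter> {0..<int (k * g)}"
    proof
      fix t assume "t \<in> (\<lambda>i. int i * int g + s) ` {..<k}"
      then obtain i where i: "i < k" "t = int i * int g + s" by auto
      have "(int i + 1) * int g \<le> int k * int g" using i(1) by (intro mult_right_mono) auto
      then show "t \<in> coset g s \<inter> {0..<int (k * g)}" using i s by (auto simp: algebra_simps)
    qed
    show "(\<lambda>t. nat (t div int g)) ` (coset g s \<inter> {0..<int (k * g)}) \<subseteq> {..<k}"
    proof
      fix i assume "i \<in> (\<lambda>t. nat (t div int g)) ` (coset g s \<inter> {0..<int (k * g)})"
      then obtain t where t: "0 \<le> t" "t < int k * int g" "i = nat (t div int g)" by auto
      have "t div int g < int k"
      proof (rule ccontr)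
        assume "\<not> t div int g < int k"
        then have "int k * int g \<le> (t div int g) * int g" by (intro mult_right_mono) auto
        also have "\<dots> \<le> t" using assms div_mult_mod_eq[of t "int g"] pos_mod_sign[of "int g" t] by linarith
        finally show False using t(2) by simp
      qed
      moreover have "0 \<le> t div int g" using t(1) assms by (simp add: pos_imp_zdiv_nonneg_iff)
      ultimately show "i \<in> {..<k}" using t(3) by simp
    qed
  qed
  ultimately show ?thesis using bij_betw_same_card by fastforce
qed

lemma card_coset_Int_self: "0 < g \<Longrightarrow> card (coset g r \<inter> {0..<int g}) = 1"
  using card_coset_Int[of g r 1] by simp

lemma not_dvd_between: "0 < a \<Longrightarrow> a < int m \<Longrightarrow> \<not> int m dvd a"
  using zdvd_imp_le[of "int m" a] by auto

lemma loop_cosets_disjoint: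
  assumes "0 < r" "r < m" "2 * r \<noteq> m"
  shows "coset m (int r) \<inter> coset m (- int r) = {}"
proof (rule ccontr)
  assume "coset m (int r) \<inter> coset m (- int r) \<noteq> {}"
  then obtain t where "int m dvd t - int r" "int m dvd t - - int r" by auto
  then have "int m dvd (t - - int r) - (t - int r)" by (rule dvd_diff[rotated])
  then have "int m dvd int (2 * r)" by simp
  then have "m dvd 2 * r" unfolding of_nat_dvd_iff .
  then obtain k where k: "2 * r = m * k" ..
  have "m * k < m * 2" "0 < m * k" using k assms by linarith+
  then have "k = 1" by (simp add: zero_less_mult_iff)
  then show False using k assms by simp
qed

text \<open>
  A join with \<open>g = gcd (n A) (n B)\<close> gives every vertex of \<open>A\<close> one neighbour in each of the
  \<open>n B div g\<close> residues modulo \<open>n B\<close> that lie over one residue modulo \<open>g\<close>.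
\<close>

fun rule_valency :: "(fibre \<Rightarrow> nat) \<Rightarrow> edge_rule \<Rightarrow> fibre \<Rightarrow> nat" where
  "rule_valency n (Join A B) X =
     (if X = A then n B div gcd (n A) (n B) else if X = B then n A div gcd (n A) (n B) else 0)"
| "rule_valency n (Shift A B r) X = (if X = A \<or> X = B then 1 else 0)"
| "rule_valency n (Loop A r) X = (if X = A then 2 else 0)"
| "rule_valency n (Semi A) X = (if X = A then 1 else 0)"

lemma card_rule_diffs:
  assumes "rule_wf n e"
  shows "(\<Sum>Y \<in> {FU, FV, FW}. card (rule_diffs n e X Y \<inter> {0..<int (n Y)})) = rule_valency n e X"
proof -
  have fib: "Y \<in> {FU, FV, FW}" for Y by (cases Y) auto
  have one: "(\<Sum>Y \<in> {FU, FV, FW}. card (if Y = B then E \<inter> {0..<int (n Y)} else {})) = card (E \<inter> {0..<int (n B)})"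
    for B and E :: "int set"
  proof -
    have "(\<Sum>Y \<in> {FU, FV, FW}. card (if Y = B then E \<inter> {0..<int (n Y)} else {}))
        = (\<Sum>Y \<in> {FU, FV, FW}. if B = Y then card (E \<inter> {0..<int (n B)}) else 0)"
      by (rule sum.cong) auto
    then show ?thesis using fib[of B] by (simp only: sum.delta) simp
  qed
  show ?thesis
  proof (cases e)
    case (Join A B)
    let ?g = "gcd (n A) (n B)"
    have g: "0 < ?g" "n A = (n A div ?g) * ?g" "n B = (n B div ?g) * ?g" using assms by (auto simp: Join)
    have c: "card (coset ?g 0 \<inter> {0..<int (n A)}) = n A div ?g" "card (coset ?g 0 \<inter> {0..<int (n B)}) = n B div ?g"
      using card_coset_Int[OF g(1), of 0 "n A div ?g"] card_coset_Int[OF g(1), of 0 "n B div ?g"]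
      unfolding g(2,3)[symmetric] by simp_all
    have AB: "A \<noteq> B" using assms by (simp add: Join)
    have "rule_diffs n e X Y \<inter> {0..<int (n Y)} =
      (if Y = (if X = A then B else A) then (if X = A \<or> X = B then coset ?g 0 else {}) \<inter> {0..<int (n Y)} else {})" for Y
      using AB by (auto simp: Join)
    then show ?thesis using c AB by (simp only: one) (auto simp: Join)
  next
    case (Shift A B r)
    have AB: "A \<noteq> B" "n A = n B" "0 < n B" using assms by (auto simp: Shift)
    have "rule_diffs n e X Y \<inter> {0..<int (n Y)} =
      (if Y = (if X = A then B else A) then
        (if X = A then coset (n A) (int r) else if X = B then coset (n A) (- int r) else {}) \<inter> {0..<int (n Y)} else {})" for Y
      using AB by (auto simp: Shift)
    then show ?thesis using AB card_coset_Int_self[OF AB(3)] by (simp only: one) (auto simp: Shift)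
  next
    case (Loop A r)
    have A: "0 < r" "r < n A" "2 * r \<noteq> n A" using assms by (auto simp: Loop)
    have c: "card ((coset (n A) (int r) \<union> coset (n A) (- int r)) \<inter> {0..<int (n A)}) = 2"
    proof -
      have "card ((coset (n A) (int r) \<union> coset (n A) (- int r)) \<inter> {0..<int (n A)})
          = card (coset (n A) (int r) \<inter> {0..<int (n A)}) + card (coset (n A) (- int r) \<inter> {0..<int (n A)})"
        unfolding Int_Un_distrib2 using loop_cosets_disjoint[OF A] by (intro card_Un_disjoint) auto
      then show ?thesis using A card_coset_Int_self[of "n A"] by simp
    qed
    have "rule_diffs n e X Y \<inter> {0..<int (n Y)} =
      (if Y = A then (if X = A then coset (n A) (int r) \<union> coset (n A) (- int r) else {}) \<inter> {0..<int (n Y)} else {})" for Y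
      by (auto simp: Loop)
    then show ?thesis using c by (simp only: one) (auto simp: Loop)
  next
    case (Semi A)
    have A: "0 < n A" using assms by (auto simp: Semi)
    have "rule_diffs n e X Y \<inter> {0..<int (n Y)} =
      (if Y = A then (if X = A then coset (n A) (int (n A div 2)) else {}) \<inter> {0..<int (n Y)} else {})" for Y
      by (auto simp: Semi)
    then show ?thesis using card_coset_Int_self[OF A] by (simp only: one) (auto simp: Semi)
  qed
qed

text \<open>
  A sufficient condition for two rules to have no arc in common, so that their valencies add up. Two
  shifts are compared only when they link the same fibres in the same direction, which is how they
  occur in the families. A loop and a semi rule never clash, because the loop parameter is not half
  the size.
\<close>

fun rules_compatible :: "(fibre \<Rightarrow> nat) \<Rightarrow> edge_rule \<Rightarrow> edge_rule \<Rightarrow> bool" where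
  "rules_compatible n (Join A B) (Join C E) \<longleftrightarrow> \<not> (A = C \<and> B = E \<or> A = E \<and> B = C)"
| "rules_compatible n (Join A B) (Shift C E r) \<longleftrightarrow> 0 < r \<or> \<not> (A = C \<and> B = E \<or> A = E \<and> B = C)"
| "rules_compatible n (Shift C E r) (Join A B) \<longleftrightarrow> 0 < r \<or> \<not> (A = C \<and> B = E \<or> A = E \<and> B = C)"
| "rules_compatible n (Shift A B r) (Shift C E s) \<longleftrightarrow> (A = C \<and> B = E \<and> r \<noteq> s)"
| "rules_compatible n (Loop A r) (Loop B s) \<longleftrightarrow> A \<noteq> B"
| "rules_compatible n (Semi A) (Semi B) \<longleftrightarrow> A \<noteq> B"
| "rules_compatible n _ _ \<longleftrightarrow> True"

lemma shift_not_dvd: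
  assumes "0 < r" "r < m"
  shows "\<not> (int m dvd t \<and> int m dvd t - int r)" "\<not> (int m dvd t \<and> int m dvd t + int r)"
proof -
  have m: "\<not> int m dvd int r" using assms by (intro not_dvd_between) auto
  show "\<not> (int m dvd t \<and> int m dvd t - int r)"
    using m dvd_diff[of "int m" t "t - int r"] by auto
  show "\<not> (int m dvd t \<and> int m dvd t + int r)"
    using m dvd_diff[of "int m" "t + int r" t] by auto
qed

lemma distinct_residues:
  assumes "r < m" "s < m" "r \<noteq> s"
  shows "\<not> (int m dvd t - int r \<and> int m dvd t - int s)" "\<not> (int m dvd t + int r \<and> int m dvd t + int s)"
proof -
  have m: "\<not> int m dvd int r - int s"
  proof (cases "s < r")
    case True
    then show ?thesis using assms by (intro not_dvd_between) auto
  next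
    case False
    then have "\<not> int m dvd int s - int r" using assms by (intro not_dvd_between) auto
    then show ?thesis by (metis dvd_diff_commute)
  qed
  show "\<not> (int m dvd t - int r \<and> int m dvd t - int s)"
    using m dvd_diff[of "int m" "t - int s" "t - int r"] by auto
  show "\<not> (int m dvd t + int r \<and> int m dvd t + int s)"
    using m dvd_diff[of "int m" "t + int r" "t + int s"] by auto
qed

fun rule_ends :: "edge_rule \<Rightarrow> fibre set" where
  "rule_ends (Join A B) = {A, B}"
| "rule_ends (Shift A B r) = {A, B}"
| "rule_ends (Loop A r) = {A}"
| "rule_ends (Semi A) = {A}"

lemma rule_diffs_ends: "t \<in> rule_diffs n e X Y \<Longrightarrow> rule_ends e = {X, Y}"
  by (cases e) (simp_all split: if_splits, auto)

lemma rules_compatible_disjoint: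
  assumes e: "rule_wf n e" and f: "rule_wf n f" and ef: "rules_compatible n e f"
  shows "rule_diffs n e X Y \<inter> rule_diffs n f X Y = {}"
proof -
  have join_shift: "rule_diffs n (Join A B) X Y \<inter> rule_diffs n (Shift C E r) X Y = {}"
    if "rule_wf n (Join A B)" "rule_wf n (Shift C E r)" "0 < r \<or> \<not> (A = C \<and> B = E \<or> A = E \<and> B = C)"
    for A B C E r
  proof (rule equals0I)
    fix t assume t: "t \<in> rule_diffs n (Join A B) X Y \<inter> rule_diffs n (Shift C E r) X Y"
    have CE: "n C = n E" "r < n E" using that(2) by simp_all
    have AB: "(X = A \<and> Y = B \<or> X = B \<and> Y = A) \<and> int (gcd (n A) (n B)) dvd t"
      using t by (simp split: if_splits)
    moreover have CE': "X = C \<and> Y = E \<and> int (n E) dvd t - int r \<or> X = E \<and> Y = C \<and> int (n E) dvd t + int r"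
      using t CE by (simp split: if_splits)
    ultimately have "A = C \<and> B = E \<or> A = E \<and> B = C" by blast
    then have "0 < r" "gcd (n A) (n B) = n E" using that(3) CE by auto
    then show False using AB CE' shift_not_dvd[OF \<open>0 < r\<close> CE(2)] by metis
  qed
  have loop_semi: "rule_diffs n (Loop A r) X Y \<inter> rule_diffs n (Semi B) X Y = {}"
    if "rule_wf n (Loop A r)" "rule_wf n (Semi B)" for A B r
  proof -
    define h where "h = n B div 2"
    have h: "n B = 2 * h" "0 < h" using that(2) by (auto simp: h_def)
    have "\<not> (int (n B) dvd t - int r \<and> int (n B) dvd t - int h)" if "A = B" for t
      using distinct_residues(1)[of r "n B" h] that h \<open>rule_wf n (Loop A r)\<close> by auto
    moreover have "\<not> (int (n B) dvd t + int r \<and> int (n B) dvd t - int h)" if "A = B" for t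
    proof -
      have "t + int h = (t - int h) + int (n B)" using h by simp
      then have "int (n B) dvd t + int h \<longleftrightarrow> int (n B) dvd t - int h" by (metis dvd_add_triv_right_iff)
      then show ?thesis
        using distinct_residues(2)[of r "n B" h] that h \<open>rule_wf n (Loop A r)\<close> by auto
    qed
    ultimately show ?thesis by (auto simp: h_def split: if_splits)
  qed
  have shift_shift: "rule_diffs n (Shift A B r) X Y \<inter> rule_diffs n (Shift A B s) X Y = {}"
    if "rule_wf n (Shift A B r)" "rule_wf n (Shift A B s)" "r \<noteq> s" for A B r s
  proof (rule equals0I)
    fix t assume "t \<in> rule_diffs n (Shift A B r) X Y \<inter> rule_diffs n (Shift A B s) X Y"
    then have "int (n A) dvd t - int r \<and> int (n A) dvd t - int s \<or>
        int (n A) dvd t + int r \<and> int (n A) dvd t + int s"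
      by (simp split: if_splits)
    then show False using distinct_residues[of r "n A" s t] that by auto
  qed
  show ?thesis
  proof (cases "rule_ends e = rule_ends f")
    case False
    show ?thesis
    proof (rule equals0I)
      fix t assume t: "t \<in> rule_diffs n e X Y \<inter> rule_diffs n f X Y"
      then have "rule_ends e = {X, Y}" "rule_ends f = {X, Y}" using rule_diffs_ends by blast+
      with False show False by simp
    qed
  next
    case ends: True
    have "(\<exists>A B C E r. e = Join A B \<and> f = Shift C E r) \<or> (\<exists>A B C E r. e = Shift C E r \<and> f = Join A B) \<or>
       (\<exists>A B r s. e = Shift A B r \<and> f = Shift A B s \<and> r \<noteq> s) \<or>
       (\<exists>A r B. e = Loop A r \<and> f = Semi B) \<or> (\<exists>A r B. e = Semi B \<and> f = Loop A r)"
      by (cases e; cases f; insert e f ef ends; simp add: doubleton_eq_iff; blast?)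
    then show ?thesis
    proof (elim disjE exE conjE)
      fix A B C E r assume "e = Join A B" "f = Shift C E r"
      then show ?thesis using join_shift[of A B C E r] e f ef by simp
    next
      fix A B C E r assume "e = Shift C E r" "f = Join A B"
      then show ?thesis using join_shift[of A B C E r] e f ef by (simp add: Int_commute)
    next
      fix A B r s assume "e = Shift A B r" "f = Shift A B s" "r \<noteq> s"
      then show ?thesis using shift_shift[of A B r s] e f by simp
    next
      fix A r B assume "e = Loop A r" "f = Semi B"
      then show ?thesis using loop_semi[of A r B] e f by simp
    next
      fix A r B assume "e = Semi B" "f = Loop A r"
      then show ?thesis using loop_semi[of A r B] e f by (simp add: Int_commute)
    qed
  qed
qed

text \<open>
  A combinatorial certificate of cubicity that simplification can check for symbolic parameters.
\<close>

definition scheme_cubic :: "scheme \<Rightarrow> bool" where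
  "scheme_cubic S \<longleftrightarrow> scheme_wf S \<and> sorted_wrt (rules_compatible (size_of S)) (rules S) \<and>
     (\<forall>X. 0 < size_of S X \<longrightarrow> (\<Sum>e\<leftarrow>rules S. rule_valency (size_of S) e X) = 3)"

lemma card_rules_diffs:
  assumes "\<forall>e \<in> set es. rule_wf n e" "sorted_wrt (rules_compatible n) es"
  shows "(\<Sum>Y \<in> {FU, FV, FW}. card ((\<Union>e \<in> set es. rule_diffs n e X Y) \<inter> {0..<int (n Y)})) =
    (\<Sum>e\<leftarrow>es. rule_valency n e X)"
  using assms
proof (induction es)
  case (Cons e es)
  have disj: "rule_diffs n e X Y \<inter> (\<Union>e \<in> set es. rule_diffs n e X Y) = {}" for Y
    using rules_compatible_disjoint[of n e _ X Y] Cons.prems by fastforce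
  have "card ((\<Union>e' \<in> set (e # es). rule_diffs n e' X Y) \<inter> {0..<int (n Y)}) =
      card (rule_diffs n e X Y \<inter> {0..<int (n Y)}) +
      card ((\<Union>e \<in> set es. rule_diffs n e X Y) \<inter> {0..<int (n Y)})" for Y
  proof -
    have "(\<Union>e' \<in> set (e # es). rule_diffs n e' X Y) \<inter> {0..<int (n Y)} =
        (rule_diffs n e X Y \<inter> {0..<int (n Y)}) \<union> ((\<Union>e \<in> set es. rule_diffs n e X Y) \<inter> {0..<int (n Y)})"
      by (auto simp del: rule_diffs.simps)
    then show ?thesis using disj[of Y] by (simp only:) (rule card_Un_disjoint, auto)
  qed
  then have "(\<Sum>Y \<in> {FU, FV, FW}. card ((\<Union>e' \<in> set (e # es). rule_diffs n e' X Y) \<inter> {0..<int (n Y)})) =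
      (\<Sum>Y \<in> {FU, FV, FW}. card (rule_diffs n e X Y \<inter> {0..<int (n Y)})) +
      (\<Sum>Y \<in> {FU, FV, FW}. card ((\<Union>e \<in> set es. rule_diffs n e X Y) \<inter> {0..<int (n Y)}))"
    by (simp only: sum.distrib)
  also have "\<dots> = rule_valency n e X + (\<Sum>e\<leftarrow>es. rule_valency n e X)"
    using Cons card_rule_diffs[of n e X] by (simp only: list.set_intros sorted_wrt.simps) simp
  finally show ?case by (simp only: list.map sum_list.Cons)
qed simp

lemma zero_notin_diffs:
  assumes "scheme_wf S"
  shows "0 \<notin> scheme_diffs S X X"
proof -
  have "0 \<notin> rule_diffs (size_of S) e X X" if e: "rule_wf (size_of S) e" for e
  proof (cases e)
    case (Loop A r)
    then show ?thesis using e not_dvd_between[of "int r" "size_of S A"] by simp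
  next
    case (Semi A)
    then have "\<not> int (size_of S A) dvd int (size_of S A div 2)"
      using e by (intro not_dvd_between) (auto elim!: evenE)
    then show ?thesis using Semi by simp
  next
    case (Join A B)
    then have "A \<noteq> B" using e by simp
    then show ?thesis by (auto simp: Join)
  next
    case (Shift A B r)
    then have "A \<noteq> B" using e by simp
    then show ?thesis by (auto simp: Shift)
  qed
  then show ?thesis using assms by (auto simp: scheme_diffs_def scheme_wf_def)
qed

section \<open>Connectedness of scheme graphs\<close>

text \<open>
  One representative of the differences of a rule; the others differ from it by multiples of the
  fibre sizes or in sign, which is immaterial for common divisors.
\<close>

fun rule_param :: "(fibre \<Rightarrow> nat) \<Rightarrow> edge_rule \<Rightarrow> nat" where
  "rule_param n (Join A B) = 0"
| "rule_param n (Shift A B r) = r"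
| "rule_param n (Loop A r) = r"
| "rule_param n (Semi A) = n A div 2"

text \<open>
  The hub \<open>C\<close> reaches every other fibre along arcs of difference \<open>0\<close>.
\<close>

definition star_scheme :: "scheme \<Rightarrow> fibre \<Rightarrow> bool" where
  "star_scheme S C \<longleftrightarrow> 0 < size_of S C \<and>
     (\<forall>X. X \<noteq> C \<longrightarrow> 0 < size_of S X \<longrightarrow> Join C X \<in> set (rules S) \<or> Join X C \<in> set (rules S))"

definition scheme_coprime :: "scheme \<Rightarrow> bool" where
  "scheme_coprime S \<longleftrightarrow> (\<forall>d :: nat. (\<forall>X. d dvd size_of S X) \<longrightarrow>
     (\<forall>e \<in> set (rules S). d dvd rule_param (size_of S) e) \<longrightarrow> d = 1)"

lemma coset_common_divisor:
  assumes "int d dvd int g"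
  shows "(\<forall>t \<in> coset g r. int d dvd t) \<longleftrightarrow> int d dvd r"
proof
  assume "\<forall>t \<in> coset g r. int d dvd t"
  then show "int d dvd r" by simp
next
  assume r: "int d dvd r"
  show "\<forall>t \<in> coset g r. int d dvd t"
  proof
    fix t assume "t \<in> coset g r"
    then have "int d dvd t - r" using assms dvd_trans by auto
    then show "int d dvd t" using r by (metis dvd_add diff_add_cancel)
  qed
qed

lemma rule_common_divisor:
  assumes e: "rule_wf n e" and d: "\<And>X. d dvd n X"
  shows "(\<forall>X Y. \<forall>t \<in> rule_diffs n e X Y. int d dvd t) \<longleftrightarrow> d dvd rule_param n e"
proof -
  have d': "int d dvd int (n X)" "int d dvd int (gcd (n X) (n Y))" for X Y
    using d by simp_all
  have support: "(\<forall>X Y. \<forall>t \<in> rule_diffs n e X Y. int d dvd t) \<longleftrightarrow>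
      (\<forall>t \<in> rule_diffs n e A B \<union> rule_diffs n e B A. int d dvd t)"
    if other: "\<And>X Y. \<not> (X = A \<and> Y = B \<or> X = B \<and> Y = A) \<Longrightarrow> rule_diffs n e X Y = {}" for A B
  proof
    assume all: "\<forall>t \<in> rule_diffs n e A B \<union> rule_diffs n e B A. int d dvd t"
    show "\<forall>X Y. \<forall>t \<in> rule_diffs n e X Y. int d dvd t"
    proof (intro allI ballI)
      fix X Y t assume t: "t \<in> rule_diffs n e X Y"
      then have "X = A \<and> Y = B \<or> X = B \<and> Y = A" using other[of X Y] by (cases "X = A \<and> Y = B \<or> X = B \<and> Y = A") simp_all
      then show "int d dvd t" using all t by (elim disjE conjE) simp_all
    qed
  qed blast
  have two: "(\<forall>X Y. \<forall>t \<in> rule_diffs n e X Y. int d dvd t) \<longleftrightarrow> d dvd r"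
    if AB: "rule_diffs n e A B \<union> rule_diffs n e B A = coset (n A) (int r) \<union> coset (n A) (- int r)"
      and other: "\<And>X Y. \<not> (X = A \<and> Y = B \<or> X = B \<and> Y = A) \<Longrightarrow> rule_diffs n e X Y = {}" for A B r
  proof -
    have "(\<forall>X Y. \<forall>t \<in> rule_diffs n e X Y. int d dvd t) \<longleftrightarrow>
        (\<forall>t \<in> rule_diffs n e A B \<union> rule_diffs n e B A. int d dvd t)"
      by (rule support[OF other])
    also have "\<dots> \<longleftrightarrow> int d dvd int r \<and> int d dvd - int r"
      unfolding AB ball_Un by (simp only: coset_common_divisor[OF d'(1)])
    finally show ?thesis by simp
  qed
  have one: "(\<forall>X Y. \<forall>t \<in> rule_diffs n e X Y. int d dvd t) \<longleftrightarrow> int d dvd r"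
    if AB: "rule_diffs n e A B \<union> rule_diffs n e B A = coset g r" and g: "int d dvd int g"
      and other: "\<And>X Y. \<not> (X = A \<and> Y = B \<or> X = B \<and> Y = A) \<Longrightarrow> rule_diffs n e X Y = {}" for A B g r
  proof -
    have "(\<forall>X Y. \<forall>t \<in> rule_diffs n e X Y. int d dvd t) \<longleftrightarrow>
        (\<forall>t \<in> rule_diffs n e A B \<union> rule_diffs n e B A. int d dvd t)"
      by (rule support[OF other])
    also have "\<dots> \<longleftrightarrow> int d dvd r" unfolding AB by (rule coset_common_divisor[OF g])
    finally show ?thesis .
  qed
  show ?thesis
  proof (cases e)
    case (Join A B)
    have "(\<forall>X Y. \<forall>t \<in> rule_diffs n e X Y. int d dvd t) \<longleftrightarrow> int d dvd 0"
      by (rule one[of A B "gcd (n A) (n B)" 0, OF _ d'(2)]) (auto simp: Join)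
    then show ?thesis by (simp add: Join)
  next
    case (Shift A B r)
    have "(\<forall>X Y. \<forall>t \<in> rule_diffs n e X Y. int d dvd t) \<longleftrightarrow> d dvd r"
      by (rule two[of A B]) (use e Shift in auto)
    then show ?thesis by (simp add: Shift)
  next
    case (Loop A r)
    have "(\<forall>X Y. \<forall>t \<in> rule_diffs n e X Y. int d dvd t) \<longleftrightarrow> d dvd r"
      by (rule two[of A A]) (use Loop in auto)
    then show ?thesis by (simp add: Loop)
  next
    case (Semi A)
    have "(\<forall>X Y. \<forall>t \<in> rule_diffs n e X Y. int d dvd t) \<longleftrightarrow> int d dvd int (n A div 2)"
      by (rule one[of A A "n A" "int (n A div 2)", OF _ d'(1)]) (auto simp: Semi)
    then show ?thesis by (simp add: Semi)
  qed
qed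

text \<open>
  For schemes with a hub, connectedness is a condition on one gcd. It is used in both directions: it
  yields the coprimality conditions of a connected graph, and it shows that they suffice.
\<close>

lemma scheme_connected_iff:
  assumes wf: "scheme_wf S" and star: "star_scheme S C" and idx: "indexing \<Gamma> (size_of S) (scheme_diffs S) \<phi>"
  shows "connected (with_proj \<Gamma>) \<longleftrightarrow> scheme_coprime S"
proof -
  interpret indexing \<Gamma> "size_of S" "scheme_diffs S" \<phi> by fact
  have C: "0 < size_of S C" using star by (simp add: star_scheme_def)
  have zero: "0 \<in> scheme_diffs S C X" if "0 < size_of S X" "X \<noteq> C" for X
  proof -
    have "Join C X \<in> set (rules S) \<or> Join X C \<in> set (rules S)"
      using star that by (simp add: star_scheme_def)
    then show ?thesis unfolding scheme_diffs_def by force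
  qed
  have present: "0 < size_of S X \<and> 0 < size_of S Y"
    if "e \<in> set (rules S)" "t \<in> rule_diffs (size_of S) e X Y" for e t X Y
  proof -
    have "rule_wf (size_of S) e" using wf that by (simp add: scheme_wf_def)
    then show ?thesis using that(2) by (cases e) (auto split: if_splits)
  qed
  define common where "common d \<longleftrightarrow> (\<forall>X. 0 < size_of S X \<longrightarrow> d dvd int (size_of S X)) \<and>
      (\<forall>X Y. 0 < size_of S X \<longrightarrow> 0 < size_of S Y \<longrightarrow> (\<forall>t \<in> scheme_diffs S X Y. d dvd t))" for d
  have conn: "connected (with_proj \<Gamma>) \<longleftrightarrow> (\<forall>d. common d \<longrightarrow> is_unit d)"
    unfolding common_def by (rule connected_iff_gcd[OF C zero])
  have common: "common (int d) \<longleftrightarrow>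
     (\<forall>X. d dvd size_of S X) \<and> (\<forall>e \<in> set (rules S). d dvd rule_param (size_of S) e)" for d
  proof -
    have 1: "(\<forall>X. 0 < size_of S X \<longrightarrow> int d dvd int (size_of S X)) \<longleftrightarrow> (\<forall>X. d dvd size_of S X)"
      by (metis dvd_0_right gr0I of_nat_dvd_iff)
    have 2: "(\<forall>X Y. 0 < size_of S X \<longrightarrow> 0 < size_of S Y \<longrightarrow> (\<forall>t \<in> scheme_diffs S X Y. int d dvd t)) \<longleftrightarrow>
        (\<forall>e \<in> set (rules S). \<forall>X Y. \<forall>t \<in> rule_diffs (size_of S) e X Y. int d dvd t)"
      using present unfolding scheme_diffs_def by blast
    show ?thesis unfolding common_def 1 2
      using rule_common_divisor[of "size_of S" _ d] wf unfolding scheme_wf_def by blast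
  qed
  show ?thesis
    unfolding conn scheme_coprime_def
  proof
    assume unit: "\<forall>d. common d \<longrightarrow> is_unit d"
    show "\<forall>d. (\<forall>X. d dvd size_of S X) \<longrightarrow> (\<forall>e \<in> set (rules S). d dvd rule_param (size_of S) e) \<longrightarrow> d = 1"
    proof (intro allI impI)
      fix d assume "\<forall>X. d dvd size_of S X" "\<forall>e \<in> set (rules S). d dvd rule_param (size_of S) e"
      then have "is_unit (int d)" using common[of d] unit by blast
      then show "d = 1" by simp
    qed
  next
    assume one: "\<forall>d. (\<forall>X. d dvd size_of S X) \<longrightarrow>
      (\<forall>e \<in> set (rules S). d dvd rule_param (size_of S) e) \<longrightarrow> d = 1"
    show "\<forall>d. common d \<longrightarrow> is_unit d"
    proof (intro allI impI)
      fix d assume "common d"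
      then have "common (int (nat \<bar>d\<bar>))" unfolding common_def by simp
      then have "nat \<bar>d\<bar> = 1" using common[of "nat \<bar>d\<bar>"] one by blast
      then show "is_unit d" by simp
    qed
  qed
qed

lemma scheme_graph_sound:
  assumes pseudo: "pair_pseudo_graph \<Gamma>" and cubic: "scheme_cubic S" and star: "star_scheme S C"
    and coprime: "scheme_coprime S" and iso: "graph_iso \<Gamma> (scheme_graph S)"
  shows "pair_graph \<Gamma> \<and> connected (with_proj \<Gamma>) \<and> cubic \<Gamma> \<and> (\<exists>k \<le> 3. cyclic_aut_group_with_orbits \<Gamma> k)"
proof -
  have wf: "scheme_wf S" using cubic by (simp add: scheme_cubic_def)
  then obtain \<phi> where idx: "indexing \<Gamma> (size_of S) (scheme_diffs S) \<phi>"
    using iso graph_iso_scheme_iff[OF wf pseudo] by blast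
  interpret indexing \<Gamma> "size_of S" "scheme_diffs S" \<phi> by fact
  have "pair_graph \<Gamma>" using pair_graph_iff zero_notin_diffs[OF wf] by blast
  moreover have "connected (with_proj \<Gamma>)" using scheme_connected_iff[OF wf star idx] coprime by blast
  moreover have "cubic \<Gamma>"
    unfolding cubic_iff
  proof (intro allI impI)
    fix X assume "0 < size_of S X"
    then have "(\<Sum>e\<leftarrow>rules S. rule_valency (size_of S) e X) = 3" using cubic by (simp add: scheme_cubic_def)
    moreover have "\<forall>e \<in> set (rules S). rule_wf (size_of S) e" "sorted_wrt (rules_compatible (size_of S)) (rules S)"
      using cubic by (simp_all add: scheme_cubic_def scheme_wf_def)
    ultimately show "(\<Sum>Y \<in> {FU, FV, FW}. card (scheme_diffs S X Y \<inter> {0..<int (size_of S Y)})) = 3"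
      unfolding scheme_diffs_def using card_rules_diffs[of "rules S" "size_of S" X] by metis
  qed
  ultimately show ?thesis using cyclic_aut_group by blast
qed

section \<open>Edges within an orbit and between two orbits\<close>

context indexing
begin

text \<open>
  The number of neighbours in \<open>Y\<close> of a vertex of \<open>X\<close>.
\<close>

definition deg :: "fibre \<Rightarrow> fibre \<Rightarrow> nat" where
  "deg X Y = card (D X Y \<inter> {0..<int (n Y)})"

lemma diffs_eq_cosets:
  assumes "0 < n X" "0 < n Y"
  defines "g \<equiv> gcd (n X) (n Y)"
  shows "D X Y = (\<Union>t \<in> D X Y \<inter> {0..<int g}. coset g t)"
proof (intro equalityI subsetI)
  have g: "0 < int g" using assms by simp
  fix t assume t: "t \<in> D X Y"
  have m: "int g dvd t - t mod int g" by (simp add: minus_mod_eq_mult_div)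
  then have "t mod int g \<in> D X Y" using diff_cong[OF assms(1,2), of t "t mod int g"] t by (simp add: g_def)
  then have "t mod int g \<in> D X Y \<inter> {0..<int g}" using g by simp
  moreover have "t \<in> coset g (t mod int g)" using m by simp
  ultimately show "t \<in> (\<Union>t \<in> D X Y \<inter> {0..<int g}. coset g t)" by (rule UN_I)
next
  fix t assume "t \<in> (\<Union>t \<in> D X Y \<inter> {0..<int g}. coset g t)"
  then obtain s where s: "s \<in> D X Y" "int g dvd t - s" by auto
  then show "t \<in> D X Y" using diff_cong[OF assms(1,2), of t s] by (simp add: g_def)
qed

lemma residues_eqI:
  assumes "0 \<le> s" "s < int g" "0 \<le> t" "t < int g" "int g dvd s - t"
  shows "s = t"
  using assms by (metis mod_eq_dvd_iff mod_pos_pos_trivial)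

text \<open>
  Every residue modulo the gcd \<open>g\<close> of the sizes splits into \<open>n Y div g\<close> residues modulo \<open>n Y\<close>.
\<close>

lemma deg_eq:
  assumes "0 < n X" "0 < n Y"
  defines "g \<equiv> gcd (n X) (n Y)"
  shows "deg X Y = card (D X Y \<inter> {0..<int g}) * (n Y div g)"
proof -
  let ?E = "D X Y \<inter> {0..<int g}"
  have g: "0 < g" "n Y = (n Y div g) * g" using assms by simp_all
  have fin: "finite ?E" by simp
  have "D X Y \<inter> {0..<int (n Y)} = (\<Union>t \<in> ?E. coset g t \<inter> {0..<int (n Y)})"
    using diffs_eq_cosets[OF assms(1,2)] unfolding g_def by blast
  then have "deg X Y = card (\<Union>t \<in> ?E. coset g t \<inter> {0..<int (n Y)})"
    by (simp only: deg_def)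
  also have "\<dots> = (\<Sum>t \<in> ?E. card (coset g t \<inter> {0..<int (n Y)}))"
  proof (rule card_UN_disjoint[OF fin])
    show "\<forall>t\<in>?E. finite (coset g t \<inter> {0..<int (n Y)})" by simp
    show "\<forall>s\<in>?E. \<forall>t\<in>?E. s \<noteq> t \<longrightarrow> (coset g s \<inter> {0..<int (n Y)}) \<inter> (coset g t \<inter> {0..<int (n Y)}) = {}"
    proof (intro ballI impI equals0I)
      fix s t u assume st: "s \<in> ?E" "t \<in> ?E" "s \<noteq> t"
        and u: "u \<in> (coset g s \<inter> {0..<int (n Y)}) \<inter> (coset g t \<inter> {0..<int (n Y)})"
      then have "int g dvd u - t" "int g dvd u - s" by simp_all
      then have "int g dvd (u - t) - (u - s)" by (rule dvd_diff)
      then show False using residues_eqI[of s g t] st by auto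
    qed
  qed
  also have "\<dots> = (\<Sum>t \<in> ?E. n Y div g)"
    using card_coset_Int[OF g(1), of _ "n Y div g"] g(2) by (intro sum.cong) simp_all
  finally show ?thesis by simp
qed

text \<open>
  Negation exchanges the differences from \<open>X\<close> to \<open>Y\<close> with those from \<open>Y\<close> to \<open>X\<close>.
\<close>

lemma card_diffs_sym:
  assumes "0 < n X" "0 < n Y"
  defines "g \<equiv> gcd (n X) (n Y)"
  shows "card (D X Y \<inter> {0..<int g}) = card (D Y X \<inter> {0..<int g})"
proof -
  have g: "0 < int g" using assms by simp
  have maps: "- t mod int g \<in> D B A \<inter> {0..<int g}"
    if "t \<in> D A B" "0 < n A" "0 < n B" "gcd (n A) (n B) = g" for A B t
  proof -
    have "int g dvd - t - - t mod int g" by (simp add: minus_mod_eq_mult_div)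
    then have "- t mod int g \<in> D B A \<longleftrightarrow> - t \<in> D B A"
      using diff_cong[OF that(3,2), of "- t" "- t mod int g"] that(4) by (simp add: gcd.commute)
    then show ?thesis using diff_sym[OF that(2,3), of t] that(1) g by simp
  qed
  have "bij_betw (\<lambda>t. - t mod int g) (D X Y \<inter> {0..<int g}) (D Y X \<inter> {0..<int g})"
  proof (rule bij_betw_byWitness[where f' = "\<lambda>t. - t mod int g"])
    have inv: "- (- t mod int g) mod int g = t" if "t \<in> {0..<int g}" for t
      using that by (simp add: mod_minus_eq)
    show "\<forall>t\<in>D X Y \<inter> {0..<int g}. - (- t mod int g) mod int g = t" using inv by blast
    show "\<forall>t\<in>D Y X \<inter> {0..<int g}. - (- t mod int g) mod int g = t" using inv by blast
    show "(\<lambda>t. - t mod int g) ` (D X Y \<inter> {0..<int g}) \<subseteq> D Y X \<inter> {0..<int g}"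
      using maps[OF _ assms(1,2)] by (auto simp only: g_def)
    show "(\<lambda>t. - t mod int g) ` (D Y X \<inter> {0..<int g}) \<subseteq> D X Y \<inter> {0..<int g}"
      using maps[OF _ assms(2,1)] by (auto simp only: g_def gcd.commute)
  qed
  then show ?thesis by (rule bij_betw_same_card)
qed

lemma deg_zero_iff:
  assumes "0 < n X" "0 < n Y"
  shows "deg X Y = 0 \<longleftrightarrow> D X Y = {}"
proof
  assume 0: "deg X Y = 0"
  show "D X Y = {}"
  proof (rule equals0I)
    fix t assume t: "t \<in> D X Y"
    have "int (gcd (n X) (n Y)) dvd t - t mod int (n Y)"
      by (rule dvd_trans[of _ "int (n Y)"]) (simp_all add: minus_mod_eq_mult_div)
    then have "t mod int (n Y) \<in> D X Y \<inter> {0..<int (n Y)}"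
      using diff_cong[OF assms, of t "t mod int (n Y)"] t assms by simp
    moreover have "D X Y \<inter> {0..<int (n Y)} = {}" using 0 by (simp add: deg_def)
    ultimately show False by blast
  qed
qed (simp add: deg_def)

text \<open>
  With \<open>g\<close> the gcd of the sizes and \<open>e\<close> the number of residues modulo \<open>g\<close> in \<open>D X Y\<close>, the two degrees
  are \<open>e (n Y div g)\<close> and \<open>e (n X div g)\<close>, where the cofactors of \<open>e\<close> are coprime. As valency \<open>3\<close> leaves
  little room, the pair of degrees decides everything: equal degrees mean orbits of equal size, and
  unequal ones mean a single class of arcs and sizes in the inverse ratio of the degrees.
\<close>

lemma join_sizes:
  assumes XY: "0 < n X" "0 < n Y" and pos: "0 < deg X Y" and le: "deg X Y \<le> 3" "deg Y X \<le> 3"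
  shows "0 < deg Y X"
    and "deg X Y = deg Y X \<Longrightarrow> n X = n Y"
    and "deg X Y \<noteq> deg Y X \<Longrightarrow>
      n X = deg Y X * gcd (n X) (n Y) \<and> n Y = deg X Y * gcd (n X) (n Y) \<and>
      (\<exists>t. D X Y = coset (gcd (n X) (n Y)) t)"
proof -
  define g where "g = gcd (n X) (n Y)"
  define a b e where "a = n X div g" and "b = n Y div g" and "e = card (D X Y \<inter> {0..<int g})"
  have g: "0 < g" using XY by (simp add: g_def)
  have n: "n X = a * g" "n Y = b * g" by (simp_all add: a_def b_def g_def)
  have ab: "0 < a" "0 < b" using n XY by (auto intro: gr0I)
  have "coprime a b" unfolding a_def b_def g_def using XY by (intro div_gcd_coprime) simp
  have p: "deg X Y = e * b" using deg_eq[OF XY] by (simp add: e_def b_def g_def)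
  have q: "deg Y X = e * a"
    using deg_eq[OF XY(2,1)] card_diffs_sym[OF XY] by (simp add: e_def a_def g_def gcd.commute)
  have e: "0 < e" using pos p by (auto intro: gr0I)
  show "0 < deg Y X" using q e ab by simp
  show "n X = n Y" if "deg X Y = deg Y X" using that p q e n by simp
  show "n X = deg Y X * gcd (n X) (n Y) \<and> n Y = deg X Y * gcd (n X) (n Y) \<and>
      (\<exists>t. D X Y = coset (gcd (n X) (n Y)) t)" if ne: "deg X Y \<noteq> deg Y X"
  proof -
    \<comment> \<open>Distinct positive numbers up to \<open>3\<close> have no common divisor above \<open>1\<close>.\<close>
    have "a \<noteq> b" using ne p q by auto
    have "e = 1"
    proof (rule ccontr)
      assume "e \<noteq> 1"
      then have "2 \<le> e" using e by simp
      moreover have "e * a \<le> 3" "e * b \<le> 3" using le p q by simp_all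
      ultimately have "a \<le> 1" "b \<le> 1"
        using mult_le_mono[of 2 e 2 a] mult_le_mono[of 2 e 2 b] by (auto intro: ccontr)
      then show False using ab \<open>a \<noteq> b\<close> by simp
    qed
    then obtain t where "D X Y \<inter> {0..<int g} = {t}" unfolding e_def by (rule card_1_singletonE)
    then have "D X Y = coset g t" using diffs_eq_cosets[OF XY] by (simp add: g_def)
    then show ?thesis using n p q \<open>e = 1\<close> unfolding g_def by auto
  qed
qed

lemma join_single:
  assumes XY: "0 < n X" "0 < n Y" and le: "deg X Y \<le> 3" "deg Y X \<le> 3"
    and deg: "deg X Y \<noteq> deg Y X \<or> deg X Y = 1" and zero: "0 \<in> D X Y"
  shows "D X Y = coset (gcd (n X) (n Y)) 0"
    and "n X = deg Y X * gcd (n X) (n Y)" and "n Y = deg X Y * gcd (n X) (n Y)"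
proof -
  let ?g = "gcd (n X) (n Y)"
  have pos: "0 < deg X Y" using zero deg_zero_iff[OF XY] by auto
  have "(\<exists>t. D X Y = coset ?g t) \<and> n X = deg Y X * ?g \<and> n Y = deg X Y * ?g"
  proof (cases "deg X Y = deg Y X")
    case True
    then have n: "n X = n Y" using join_sizes(2)[OF XY pos le] by simp
    have "card (D X Y \<inter> {0..<int (n Y)}) = 1" using True deg by (auto simp: deg_def)
    then obtain t where "D X Y \<inter> {0..<int (n Y)} = {t}" by (rule card_1_singletonE)
    then show ?thesis using diffs_eq_cosets[OF XY] n True deg by auto
  next
    case False
    then show ?thesis using join_sizes(3)[OF XY pos le] by blast
  qed
  then obtain t where t: "D X Y = coset ?g t" and n: "n X = deg Y X * ?g" "n Y = deg X Y * ?g" by blast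
  have "int ?g dvd t - 0" using zero t by simp
  then show "D X Y = coset ?g 0" using t coset_eqI by simp
  show "n X = deg Y X * ?g" "n Y = deg X Y * ?g" using n by simp_all
qed

lemma shift_single:
  assumes XY: "0 < n X" "n X = n Y" and deg: "deg X Y = 1"
  obtains r where "r < n Y" "D X Y = coset (n Y) (int r)"
proof -
  have "card (D X Y \<inter> {0..<int (n Y)}) = 1" using deg by (simp add: deg_def)
  then obtain t where t: "D X Y \<inter> {0..<int (n Y)} = {t}" by (rule card_1_singletonE)
  then have "D X Y = coset (n Y) t" using diffs_eq_cosets[of X Y] XY by simp
  moreover have "0 \<le> t" "t < int (n Y)" using t by auto
  ultimately show thesis using that[of "nat t"] by simp
qed

lemma shift_double:
  assumes XY: "0 < n X" "n X = n Y" and deg: "deg X Y = 2"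
  obtains r s where "r < s" "s < n Y" "D X Y = coset (n Y) (int r) \<union> coset (n Y) (int s)"
    "0 \<in> D X Y \<Longrightarrow> r = 0"
proof -
  have c: "card (D X Y \<inter> {0..<int (n Y)}) = 2" using deg by (simp add: deg_def)
  then obtain a b where ab: "D X Y \<inter> {0..<int (n Y)} = {a, b}" "a \<noteq> b" by (metis card_2_iff)
  have "\<exists>r s. r < s \<and> {a, b} = {r, s}" using ab(2) by (metis insert_commute linorder_neqE)
  then obtain r s where rs: "r < s" "D X Y \<inter> {0..<int (n Y)} = {r, s}" using ab(1) by metis
  have "r \<in> D X Y \<inter> {0..<int (n Y)}" "s \<in> D X Y \<inter> {0..<int (n Y)}" unfolding rs(2) by simp_all
  then have b: "0 \<le> r" "s < int (n Y)" by simp_all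
  have "D X Y = coset (n Y) r \<union> coset (n Y) s" using diffs_eq_cosets[of X Y] XY rs(2) by simp
  moreover have "r = 0" if "0 \<in> D X Y"
  proof -
    have "0 \<in> D X Y \<inter> {0..<int (n Y)}" using that XY by simp
    then show ?thesis unfolding rs(2) using rs(1) b by auto
  qed
  ultimately show thesis using that[of "nat r" "nat s"] rs(1) b by simp
qed

lemma shift_triple:
  assumes XY: "0 < n X" "n X = n Y" and deg: "deg X Y = 3" and zero: "0 \<in> D X Y"
  obtains r s where "0 < r" "r < s" "s < n Y"
    "D X Y = coset (n Y) 0 \<union> coset (n Y) (int r) \<union> coset (n Y) (int s)"
proof -
  let ?E = "D X Y \<inter> {0..<int (n Y)}"
  have c: "card ?E = 3" using deg by (simp add: deg_def)
  have z: "0 \<in> ?E" using zero XY by simp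
  then have "card (?E - {0}) = 2" using c by simp
  then obtain a b where ab: "?E - {0} = {a, b}" "a \<noteq> b" by (metis card_2_iff)
  have "\<exists>r s. r < s \<and> {a, b} = {r, s}" using ab(2) by (metis insert_commute linorder_neqE)
  then obtain r s where rs: "r < s" "?E - {0} = {r, s}" using ab(1) by metis
  have E: "?E = {0, r, s}" using rs(2) z by blast
  have "r \<in> ?E - {0}" "s \<in> ?E - {0}" unfolding rs(2) by simp_all
  then have b: "0 \<le> r" "r \<noteq> 0" "s < int (n Y)" by simp_all
  have "D X Y = coset (n Y) 0 \<union> coset (n Y) r \<union> coset (n Y) s"
    using diffs_eq_cosets[of X Y] XY E by (simp add: Un_assoc)
  then show thesis using that[of "nat r" "nat s"] rs(1) b by simp
qed

text \<open>
  Within one orbit the set of residues is closed under \<open>t \<mapsto> n X - t\<close>, an involution whose only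
  possible fixed point is half the size. The structure of the arcs inside an orbit follows by counting
  fixed points of this involution on a set of one, two or three residues.
\<close>

lemma loop_residues:
  assumes X: "0 < n X" "0 \<notin> D X X"
  shows "D X X = (\<Union>t \<in> D X X \<inter> {0..<int (n X)}. coset (n X) t)"
    and "t \<in> D X X \<inter> {0..<int (n X)} \<Longrightarrow> 0 < t \<and> t < int (n X) \<and> int (n X) - t \<in> D X X \<inter> {0..<int (n X)}"
proof -
  show "D X X = (\<Union>t \<in> D X X \<inter> {0..<int (n X)}. coset (n X) t)" using diffs_eq_cosets[OF X(1) X(1)] by simp
  assume t: "t \<in> D X X \<inter> {0..<int (n X)}"
  have "t \<noteq> 0" using t X(2) by auto
  then have "0 < t" "t < int (n X)" using t by simp_all
  moreover have "int (n X) - t \<in> D X X"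
    using diff_cong[OF X(1) X(1), of "int (n X) - t" "- t"] diff_sym[OF X(1) X(1), of t] t by simp
  ultimately show "0 < t \<and> t < int (n X) \<and> int (n X) - t \<in> D X X \<inter> {0..<int (n X)}" by simp
qed

lemma coset_minus: "coset m (int m - t) = coset m (- t)"
  by (rule coset_eqI) simp

lemma semi_structure:
  assumes X: "0 < n X" "0 \<notin> D X X" and deg: "deg X X = 1"
  shows "even (n X)" and "D X X = coset (n X) (int (n X div 2))"
proof -
  have "card (D X X \<inter> {0..<int (n X)}) = 1" using deg by (simp add: deg_def)
  then obtain t where t: "D X X \<inter> {0..<int (n X)} = {t}" by (rule card_1_singletonE)
  then have "int (n X) - t = t" using loop_residues(2)[OF X, of t] by simp
  then have "int (n X) = 2 * t" by simp
  then show "even (n X)" by (metis dvd_triv_left even_of_nat_iff)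
  have "int (n X div 2) = t" using \<open>int (n X) = 2 * t\<close> by (simp add: zdiv_int)
  then show "D X X = coset (n X) (int (n X div 2))" using loop_residues(1)[OF X] t by simp
qed

lemma loop_structure:
  assumes X: "0 < n X" "0 \<notin> D X X" and deg: "deg X X = 2"
  obtains r where "0 < r" "r < n X" "2 * r \<noteq> n X"
    "D X X = coset (n X) (int r) \<union> coset (n X) (- int r)"
proof -
  let ?m = "int (n X)"
  have "card (D X X \<inter> {0..<?m}) = 2" using deg by (simp add: deg_def)
  then obtain a b where ab: "D X X \<inter> {0..<?m} = {a, b}" "a \<noteq> b" by (metis card_2_iff)
  have a: "0 < a" "a < ?m" "?m - a \<in> {a, b}" and b: "0 < b" "b < ?m" "?m - b \<in> {a, b}"
    using loop_residues(2)[OF X, of a] loop_residues(2)[OF X, of b] ab by auto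
  have "b = ?m - a" "2 * a \<noteq> ?m" using a(3) b(3) ab(2) by auto
  then have "D X X = coset (n X) a \<union> coset (n X) (- a)"
    using loop_residues(1)[OF X] ab(1) coset_minus by simp
  moreover have "2 * nat a \<noteq> n X" using \<open>2 * a \<noteq> ?m\<close> a(1) by linarith
  ultimately show thesis using that[of "nat a"] a by simp
qed

lemma loop_semi_structure:
  assumes X: "0 < n X" "0 \<notin> D X X" and deg: "deg X X = 3"
  obtains r where "even (n X)" "0 < r" "r < n X" "2 * r \<noteq> n X"
    "D X X = coset (n X) (int r) \<union> coset (n X) (- int r) \<union> coset (n X) (int (n X div 2))"
proof -
  let ?m = "int (n X)"
  have "card (D X X \<inter> {0..<?m}) = 3" using deg by (simp add: deg_def)
  then obtain a b c where abc: "D X X \<inter> {0..<?m} = {a, b, c}" "a \<noteq> b" "a \<noteq> c" "b \<noteq> c"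
    by (metis card_3_iff)
  have "\<exists>h r. 2 * h = ?m \<and> 2 * r \<noteq> ?m \<and> 0 < r \<and> r < ?m \<and> {a, b, c} = {r, ?m - r, h}"
  proof -
    have a: "0 < a" "a < ?m" "?m - a = a \<or> ?m - a = b \<or> ?m - a = c"
      and b: "0 < b" "b < ?m" "?m - b = a \<or> ?m - b = b \<or> ?m - b = c"
      and c: "0 < c" "c < ?m" "?m - c = a \<or> ?m - c = b \<or> ?m - c = c"
      using loop_residues(2)[OF X, of a] loop_residues(2)[OF X, of b] loop_residues(2)[OF X, of c] abc(1)
      by auto
    from a(3) show ?thesis
    proof (elim disjE)
      assume "?m - a = a"
      then have "c = ?m - b" "2 * b \<noteq> ?m" using b(3) abc(2-4) by linarith+
      then show ?thesis using b \<open>?m - a = a\<close> by (intro exI[of _ a] exI[of _ b]) auto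
    next
      assume "?m - a = b"
      then have "2 * c = ?m" "2 * a \<noteq> ?m" using c(3) abc(2-4) by linarith+
      then show ?thesis using a \<open>?m - a = b\<close> by (intro exI[of _ c] exI[of _ a]) auto
    next
      assume "?m - a = c"
      then have "2 * b = ?m" "2 * a \<noteq> ?m" using b(3) abc(2-4) by linarith+
      then show ?thesis using a \<open>?m - a = c\<close> by (intro exI[of _ b] exI[of _ a]) auto
    qed
  qed
  then obtain h r where h: "2 * h = ?m" and r: "2 * r \<noteq> ?m" "0 < r" "r < ?m"
    and E: "D X X \<inter> {0..<?m} = {r, ?m - r, h}"
    using abc(1) by metis
  have "D X X = coset (n X) r \<union> coset (n X) (- r) \<union> coset (n X) h"
    using loop_residues(1)[OF X] E coset_minus by (simp add: Un_assoc)
  moreover have "int (n X div 2) = h" using h by (simp add: zdiv_int flip: h)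
  moreover have "even (n X)" using h by (metis dvd_triv_left even_of_nat_iff)
  moreover have "2 * nat r \<noteq> n X" using r by linarith
  ultimately show thesis using that[of "nat r"] r by simp
qed

text \<open>
  The comparison of differences is needed only once for each unordered pair of fibres, in the
  direction that happens to be convenient.
\<close>

lemma graph_iso_schemeI:
  assumes wf: "scheme_wf S" and ABC: "A \<noteq> B" "A \<noteq> C" "B \<noteq> C"
    and size: "size_of S FU = n A" "size_of S FV = n B" "size_of S FW = n C"
    and A: "0 < n A \<Longrightarrow> D A A = scheme_diffs S FU FU"
    and B: "0 < n B \<Longrightarrow> D B B = scheme_diffs S FV FV"
    and C: "0 < n C \<Longrightarrow> D C C = scheme_diffs S FW FW"
    and AB: "0 < n A \<Longrightarrow> 0 < n B \<Longrightarrow> D A B = scheme_diffs S FU FV \<or> D B A = scheme_diffs S FV FU"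
    and AC: "0 < n A \<Longrightarrow> 0 < n C \<Longrightarrow> D A C = scheme_diffs S FU FW \<or> D C A = scheme_diffs S FW FU"
    and BC: "0 < n B \<Longrightarrow> 0 < n C \<Longrightarrow> D B C = scheme_diffs S FV FW \<or> D C B = scheme_diffs S FW FV"
  shows "graph_iso \<Gamma> (scheme_graph S)"
proof -
  define \<pi> where "\<pi> X = (case X of FU \<Rightarrow> A | FV \<Rightarrow> B | FW \<Rightarrow> C)" for X
  have \<pi>: "\<pi> FU = A" "\<pi> FV = B" "\<pi> FW = C" by (simp_all add: \<pi>_def)
  have "X = Y" if "\<pi> X = \<pi> Y" for X Y using that ABC by (cases X; cases Y) (simp_all add: \<pi>)
  then have "inj \<pi>" by (rule injI)
  then have bij: "bij \<pi>" using finite_UNIV_inj_surj[OF finite_fibres] by (simp add: bij_def)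
  interpret S: indexing "scheme_graph S" "size_of S" "scheme_diffs S" "\<lambda>X i. (X, nat (i mod int (size_of S X)))"
    by (rule scheme_indexing[OF wf])
  have n: "n (\<pi> X) = size_of S X" for X using size by (cases X) (simp_all add: \<pi>)
  have swap: "D (\<pi> Y) (\<pi> X) = scheme_diffs S Y X \<longleftrightarrow> D (\<pi> X) (\<pi> Y) = scheme_diffs S X Y"
    if "0 < n (\<pi> X)" "0 < n (\<pi> Y)" for X Y
  proof -
    have "t \<in> D (\<pi> Y) (\<pi> X) \<longleftrightarrow> - t \<in> D (\<pi> X) (\<pi> Y)" for t
      using diff_sym[OF that(1,2), of "- t"] by simp
    moreover have "t \<in> scheme_diffs S Y X \<longleftrightarrow> - t \<in> scheme_diffs S X Y" for t
      using S.diff_sym[of X Y "- t"] that n by simp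
    moreover have "(\<forall>t. - t \<in> D (\<pi> X) (\<pi> Y) \<longleftrightarrow> - t \<in> scheme_diffs S X Y) \<longleftrightarrow>
        (\<forall>t. t \<in> D (\<pi> X) (\<pi> Y) \<longleftrightarrow> t \<in> scheme_diffs S X Y)" by (metis minus_minus)
    ultimately show ?thesis by (simp only: set_eq_iff)
  qed
  define agree where "agree X Y \<longleftrightarrow> (0 < n (\<pi> X) \<longrightarrow> 0 < n (\<pi> Y) \<longrightarrow> D (\<pi> X) (\<pi> Y) = scheme_diffs S X Y)" for X Y
  have agree_sym: "agree Y X" if "agree X Y" for X Y
    using that swap[of X Y] unfolding agree_def by blast
  have "agree FU FU" "agree FV FV" "agree FW FW"
    using A B C unfolding agree_def \<pi> by blast+
  moreover have "agree FU FV" "agree FU FW" "agree FV FW"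
    using AB AC BC swap[of FU FV] swap[of FU FW] swap[of FV FW] unfolding agree_def \<pi> by blast+
  ultimately have "agree X Y" for X Y
    using agree_sym by (cases X; cases Y) blast+
  then have D: "D (\<pi> X) (\<pi> Y) = scheme_diffs S X Y" if "0 < n (\<pi> X)" "0 < n (\<pi> Y)" for X Y
    using that unfolding agree_def by blast
  show ?thesis
    by (rule indexings_isomorphic[OF indexing_permute[OF bij] S.indexing_axioms n D])
qed

end

section \<open>The families up to connectedness\<close>

text \<open>
  The families of the list with the bounds on their parameters, but without the coprimality
  conditions. Valency alone fixes the orbit sizes of the six sporadic graphs only up to a common
  factor \<open>j\<close>, so they are replaced by one-parameter families; connectedness will force \<open>j = 1\<close>.
\<close>

inductive listed_shape :: "scheme \<Rightarrow> bool" where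
  "even m \<Longrightarrow> 0 < r \<Longrightarrow> r < m \<Longrightarrow> 2 * r \<noteq> m \<Longrightarrow> listed_shape (Gamma1 m r)"
| "0 < r \<Longrightarrow> r < m \<Longrightarrow> 2 * r \<noteq> m \<Longrightarrow> 0 < s \<Longrightarrow> s < m \<Longrightarrow> 2 * s \<noteq> m \<Longrightarrow> listed_shape (Gamma2 m r s)"
| "even m \<Longrightarrow> 0 < r \<Longrightarrow> r < m \<Longrightarrow> listed_shape (Gamma3 m r)"
| "0 < r \<Longrightarrow> r < s \<Longrightarrow> s < m \<Longrightarrow> listed_shape (Gamma4 m r s)"
| "even m \<Longrightarrow> 0 < r \<Longrightarrow> r < 2 * m \<Longrightarrow> r \<noteq> m \<Longrightarrow> listed_shape (Gamma5 m r)"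
| "0 < r \<Longrightarrow> r < 3 * m \<Longrightarrow> 2 * r \<noteq> 3 * m \<Longrightarrow> listed_shape (Gamma6 m r)"
| "0 < j \<Longrightarrow> listed_shape (Scheme (6 * j) (4 * j) 0 (rules Gamma7_2))"
| "r < m \<Longrightarrow> listed_shape (Gamma8 m r)"
| "0 < j \<Longrightarrow> listed_shape (Scheme (4 * j) (2 * j) (2 * j) (rules Gamma9_4))"
| "0 < j \<Longrightarrow> listed_shape (Scheme (6 * j) (2 * j) (2 * j) (rules Gamma10_2))"
| "0 < j \<Longrightarrow> listed_shape (Scheme (12 * j) (6 * j) (4 * j) (rules Gamma11_4))"
| "even m \<Longrightarrow> 0 < r \<Longrightarrow> r < 2 * m \<Longrightarrow> r \<noteq> m \<Longrightarrow> listed_shape (Gamma12 m r)"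
| "even m \<Longrightarrow> 0 < r \<Longrightarrow> r < 3 * m \<Longrightarrow> 2 * r \<noteq> 3 * m \<Longrightarrow> listed_shape (Gamma13 m r)"
| "0 < r \<Longrightarrow> r < 3 * h \<Longrightarrow> 2 * r \<noteq> 3 * h \<Longrightarrow> listed_shape (Gamma14 (2 * h) r)"
| "0 < j \<Longrightarrow> listed_shape (Scheme (12 * j) (8 * j) (6 * j) (rules Gamma15_6))"
| "0 < j \<Longrightarrow> listed_shape (Scheme (3 * j) (2 * j) (1 * j) (rules Gamma16_1))"
| "0 < r \<Longrightarrow> r < m \<Longrightarrow> 2 * r \<noteq> m \<Longrightarrow> 0 < s \<Longrightarrow> s < 2 * m \<Longrightarrow> s \<noteq> m \<Longrightarrow> listed_shape (Gamma17 m r s)"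
| "even m \<Longrightarrow> 0 < r \<Longrightarrow> r < 4 * m \<Longrightarrow> r \<noteq> 2 * m \<Longrightarrow> listed_shape (Gamma18 m r)"
| "0 < r \<Longrightarrow> r < 6 * m \<Longrightarrow> r \<noteq> 3 * m \<Longrightarrow> listed_shape (Gamma19 m r)"
| "even m \<Longrightarrow> 0 < r \<Longrightarrow> r < 3 * m \<Longrightarrow> listed_shape (Gamma20 m r)"
| "even m \<Longrightarrow> 0 < r \<Longrightarrow> r < 2 * m \<Longrightarrow> listed_shape (Gamma21 m r)"
| "even m \<Longrightarrow> 0 < r \<Longrightarrow> r < m \<Longrightarrow> 0 < s \<Longrightarrow> s < m \<Longrightarrow> 2 * s \<noteq> m \<Longrightarrow> listed_shape (Gamma22 m r s)"
| "even m \<Longrightarrow> r < m \<Longrightarrow> s < m \<Longrightarrow> r \<noteq> s \<Longrightarrow> listed_shape (Gamma23 m r s)"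
| "even m \<Longrightarrow> r < m \<Longrightarrow> listed_shape (Gamma24 m r)"
| "even m \<Longrightarrow> 0 < r \<Longrightarrow> r < m \<Longrightarrow> 2 * r \<noteq> m \<Longrightarrow> 0 < s \<Longrightarrow> s < m \<Longrightarrow> 2 * s \<noteq> m \<Longrightarrow>
    listed_shape (Gamma25 m r s)"

lemmas Gamma_defs =
  Gamma1_def Gamma2_def Gamma3_def Gamma4_def Gamma5_def Gamma6_def Gamma7_2_def Gamma8_def
  Gamma9_4_def Gamma10_2_def Gamma11_4_def Gamma12_def Gamma13_def Gamma14_def Gamma15_6_def
  Gamma16_1_def Gamma17_def Gamma18_def Gamma19_def Gamma20_def Gamma21_def Gamma22_def
  Gamma23_def Gamma24_def Gamma25_def

lemma all_fibre: "(\<forall>X. P X) \<longleftrightarrow> P FU \<and> P FV \<and> P FW"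
  by (metis fibre.exhaust)

lemma ex_fibre: "(\<exists>X. P X) \<longleftrightarrow> P FU \<or> P FV \<or> P FW"
  by (metis fibre.exhaust)

lemma gcd_mult_right_nat: "gcd (a * m) (b * m) = gcd a b * m" for a b m :: nat
  by (simp add: gcd_mult_distrib_nat mult.commute)

lemma gcd_numerals:
  "gcd 3 (2 :: nat) = 1" "gcd 6 (4 :: nat) = 2" "gcd 12 (8 :: nat) = 4" "gcd 4 (2 :: nat) = 2"
  "gcd 6 (3 :: nat) = 3" "gcd 6 (2 :: nat) = 2" "gcd 12 (6 :: nat) = 6" "gcd 12 (4 :: nat) = 4"
  by (simp_all add: gcd_non_0_nat)

lemma gcd_multiples:
  fixes m :: nat
  shows "gcd (2 * m) m = m" "gcd (3 * m) m = m" "gcd (4 * m) (2 * m) = 2 * m"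
    "gcd (6 * m) (3 * m) = 3 * m" "gcd m (2 * m) = m" "gcd (3 * m) (2 * m) = m"
    "gcd (6 * m) (4 * m) = 2 * m" "gcd (6 * m) (2 * m) = 2 * m" "gcd (12 * m) (6 * m) = 6 * m"
    "gcd (12 * m) (4 * m) = 4 * m" "gcd (12 * m) (8 * m) = 4 * m"
  using gcd_mult_right_nat[of 2 m 1] gcd_mult_right_nat[of 3 m 1] gcd_mult_right_nat[of 4 m 2]
    gcd_mult_right_nat[of 6 m 3] gcd_mult_right_nat[of 1 m 2] gcd_mult_right_nat[of 3 m 2]
    gcd_mult_right_nat[of 6 m 4] gcd_mult_right_nat[of 6 m 2] gcd_mult_right_nat[of 12 m 6]
    gcd_mult_right_nat[of 12 m 4] gcd_mult_right_nat[of 12 m 8]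
  by (simp_all add: gcd_numerals)

lemma div_multiples:
  fixes m :: nat
  assumes "0 < m"
  shows "2 * m div m = 2" "3 * m div m = 3" "4 * m div (2 * m) = 2" "6 * m div (3 * m) = 2"
    "6 * m div (2 * m) = 3" "12 * m div (6 * m) = 2" "12 * m div (4 * m) = 3" "8 * m div (4 * m) = 2"
  using assms by simp_all

lemma listed_shape_sound:
  assumes "listed_shape S"
  shows "scheme_cubic S" and "\<exists>C. star_scheme S C"
proof -
  show "scheme_cubic S"
    using assms
    by cases (simp_all add: Gamma_defs scheme_cubic_def scheme_wf_def all_fibre gcd_multiples div_multiples)
  show "\<exists>C. star_scheme S C"
    using assms
    by cases (simp_all add: Gamma_defs star_scheme_def all_fibre ex_fibre)
qed

lemma listed_shape_wf: "listed_shape S \<Longrightarrow> scheme_wf S"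
  using listed_shape_sound(1) by (simp add: scheme_cubic_def)

section \<open>One and two orbits\<close>

locale cubic_indexing = indexing +
  assumes loopfree: "0 < n X \<Longrightarrow> 0 \<notin> D X X"
    and valency: "0 < n X \<Longrightarrow> deg X FU + deg X FV + deg X FW = 3"
begin

lemma deg_absent: "n Y = 0 \<Longrightarrow> deg X Y = 0"
  by (simp add: deg_def)

lemma deg_sum:
  assumes "A \<noteq> B" "A \<noteq> C" "B \<noteq> C" "0 < n X"
  shows "deg X A + deg X B + deg X C = 3"
  using valency[OF assms(4)] assms(1-3) by (cases A; cases B; cases C) simp_all

lemma deg_le: "0 < n X \<Longrightarrow> deg X Y \<le> 3"
  using valency[of X] by (cases Y) simp_all

text \<open>
  A single class of arcs, brought to difference \<open>0\<close>: the sizes are the multiples of \<open>g\<close> by the opposite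
  degrees.
\<close>

lemma join_obtain:
  assumes "0 < n X" "0 < n Y" "0 \<in> D X Y" "deg X Y = p" "deg Y X = q" "p \<noteq> q \<or> p = 1"
  obtains g where "0 < g" "n X = q * g" "n Y = p * g" "D X Y = coset g 0"
proof
  note J = join_single[OF assms(1,2) deg_le[OF assms(1)] deg_le[OF assms(2)] _ assms(3)]
  show "0 < gcd (n X) (n Y)" using assms(1) by simp
  show "n X = q * gcd (n X) (n Y)" "n Y = p * gcd (n X) (n Y)" "D X Y = coset (gcd (n X) (n Y)) 0"
    using J assms(4-6) by auto
qed

lemma equal_sizes:
  assumes "0 < n X" "0 < n Y" "0 < deg X Y" "deg X Y = deg Y X"
  shows "n X = n Y"
  by (rule join_sizes(2)[OF assms(1,2,3) deg_le[OF assms(1)] deg_le[OF assms(2)] assms(4)])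

lemma double_obtain:
  assumes "0 < n X" "0 < n Y" "0 \<in> D X Y" "deg X Y = 2" "deg Y X = 2"
  obtains r where "n X = n Y" "0 < r" "r < n Y" "D X Y = coset (n Y) 0 \<union> coset (n Y) (int r)"
proof -
  have n: "n X = n Y" using equal_sizes[of X Y] assms by simp
  obtain r s where "r < s" "s < n Y" "D X Y = coset (n Y) (int r) \<union> coset (n Y) (int s)" "r = 0"
    using shift_double[OF assms(1) n assms(4)] assms(3) by metis
  then show thesis using that[of s] n by simp
qed

lemma loop_obtain:
  assumes "0 < n X" "deg X X = 2"
  obtains r where "0 < r" "r < n X" "2 * r \<noteq> n X" "D X X = coset (n X) (int r) \<union> coset (n X) (- int r)"
  using loop_structure[OF assms(1) loopfree[OF assms(1)] assms(2)] by blast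

lemma semi_arcs:
  assumes "0 < n X" "deg X X = 1"
  shows "even (n X)" "D X X = coset (n X) (int (n X div 2))"
  using semi_structure[OF assms(1) loopfree[OF assms(1)] assms(2)] by blast+

lemma no_arcs:
  assumes "0 < n X" "0 < n Y" "deg X Y = 0"
  shows "D X Y = {}"
  using deg_zero_iff[OF assms(1,2)] assms(3) by blast

text \<open>
  Each case of the classification ends here, by naming a family and the roles of the orbits.
\<close>

lemma shapeI:
  assumes "listed_shape S" and "A \<noteq> B" "A \<noteq> C" "B \<noteq> C"
    and "size_of S FU = n A" "size_of S FV = n B" "size_of S FW = n C"
    and "0 < n A \<Longrightarrow> D A A = scheme_diffs S FU FU"
    and "0 < n B \<Longrightarrow> D B B = scheme_diffs S FV FV"
    and "0 < n C \<Longrightarrow> D C C = scheme_diffs S FW FW"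
    and "0 < n A \<Longrightarrow> 0 < n B \<Longrightarrow> D A B = scheme_diffs S FU FV \<or> D B A = scheme_diffs S FV FU"
    and "0 < n A \<Longrightarrow> 0 < n C \<Longrightarrow> D A C = scheme_diffs S FU FW \<or> D C A = scheme_diffs S FW FU"
    and "0 < n B \<Longrightarrow> 0 < n C \<Longrightarrow> D B C = scheme_diffs S FV FW \<or> D C B = scheme_diffs S FW FV"
  shows "\<exists>S. listed_shape S \<and> graph_iso \<Gamma> (scheme_graph S)"
  using assms(1) graph_iso_schemeI[OF listed_shape_wf[OF assms(1)] assms(2-)] by blast

text \<open>
  Three neighbours within the orbit: the involution on the residues has one fixed point.
\<close>

lemma classify_one_orbit:
  assumes ABC: "A \<noteq> B" "A \<noteq> C" "B \<noteq> C" and C: "0 < n C" and AB: "n A = 0" "n B = 0"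
  shows "\<exists>S. listed_shape S \<and> graph_iso \<Gamma> (scheme_graph S)"
proof -
  have "deg C C = 3" using deg_sum[OF ABC C] AB by (simp add: deg_absent)
  then obtain r where r: "even (n C)" "0 < r" "r < n C" "2 * r \<noteq> n C"
    "D C C = coset (n C) (int r) \<union> coset (n C) (- int r) \<union> coset (n C) (int (n C div 2))"
    using loop_semi_structure[OF C loopfree[OF C]] by blast
  show ?thesis
    by (rule shapeI[of "Gamma1 (n C) r" C A B, OF listed_shape.intros(1)])
      (use ABC AB r in \<open>simp_all add: Gamma_defs scheme_diffs_def\<close>)
qed

text \<open>
  The cases are the possible pairs of degrees between the two orbits, up to exchanging them.
\<close>

lemma classify_two_orbits:
  assumes ABC: "A \<noteq> B" "A \<noteq> C" "B \<noteq> C" and C: "0 < n C" and A: "0 < n A" and B: "n B = 0"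
    and zero: "0 \<in> D C A" and le: "deg C A \<le> deg A C"
  shows "\<exists>S. listed_shape S \<and> graph_iso \<Gamma> (scheme_graph S)"
proof -
  have sumC: "deg C A + deg C C = 3" and sumA: "deg A A + deg A C = 3"
    using deg_sum[OF ABC C] deg_sum[OF ABC A] B by (simp_all add: deg_absent)
  have pos: "0 < deg C A" using deg_zero_iff[OF C A] zero by auto
  have "deg C A = 1 \<and> deg A C = 1 \<or> deg C A = 1 \<and> deg A C = 2 \<or> deg C A = 1 \<and> deg A C = 3 \<or>
    deg C A = 2 \<and> deg A C = 2 \<or> deg C A = 2 \<and> deg A C = 3 \<or> deg C A = 3 \<and> deg A C = 3"
    using pos le sumC sumA by arith
  then show ?thesis
  proof (elim disjE conjE)
    assume d: "deg C A = 1" "deg A C = 1"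
    obtain g where g: "0 < g" "n C = 1 * g" "n A = 1 * g" "D C A = coset g 0"
      by (rule join_obtain[OF C A zero d]) simp_all
    obtain r where r: "0 < r" "r < n C" "2 * r \<noteq> n C" "D C C = coset (n C) (int r) \<union> coset (n C) (- int r)"
      by (rule loop_obtain[OF C]) (use sumC d in simp)
    obtain s where s: "0 < s" "s < n A" "2 * s \<noteq> n A" "D A A = coset (n A) (int s) \<union> coset (n A) (- int s)"
      by (rule loop_obtain[OF A]) (use sumA d in simp)
    show ?thesis
      by (rule shapeI[of "Gamma2 g r s" C A B, OF listed_shape.intros(2)])
        (use ABC B r s g in \<open>simp_all add: Gamma_defs scheme_diffs_def\<close>)
  next
    assume d: "deg C A = 1" "deg A C = 2"
    obtain g where g: "0 < g" "n C = 2 * g" "n A = 1 * g" "D C A = coset g 0"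
      by (rule join_obtain[OF C A zero d]) simp_all
    obtain r where r: "0 < r" "r < n C" "2 * r \<noteq> n C" "D C C = coset (n C) (int r) \<union> coset (n C) (- int r)"
      by (rule loop_obtain[OF C]) (use sumC d in simp)
    have semiA: "even (n A)" "D A A = coset (n A) (int (n A div 2))" using semi_arcs[OF A] sumA d by simp_all
    show ?thesis
      by (rule shapeI[of "Gamma5 g r" C A B, OF listed_shape.intros(5)])
        (use ABC B r semiA g in \<open>simp_all add: Gamma_defs scheme_diffs_def gcd_multiples\<close>)
  next
    assume d: "deg C A = 1" "deg A C = 3"
    obtain g where g: "0 < g" "n C = 3 * g" "n A = 1 * g" "D C A = coset g 0"
      by (rule join_obtain[OF C A zero d]) simp_all
    obtain r where r: "0 < r" "r < n C" "2 * r \<noteq> n C" "D C C = coset (n C) (int r) \<union> coset (n C) (- int r)"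
      by (rule loop_obtain[OF C]) (use sumC d in simp)
    have noneA: "D A A = {}" using no_arcs[OF A A] sumA d by simp
    show ?thesis
      by (rule shapeI[of "Gamma6 g r" C A B, OF listed_shape.intros(6)])
        (use ABC B r noneA g in \<open>simp_all add: Gamma_defs scheme_diffs_def gcd_multiples\<close>)
  next
    assume d: "deg C A = 2" "deg A C = 2"
    obtain r where r: "n C = n A" "0 < r" "r < n A" "D C A = coset (n A) 0 \<union> coset (n A) (int r)"
      by (rule double_obtain[OF C A zero d])
    have semiA: "even (n A)" "D A A = coset (n A) (int (n A div 2))" using semi_arcs[OF A] sumA d by simp_all
    have semiC: "D C C = coset (n C) (int (n C div 2))" using semi_arcs[OF C] sumC d by simp_all
    show ?thesis
      by (rule shapeI[of "Gamma3 (n A) r" C A B, OF listed_shape.intros(3)])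
        (use ABC B r semiA semiC in \<open>simp_all add: Gamma_defs scheme_diffs_def\<close>)
  next
    assume d: "deg C A = 2" "deg A C = 3"
    obtain g where g: "0 < g" "n C = 3 * g" "n A = 2 * g" "D C A = coset g 0"
      by (rule join_obtain[OF C A zero d]) simp_all
    have semiC: "even (n C)" "D C C = coset (n C) (int (n C div 2))" using semi_arcs[OF C] sumC d by simp_all
    have noneA: "D A A = {}" using no_arcs[OF A A] sumA d by simp
    have "even g" using semiC(1) g(2) by simp
    then obtain j where j: "g = 2 * j" by (elim evenE)
    show ?thesis
      by (rule shapeI[of "Scheme (6 * j) (4 * j) 0 (rules Gamma7_2)" C A B, OF listed_shape.intros(7)])
        (use ABC B semiC noneA g j in \<open>simp_all add: Gamma_defs scheme_diffs_def gcd_multiples\<close>)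
  next
    assume d: "deg C A = 3" "deg A C = 3"
    have n: "n C = n A" using equal_sizes[OF C A] d by simp
    obtain r s where r: "0 < r" "r < s" "s < n A"
      "D C A = coset (n A) 0 \<union> coset (n A) (int r) \<union> coset (n A) (int s)"
      using shift_triple[OF C n d(1) zero] by blast
    have noneA: "D A A = {}" "D C C = {}" using no_arcs[OF A A] no_arcs[OF C C] sumA sumC d by simp_all
    show ?thesis
      by (rule shapeI[of "Gamma4 (n A) r s" C A B, OF listed_shape.intros(4)])
        (use ABC B r n noneA in \<open>simp_all add: Gamma_defs scheme_diffs_def Un_assoc\<close>)
  qed
qed

end

section \<open>Three orbits\<close>

context cubic_indexing
begin

text \<open>
  This occurs for an orbit of size \<open>n\<close> joined to an orbit of even size \<open>g = n div 2\<close> and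
  along a join with gcd \<open>h = n div 3\<close> to the other one; then \<open>12\<close> divides \<open>n\<close>.
\<close>

lemma common_multiple_obtain:
  fixes g h :: nat
  assumes "even g" "2 * g = 3 * h"
  obtains j where "g = 6 * j" "h = 4 * j"
proof -
  have "\<exists>j. g = 6 * j \<and> h = 4 * j" using assms by presburger
  then show thesis using that by blast
qed

text \<open>
  The orbit \<open>C\<close> lies between the leaves \<open>A\<close> and \<open>B\<close>, and spends its third edge on a semi rule. The
  degree of a leaf towards \<open>C\<close> settles what remains inside the leaf: a loop for \<open>1\<close>, a semi rule for
  \<open>2\<close> and nothing for \<open>3\<close>. The evenness required by the semi rules fixes the remaining parity.
\<close>

lemma classify_path_single:
  assumes ABC: "A \<noteq> B" "A \<noteq> C" "B \<noteq> C" and C: "0 < n C" and A: "0 < n A" and B: "0 < n B"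
    and zero: "0 \<in> D C A" "0 \<in> D C B" and nonadj: "D A B = {}"
    and deg: "deg C A = 1" "deg C B = 1" and le: "deg A C \<le> deg B C"
  shows "\<exists>S. listed_shape S \<and> graph_iso \<Gamma> (scheme_graph S)"
proof -
  have "D B A = {}" using diff_sym[OF B A] nonadj by blast
  then have "deg A B = 0" "deg B A = 0"
    using deg_zero_iff[OF A B] deg_zero_iff[OF B A] nonadj by simp_all
  then have sumA: "deg A A + deg A C = 3" and sumB: "deg B B + deg B C = 3"
    using deg_sum[OF ABC A] deg_sum[OF ABC B] by simp_all
  have sumC: "deg C C = 1" using deg_sum[OF ABC C] deg by simp
  have semiC: "even (n C)" "D C C = coset (n C) (int (n C div 2))" using semi_arcs[OF C sumC] by simp_all
  have pos: "0 < deg A C" "0 < deg B C"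
    using join_sizes(1)[OF C A _ deg_le[OF C] deg_le[OF A]] join_sizes(1)[OF C B _ deg_le[OF C] deg_le[OF B]] deg
    by simp_all
  have "deg A C = 1 \<and> deg B C = 1 \<or> deg A C = 1 \<and> deg B C = 2 \<or> deg A C = 1 \<and> deg B C = 3 \<or>
    deg A C = 2 \<and> deg B C = 2 \<or> deg A C = 2 \<and> deg B C = 3 \<or> deg A C = 3 \<and> deg B C = 3"
    using pos le sumA sumB by arith
  then show ?thesis
  proof (elim disjE conjE)
    assume d: "deg A C = 1" "deg B C = 1"
    obtain g where g: "0 < g" "n C = 1 * g" "n A = 1 * g" "D C A = coset g 0"
      by (rule join_obtain[OF C A zero(1) deg(1) d(1)]) simp_all
    obtain h where h: "0 < h" "n C = 1 * h" "n B = 1 * h" "D C B = coset h 0"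
      by (rule join_obtain[OF C B zero(2) deg(2) d(2)]) simp_all
    obtain r where r: "0 < r" "r < n A" "2 * r \<noteq> n A"
      "D A A = coset (n A) (int r) \<union> coset (n A) (- int r)"
      by (rule loop_obtain[OF A]) (use sumA d in simp)
    obtain s where s: "0 < s" "s < n B" "2 * s \<noteq> n B"
      "D B B = coset (n B) (int s) \<union> coset (n B) (- int s)"
      by (rule loop_obtain[OF B]) (use sumB d in simp)
    have m: "n C = g" "n A = g" "n B = g" "h = g" using g(2,3) h(2,3) by simp_all
    have shape: "listed_shape (Gamma25 g r s)"
      using semiC(1) r(1-3) s(1-3) unfolding m by (intro listed_shape.intros)
    show ?thesis
      by (rule shapeI[of "Gamma25 g r s" A C B, OF shape])
        (use ABC nonadj m g(4) h(4) semiC(2) r(4) s(4) in \<open>simp_all add: Gamma_defs scheme_diffs_def\<close>)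
  next
    assume d: "deg A C = 1" "deg B C = 2"
    obtain g where g: "0 < g" "n C = 1 * g" "n A = 1 * g" "D C A = coset g 0"
      by (rule join_obtain[OF C A zero(1) deg(1) d(1)]) simp_all
    obtain h where h: "0 < h" "n C = 2 * h" "n B = 1 * h" "D C B = coset h 0"
      by (rule join_obtain[OF C B zero(2) deg(2) d(2)]) simp_all
    obtain r where r: "0 < r" "r < n A" "2 * r \<noteq> n A"
      "D A A = coset (n A) (int r) \<union> coset (n A) (- int r)"
      by (rule loop_obtain[OF A]) (use sumA d in simp)
    have semiB: "even (n B)" "D B B = coset (n B) (int (n B div 2))"
      using semi_arcs[OF B] sumB d by simp_all
    have g': "n A = 2 * h" "D C A = coset (2 * h) 0" using g(2-4) h(2) by simp_all
    show ?thesis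
      by (rule shapeI[of "Gamma12 h r" C A B, OF listed_shape.intros(12)])
        (use ABC nonadj g' h semiC r semiB in \<open>simp_all add: Gamma_defs scheme_diffs_def gcd_multiples\<close>)
  next
    assume d: "deg A C = 1" "deg B C = 3"
    obtain g where g: "0 < g" "n C = 1 * g" "n A = 1 * g" "D C A = coset g 0"
      by (rule join_obtain[OF C A zero(1) deg(1) d(1)]) simp_all
    obtain h where h: "0 < h" "n C = 3 * h" "n B = 1 * h" "D C B = coset h 0"
      by (rule join_obtain[OF C B zero(2) deg(2) d(2)]) simp_all
    obtain r where r: "0 < r" "r < n A" "2 * r \<noteq> n A"
      "D A A = coset (n A) (int r) \<union> coset (n A) (- int r)"
      by (rule loop_obtain[OF A]) (use sumA d in simp)
    have noneB: "D B B = {}" using no_arcs[OF B B] sumB d by simp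
    have g': "n A = 3 * h" "D C A = coset (3 * h) 0" using g(2-4) h(2) by simp_all
    show ?thesis
      by (rule shapeI[of "Gamma13 h r" C A B, OF listed_shape.intros(13)])
        (use ABC nonadj g' h semiC r noneB in \<open>simp_all add: Gamma_defs scheme_diffs_def gcd_multiples\<close>)
  next
    assume d: "deg A C = 2" "deg B C = 2"
    obtain g where g: "0 < g" "n C = 2 * g" "n A = 1 * g" "D C A = coset g 0"
      by (rule join_obtain[OF C A zero(1) deg(1) d(1)]) simp_all
    obtain h where h: "0 < h" "n C = 2 * h" "n B = 1 * h" "D C B = coset h 0"
      by (rule join_obtain[OF C B zero(2) deg(2) d(2)]) simp_all
    have semiA: "even (n A)" "D A A = coset (n A) (int (n A div 2))"
      using semi_arcs[OF A] sumA d by simp_all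
    have semiB: "even (n B)" "D B B = coset (n B) (int (n B div 2))"
      using semi_arcs[OF B] sumB d by simp_all
    obtain j where j: "g = 2 * j" "h = 2 * j" using semiA(1) g(2,3) h(2) by (auto elim!: evenE)
    show ?thesis
      by (rule shapeI[of "Scheme (4 * j) (2 * j) (2 * j) (rules Gamma9_4)" C A B, OF listed_shape.intros(9)])
        (use ABC nonadj g h semiC semiA semiB j in \<open>simp_all add: Gamma_defs scheme_diffs_def gcd_multiples\<close>)
  next
    assume d: "deg A C = 2" "deg B C = 3"
    obtain g where g: "0 < g" "n C = 2 * g" "n A = 1 * g" "D C A = coset g 0"
      by (rule join_obtain[OF C A zero(1) deg(1) d(1)]) simp_all
    obtain h where h: "0 < h" "n C = 3 * h" "n B = 1 * h" "D C B = coset h 0"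
      by (rule join_obtain[OF C B zero(2) deg(2) d(2)]) simp_all
    have semiA: "even (n A)" "D A A = coset (n A) (int (n A div 2))"
      using semi_arcs[OF A] sumA d by simp_all
    have noneB: "D B B = {}" using no_arcs[OF B B] sumB d by simp
    have "even g" "2 * g = 3 * h" using semiA(1) g(2,3) h(2) by simp_all
    then obtain j where j: "g = 6 * j" "h = 4 * j" by (rule common_multiple_obtain)
    show ?thesis
      by (rule shapeI[of "Scheme (12 * j) (6 * j) (4 * j) (rules Gamma11_4)" C A B, OF listed_shape.intros(11)])
        (use ABC nonadj g h semiC semiA noneB j in \<open>simp_all add: Gamma_defs scheme_diffs_def gcd_multiples\<close>)
  next
    assume d: "deg A C = 3" "deg B C = 3"
    obtain g where g: "0 < g" "n C = 3 * g" "n A = 1 * g" "D C A = coset g 0"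
      by (rule join_obtain[OF C A zero(1) deg(1) d(1)]) simp_all
    obtain h where h: "0 < h" "n C = 3 * h" "n B = 1 * h" "D C B = coset h 0"
      by (rule join_obtain[OF C B zero(2) deg(2) d(2)]) simp_all
    have noneA: "D A A = {}" using no_arcs[OF A A] sumA d by simp
    have noneB: "D B B = {}" using no_arcs[OF B B] sumB d by simp
    have "even g" using semiC(1) g(2) by simp
    then obtain j where j: "g = 2 * j" "h = 2 * j" using g(2) h(2) by (auto elim!: evenE)
    show ?thesis
      by (rule shapeI[of "Scheme (6 * j) (2 * j) (2 * j) (rules Gamma10_2)" C A B, OF listed_shape.intros(10)])
        (use ABC nonadj g h semiC noneA noneB j in \<open>simp_all add: Gamma_defs scheme_diffs_def gcd_multiples\<close>)
  qed
qed

text \<open>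
  Here all edges of \<open>C\<close> go to the leaves, two of them to \<open>B\<close>. If \<open>B\<close> also sends two edges to \<open>C\<close>, the
  orbits have equal size and the second class of arcs carries a shift parameter.
\<close>

lemma classify_path_double:
  assumes ABC: "A \<noteq> B" "A \<noteq> C" "B \<noteq> C" and C: "0 < n C" and A: "0 < n A" and B: "0 < n B"
    and zero: "0 \<in> D C A" "0 \<in> D C B" and nonadj: "D A B = {}"
    and deg: "deg C A = 1" "deg C B = 2"
  shows "\<exists>S. listed_shape S \<and> graph_iso \<Gamma> (scheme_graph S)"
proof -
  have "D B A = {}" using diff_sym[OF B A] nonadj by blast
  then have "deg A B = 0" "deg B A = 0"
    using deg_zero_iff[OF A B] deg_zero_iff[OF B A] nonadj by simp_all
  then have sumA: "deg A A + deg A C = 3" and sumB: "deg B B + deg B C = 3"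
    using deg_sum[OF ABC A] deg_sum[OF ABC B] by simp_all
  have "deg C C = 0" using deg_sum[OF ABC C] deg by simp
  then have noneC: "D C C = {}" by (rule no_arcs[OF C C])
  have pos: "0 < deg A C" "0 < deg B C"
    using join_sizes(1)[OF C A _ deg_le[OF C] deg_le[OF A]] join_sizes(1)[OF C B _ deg_le[OF C] deg_le[OF B]] deg
    by simp_all
  have "(deg A C = 1 \<or> deg A C = 2 \<or> deg A C = 3) \<and> (deg B C = 1 \<or> deg B C = 2 \<or> deg B C = 3)"
    using pos sumA sumB by arith
  then show ?thesis
  proof (elim disjE conjE)
    assume d: "deg A C = 1" "deg B C = 1"
    obtain g where g: "0 < g" "n C = 1 * g" "n A = 1 * g" "D C A = coset g 0"
      by (rule join_obtain[OF C A zero(1) deg(1) d(1)]) simp_all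
    obtain h where h: "0 < h" "n C = 1 * h" "n B = 2 * h" "D C B = coset h 0"
      by (rule join_obtain[OF C B zero(2) deg(2) d(2)]) simp_all
    obtain r where r: "0 < r" "r < n A" "2 * r \<noteq> n A"
      "D A A = coset (n A) (int r) \<union> coset (n A) (- int r)"
      by (rule loop_obtain[OF A]) (use sumA d in simp)
    obtain s where s: "0 < s" "s < n B" "2 * s \<noteq> n B"
      "D B B = coset (n B) (int s) \<union> coset (n B) (- int s)"
      by (rule loop_obtain[OF B]) (use sumB d in simp)
    show ?thesis
      by (rule shapeI[of "Gamma17 g r s" C A B, OF listed_shape.intros(17)])
        (use ABC nonadj g h noneC r s in \<open>simp_all add: Gamma_defs scheme_diffs_def gcd_multiples\<close>)
  next
    assume d: "deg A C = 1" "deg B C = 2"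
    obtain g where g: "0 < g" "n C = 1 * g" "n A = 1 * g" "D C A = coset g 0"
      by (rule join_obtain[OF C A zero(1) deg(1) d(1)]) simp_all
    obtain t where h: "n C = n B" "0 < t" "t < n B" "D C B = coset (n B) 0 \<union> coset (n B) (int t)"
      by (rule double_obtain[OF C B zero(2) deg(2) d(2)])
    obtain r where r: "0 < r" "r < n A" "2 * r \<noteq> n A"
      "D A A = coset (n A) (int r) \<union> coset (n A) (- int r)"
      by (rule loop_obtain[OF A]) (use sumA d in simp)
    have semiB: "even (n B)" "D B B = coset (n B) (int (n B div 2))"
      using semi_arcs[OF B] sumB d by simp_all
    show ?thesis
      by (rule shapeI[of "Gamma22 g t r" A C B, OF listed_shape.intros(22)])
        (use ABC nonadj g h noneC r semiB in \<open>simp_all add: Gamma_defs scheme_diffs_def gcd_multiples\<close>)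
  next
    assume d: "deg A C = 1" "deg B C = 3"
    obtain g where g: "0 < g" "n C = 1 * g" "n A = 1 * g" "D C A = coset g 0"
      by (rule join_obtain[OF C A zero(1) deg(1) d(1)]) simp_all
    obtain h where h: "0 < h" "n C = 3 * h" "n B = 2 * h" "D C B = coset h 0"
      by (rule join_obtain[OF C B zero(2) deg(2) d(2)]) simp_all
    obtain r where r: "0 < r" "r < n A" "2 * r \<noteq> n A"
      "D A A = coset (n A) (int r) \<union> coset (n A) (- int r)"
      by (rule loop_obtain[OF A]) (use sumA d in simp)
    have noneB: "D B B = {}" using no_arcs[OF B B] sumB d by simp
    have g': "n A = 3 * h" "D C A = coset (3 * h) 0" using g(2-4) h(2) by simp_all
    show ?thesis
      by (rule shapeI[of "Gamma14 (2 * h) r" C A B, OF listed_shape.intros(14)])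
        (use ABC nonadj g' h noneC r noneB in \<open>simp_all add: Gamma_defs scheme_diffs_def gcd_multiples\<close>)
  next
    assume d: "deg A C = 2" "deg B C = 1"
    obtain g where g: "0 < g" "n C = 2 * g" "n A = 1 * g" "D C A = coset g 0"
      by (rule join_obtain[OF C A zero(1) deg(1) d(1)]) simp_all
    obtain h where h: "0 < h" "n C = 1 * h" "n B = 2 * h" "D C B = coset h 0"
      by (rule join_obtain[OF C B zero(2) deg(2) d(2)]) simp_all
    have semiA: "even (n A)" "D A A = coset (n A) (int (n A div 2))"
      using semi_arcs[OF A] sumA d by simp_all
    obtain s where s: "0 < s" "s < n B" "2 * s \<noteq> n B"
      "D B B = coset (n B) (int s) \<union> coset (n B) (- int s)"
      by (rule loop_obtain[OF B]) (use sumB d in simp)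
    show ?thesis
      by (rule shapeI[of "Gamma18 g s" B C A, OF listed_shape.intros(18)])
        (use ABC nonadj g h noneC semiA s in \<open>simp_all add: Gamma_defs scheme_diffs_def gcd_multiples\<close>)
  next
    assume d: "deg A C = 2" "deg B C = 2"
    obtain g where g: "0 < g" "n C = 2 * g" "n A = 1 * g" "D C A = coset g 0"
      by (rule join_obtain[OF C A zero(1) deg(1) d(1)]) simp_all
    obtain t where h: "n C = n B" "0 < t" "t < n B" "D C B = coset (n B) 0 \<union> coset (n B) (int t)"
      by (rule double_obtain[OF C B zero(2) deg(2) d(2)])
    have semiA: "even (n A)" "D A A = coset (n A) (int (n A div 2))"
      using semi_arcs[OF A] sumA d by simp_all
    have semiB: "even (n B)" "D B B = coset (n B) (int (n B div 2))"
      using semi_arcs[OF B] sumB d by simp_all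
    show ?thesis
      by (rule shapeI[of "Gamma21 g t" C B A, OF listed_shape.intros(21)])
        (use ABC nonadj g h noneC semiA semiB in \<open>simp_all add: Gamma_defs scheme_diffs_def gcd_multiples\<close>)
  next
    assume d: "deg A C = 2" "deg B C = 3"
    obtain g where g: "0 < g" "n C = 2 * g" "n A = 1 * g" "D C A = coset g 0"
      by (rule join_obtain[OF C A zero(1) deg(1) d(1)]) simp_all
    obtain h where h: "0 < h" "n C = 3 * h" "n B = 2 * h" "D C B = coset h 0"
      by (rule join_obtain[OF C B zero(2) deg(2) d(2)]) simp_all
    have semiA: "even (n A)" "D A A = coset (n A) (int (n A div 2))"
      using semi_arcs[OF A] sumA d by simp_all
    have noneB: "D B B = {}" using no_arcs[OF B B] sumB d by simp
    have "even g" "2 * g = 3 * h" using semiA(1) g(2,3) h(2) by simp_all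
    then obtain j where j: "g = 6 * j" "h = 4 * j" by (rule common_multiple_obtain)
    show ?thesis
      by (rule shapeI[of "Scheme (12 * j) (8 * j) (6 * j) (rules Gamma15_6)" C B A, OF listed_shape.intros(15)])
        (use ABC nonadj g h noneC semiA noneB j in \<open>simp_all add: Gamma_defs scheme_diffs_def gcd_multiples\<close>)
  next
    assume d: "deg A C = 3" "deg B C = 1"
    obtain g where g: "0 < g" "n C = 3 * g" "n A = 1 * g" "D C A = coset g 0"
      by (rule join_obtain[OF C A zero(1) deg(1) d(1)]) simp_all
    obtain h where h: "0 < h" "n C = 1 * h" "n B = 2 * h" "D C B = coset h 0"
      by (rule join_obtain[OF C B zero(2) deg(2) d(2)]) simp_all
    have noneA: "D A A = {}" using no_arcs[OF A A] sumA d by simp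
    obtain s where s: "0 < s" "s < n B" "2 * s \<noteq> n B"
      "D B B = coset (n B) (int s) \<union> coset (n B) (- int s)"
      by (rule loop_obtain[OF B]) (use sumB d in simp)
    show ?thesis
      by (rule shapeI[of "Gamma19 g s" B C A, OF listed_shape.intros(19)])
        (use ABC nonadj g h noneC noneA s in \<open>simp_all add: Gamma_defs scheme_diffs_def gcd_multiples\<close>)
  next
    assume d: "deg A C = 3" "deg B C = 2"
    obtain g where g: "0 < g" "n C = 3 * g" "n A = 1 * g" "D C A = coset g 0"
      by (rule join_obtain[OF C A zero(1) deg(1) d(1)]) simp_all
    obtain t where h: "n C = n B" "0 < t" "t < n B" "D C B = coset (n B) 0 \<union> coset (n B) (int t)"
      by (rule double_obtain[OF C B zero(2) deg(2) d(2)])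
    have noneA: "D A A = {}" using no_arcs[OF A A] sumA d by simp
    have semiB: "even (n B)" "D B B = coset (n B) (int (n B div 2))"
      using semi_arcs[OF B] sumB d by simp_all
    show ?thesis
      by (rule shapeI[of "Gamma20 g t" C B A, OF listed_shape.intros(20)])
        (use ABC nonadj g h noneC noneA semiB in \<open>simp_all add: Gamma_defs scheme_diffs_def gcd_multiples\<close>)
  next
    assume d: "deg A C = 3" "deg B C = 3"
    obtain g where g: "0 < g" "n C = 3 * g" "n A = 1 * g" "D C A = coset g 0"
      by (rule join_obtain[OF C A zero(1) deg(1) d(1)]) simp_all
    obtain h where h: "0 < h" "n C = 3 * h" "n B = 2 * h" "D C B = coset h 0"
      by (rule join_obtain[OF C B zero(2) deg(2) d(2)]) simp_all
    have noneA: "D A A = {}" using no_arcs[OF A A] sumA d by simp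
    have noneB: "D B B = {}" using no_arcs[OF B B] sumB d by simp
    show ?thesis
      by (rule shapeI[of "Scheme (3 * g) (2 * g) (1 * g) (rules Gamma16_1)" C B A, OF listed_shape.intros(16)])
        (use ABC nonadj g h noneC noneA noneB in \<open>simp_all add: Gamma_defs scheme_diffs_def gcd_multiples\<close>)
  qed
qed

text \<open>
  Base points can be aligned along two sides only, so the differences along the third side remain as
  parameters. That side must join orbits of equal size, which leaves three possibilities.
\<close>

lemma classify_triangle:
  assumes ABC: "A \<noteq> B" "A \<noteq> C" "B \<noteq> C" and C: "0 < n C" and A: "0 < n A" and B: "0 < n B"
    and zero: "0 \<in> D C A" "0 \<in> D C B" and adj: "D A B \<noteq> {}"
    and deg: "deg C A = 1" "deg C B = 1"
  shows "\<exists>S. listed_shape S \<and> graph_iso \<Gamma> (scheme_graph S)"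
proof -
  have posA: "0 < deg A B" using deg_zero_iff[OF A B] adj by simp
  have posB: "0 < deg B A" by (rule join_sizes(1)[OF A B posA deg_le[OF A] deg_le[OF B]])
  have sumA: "deg A A + deg A B + deg A C = 3" and sumB: "deg B A + deg B B + deg B C = 3"
    using deg_sum[OF ABC A] deg_sum[OF ABC B] by simp_all
  have "deg C C = 1" using deg_sum[OF ABC C] deg by simp
  then have semiC: "even (n C)" "D C C = coset (n C) (int (n C div 2))" using semi_arcs[OF C] by simp_all
  have pos: "0 < deg A C" "0 < deg B C"
    using join_sizes(1)[OF C A _ deg_le[OF C] deg_le[OF A]] join_sizes(1)[OF C B _ deg_le[OF C] deg_le[OF B]] deg
    by simp_all
  obtain g where g: "0 < g" "n C = deg A C * g" "n A = 1 * g" "D C A = coset g 0"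
    by (rule join_obtain[OF C A zero(1) deg(1) refl]) simp_all
  obtain h where h: "0 < h" "n C = deg B C * h" "n B = 1 * h" "D C B = coset h 0"
    by (rule join_obtain[OF C B zero(2) deg(2) refl]) simp_all
  have AB: "n A = n B \<and> deg A B = deg B A \<or>
    (\<exists>k. n A = deg B A * k \<and> n B = deg A B * k \<and> deg A B \<noteq> deg B A)"
    using join_sizes(2,3)[OF A B posA deg_le[OF A] deg_le[OF B]] by blast
  \<comment> \<open>The ratios of the sizes along the three sides multiply to \<open>1\<close>, which valency \<open>3\<close> allows only for
    equal sizes of \<open>A\<close> and \<open>B\<close>.\<close>
  have "deg A C = deg B C \<and> n A = n B \<and> deg A B = deg B A"
    using AB
  proof (elim disjE exE conjE)
    assume n: "n A = n B" "deg A B = deg B A"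
    then have "deg A C * g = deg B C * g" using g h by simp
    then show ?thesis using n g(1) by simp
  next
    fix k assume k: "n A = deg B A * k" "n B = deg A B * k" "deg A B \<noteq> deg B A"
    have "deg A C * (deg B A * k) = deg B C * (deg A B * k)" using k(1,2) g(2,3) h(2,3) by auto
    then have "(deg A C * deg B A) * k = (deg B C * deg A B) * k" by (simp only: mult.assoc)
    moreover have "0 < k" using k(1) A by (auto intro: gr0I)
    ultimately have eq: "deg A C * deg B A = deg B C * deg A B" by simp
    have "deg A C = 1 \<or> deg A C = 2" "deg B C = 1 \<or> deg B C = 2"
      using sumA sumB posA posB pos by arith+
    then show ?thesis using eq k(3) sumA sumB by (elim disjE) simp_all
  qed
  then have n: "deg A C = deg B C" "n A = n B" "deg A B = deg B A" by simp_all
  have "deg A C = 1 \<and> deg A B = 1 \<or> deg A C = 1 \<and> deg A B = 2 \<or> deg A C = 2 \<and> deg A B = 1"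
    using sumA posA pos by arith
  then show ?thesis
  proof (elim disjE conjE)
    assume d: "deg A C = 1" "deg A B = 1"
    then have e: "deg B C = 1" "deg B A = 1" using n by simp_all
    obtain r where r: "r < n B" "D A B = coset (n B) (int r)" by (rule shift_single[OF A n(2) d(2)])
    have semiA: "D A A = coset (n A) (int (n A div 2))" using semi_arcs[OF A] sumA d by simp
    have semiB: "D B B = coset (n B) (int (n B div 2))" using semi_arcs[OF B] sumB d n by simp
    show ?thesis
      by (rule shapeI[of "Gamma24 g r" B C A, OF listed_shape.intros(24)])
        (use ABC g h n(2) d e semiA semiB semiC r in \<open>simp_all add: Gamma_defs scheme_diffs_def\<close>)
  next
    assume d: "deg A C = 1" "deg A B = 2"
    then have e: "deg B C = 1" "deg B A = 2" using n by simp_all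
    obtain r s where r: "r < s" "s < n B" "D A B = coset (n B) (int r) \<union> coset (n B) (int s)"
      using shift_double[OF A n(2) d(2)] by metis
    have noneA: "D A A = {}" "D B B = {}" using no_arcs[OF A A] no_arcs[OF B B] sumA sumB d n by simp_all
    show ?thesis
      by (rule shapeI[of "Gamma23 g r s" A B C, OF listed_shape.intros(23)])
        (use ABC g h n(2) d e noneA semiC r in \<open>simp_all add: Gamma_defs scheme_diffs_def\<close>)
  next
    assume d: "deg A C = 2" "deg A B = 1"
    then have e: "deg B C = 2" "deg B A = 1" using n by simp_all
    obtain r where r: "r < n B" "D A B = coset (n B) (int r)" by (rule shift_single[OF A n(2) d(2)])
    have noneA: "D A A = {}" "D B B = {}" using no_arcs[OF A A] no_arcs[OF B B] sumA sumB d n by simp_all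
    show ?thesis
      by (rule shapeI[of "Gamma8 g r" C A B, OF listed_shape.intros(8)])
        (use ABC g h n(2) d e noneA semiC r in \<open>simp_all add: Gamma_defs scheme_diffs_def gcd_multiples\<close>)
  qed
qed

end

context indexing
begin

lemma cubic_indexingI:
  assumes "pair_graph \<Gamma>" "cubic \<Gamma>"
  shows "cubic_indexing \<Gamma> n D \<phi>"
proof (rule cubic_indexing.intro[OF indexing_axioms cubic_indexing_axioms.intro])
  fix X assume X: "0 < n X"
  show "0 \<notin> D X X" using assms(1) X pair_graph_iff by blast
  have "(\<Sum>Y \<in> {FU, FV, FW}. deg X Y) = 3" using assms(2) X cubic_iff by (simp only: deg_def)
  then show "deg X FU + deg X FV + deg X FW = 3" by simp
qed

text \<open>
  Degrees do not depend on the base points.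
\<close>

lemma card_translate:
  assumes XY: "0 < n X" "0 < n Y"
  shows "card ({t. t + k \<in> D X Y} \<inter> {0..<int (n Y)}) = deg X Y"
proof -
  let ?m = "int (n Y)"
  have g: "int (gcd (n X) (n Y)) dvd s mod ?m - s" for s
  proof -
    have "?m dvd s mod ?m - s" by (metis dvd_minus_iff dvd_minus_mod minus_diff_eq)
    then show ?thesis by (rule dvd_trans[rotated]) simp
  qed
  have mem: "s mod ?m \<in> D X Y \<longleftrightarrow> s \<in> D X Y" for s by (rule diff_cong[OF XY g])
  have mem': "(s - k) mod ?m + k \<in> D X Y \<longleftrightarrow> s \<in> D X Y" for s
    by (rule diff_cong[OF XY]) (use g[of "s - k"] in \<open>simp add: algebra_simps\<close>)
  have "bij_betw (\<lambda>t. (t + k) mod ?m) ({t. t + k \<in> D X Y} \<inter> {0..<?m}) (D X Y \<inter> {0..<?m})"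
  proof (rule bij_betw_byWitness[where f' = "\<lambda>s. (s - k) mod ?m"])
    show "\<forall>t\<in>{t. t + k \<in> D X Y} \<inter> {0..<?m}. ((t + k) mod ?m - k) mod ?m = t"
      by (auto simp: mod_simps)
    show "\<forall>s\<in>D X Y \<inter> {0..<?m}. ((s - k) mod ?m + k) mod ?m = s" by (auto simp: mod_simps)
    show "(\<lambda>t. (t + k) mod ?m) ` ({t. t + k \<in> D X Y} \<inter> {0..<?m}) \<subseteq> D X Y \<inter> {0..<?m}"
      using mem XY by auto
    show "(\<lambda>s. (s - k) mod ?m) ` (D X Y \<inter> {0..<?m}) \<subseteq> {t. t + k \<in> D X Y} \<inter> {0..<?m}"
      using mem' XY by auto
  qed
  then show ?thesis unfolding deg_def by (rule bij_betw_same_card)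
qed

text \<open>
  Moving the base point of each other orbit along an arc from the orbit \<open>C\<close> makes \<open>0\<close> a difference
  from \<open>C\<close> to every orbit adjacent to it.
\<close>

lemma rebase_star:
  obtains D' \<phi>' where "indexing \<Gamma> n D' \<phi>'"
    and "\<And>X. X \<noteq> C \<Longrightarrow> D C X \<noteq> {} \<Longrightarrow> 0 \<in> D' C X"
    and "\<And>X Y. D' X Y = {} \<longleftrightarrow> D X Y = {}"
    and "\<And>X Y. 0 < n X \<Longrightarrow> 0 < n Y \<Longrightarrow> indexing.deg n D' X Y = deg X Y"
proof -
  define c where "c X = (if X = C then 0 else SOME t. t \<in> D C X)" for X
  define D' where "D' X Y = {t. t + c Y - c X \<in> D X Y}" for X Y
  have idx: "indexing \<Gamma> n D' (\<lambda>X i. \<phi> X (i + c X))" unfolding D'_def by (rule indexing_rebase)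
  show thesis
  proof (rule that[OF idx])
    fix X assume "X \<noteq> C" "D C X \<noteq> {}"
    then show "0 \<in> D' C X" using some_in_eq[of "D C X"] by (simp add: D'_def c_def)
  next
    fix X Y
    have "t \<in> D X Y \<longleftrightarrow> t - c Y + c X \<in> D' X Y" for t by (simp add: D'_def)
    then show "D' X Y = {} \<longleftrightarrow> D X Y = {}" unfolding D'_def by blast
  next
    fix X Y assume XY: "0 < n X" "0 < n Y"
    have "D' X Y = {t. t + (c Y - c X) \<in> D X Y}" by (simp add: D'_def algebra_simps)
    then show "indexing.deg n D' X Y = deg X Y"
      using card_translate[OF XY] unfolding indexing.deg_def[OF idx] by simp
  qed
qed

text \<open>
  A connected graph has an edge leaving any proper nonempty union of orbits.
\<close>

lemma connected_adjacent:
  assumes conn: "connected (with_proj \<Gamma>)" and "0 < n A" "A \<in> P" "0 < n B" "B \<notin> P"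
  obtains X Y where "0 < n X" "0 < n Y" "X \<in> P" "Y \<notin> P" "D X Y \<noteq> {}"
proof -
  have "(\<phi> A 0, \<phi> B 0) \<in> (parcs \<Gamma>)\<^sup>*"
    using conn assms(2,4) index_in_verts unfolding connected_iff_rtrancl[OF pseudo] by blast
  moreover have "\<exists>X i. 0 < n X \<and> X \<in> P \<and> v = \<phi> X i"
    if "(\<phi> A 0, v) \<in> (parcs \<Gamma>)\<^sup>*" and no: "\<not> (\<exists>X Y. 0 < n X \<and> 0 < n Y \<and> X \<in> P \<and> Y \<notin> P \<and> D X Y \<noteq> {})" for v
    using that(1)
  proof (induction rule: rtrancl_induct)
    case base then show ?case using assms by blast
  next
    case (step u v)
    then obtain X i where X: "0 < n X" "X \<in> P" "u = \<phi> X i" by blast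
    obtain Z k Y j where Y: "0 < n Y" "v = \<phi> Y j" using step(2) by (elim arc_cases)
    have "j - i \<in> D X Y" using step(2) arc_iff[OF X(1) Y(1)] X(3) Y(2) by simp
    then have "Y \<in> P" using no X Y by blast
    then show ?case using Y by blast
  qed
  ultimately have "(\<exists>X Y. 0 < n X \<and> 0 < n Y \<and> X \<in> P \<and> Y \<notin> P \<and> D X Y \<noteq> {}) \<or>
      (\<exists>X i. 0 < n X \<and> X \<in> P \<and> \<phi> B 0 = \<phi> X i)" by blast
  moreover have "\<not> (\<exists>X i. 0 < n X \<and> X \<in> P \<and> \<phi> B 0 = \<phi> X i)"
    using eq_iff[OF assms(4)] assms(5) by blast
  ultimately show thesis using that by blast
qed

lemma empty_sym: "0 < n X \<Longrightarrow> 0 < n Y \<Longrightarrow> D X Y = {} \<longleftrightarrow> D Y X = {}"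
  using diff_sym[of X Y] diff_sym[of Y X] by blast

end

context cubic_indexing
begin

lemma classify_two_orbits_ordered:
  assumes ABC: "A \<noteq> B" "A \<noteq> C" "B \<noteq> C" and C: "0 < n C" and A: "0 < n A" and B: "n B = 0"
    and adj: "D C A \<noteq> {}" and le: "deg C A \<le> deg A C" and G: "pair_graph \<Gamma>" "cubic \<Gamma>"
  shows "\<exists>S. listed_shape S \<and> graph_iso \<Gamma> (scheme_graph S)"
proof (rule rebase_star[of C])
  fix D' \<phi>'
  assume idx: "indexing \<Gamma> n D' \<phi>'"
    and zero: "\<And>X. X \<noteq> C \<Longrightarrow> D C X \<noteq> {} \<Longrightarrow> 0 \<in> D' C X"
    and deg: "\<And>X Y. 0 < n X \<Longrightarrow> 0 < n Y \<Longrightarrow> indexing.deg n D' X Y = deg X Y"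
  interpret I: cubic_indexing \<Gamma> n D' \<phi>' by (rule indexing.cubic_indexingI[OF idx G])
  show ?thesis
    using I.classify_two_orbits[OF ABC C A B zero[OF ABC(2) adj]] le deg[OF C A] deg[OF A C] by simp
qed

lemma classify_star:
  assumes ABC: "A \<noteq> B" "A \<noteq> C" "B \<noteq> C" and C: "0 < n C" and A: "0 < n A" and B: "0 < n B"
    and adj: "D C A \<noteq> {}" "D C B \<noteq> {}"
    and cond: "D A B = {} \<and> deg C A = 1 \<and> (deg C B = 1 \<and> deg A C \<le> deg B C \<or> deg C B = 2) \<or>
      D A B \<noteq> {} \<and> deg C A = 1 \<and> deg C B = 1"
    and G: "pair_graph \<Gamma>" "cubic \<Gamma>"
  shows "\<exists>S. listed_shape S \<and> graph_iso \<Gamma> (scheme_graph S)"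
proof (rule rebase_star[of C])
  fix D' \<phi>'
  assume idx: "indexing \<Gamma> n D' \<phi>'"
    and zero: "\<And>X. X \<noteq> C \<Longrightarrow> D C X \<noteq> {} \<Longrightarrow> 0 \<in> D' C X"
    and empty: "\<And>X Y. D' X Y = {} \<longleftrightarrow> D X Y = {}"
    and deg: "\<And>X Y. 0 < n X \<Longrightarrow> 0 < n Y \<Longrightarrow> indexing.deg n D' X Y = deg X Y"
  interpret I: cubic_indexing \<Gamma> n D' \<phi>' by (rule indexing.cubic_indexingI[OF idx G])
  note args = ABC C A B zero[OF ABC(2) adj(1)] zero[OF ABC(3) adj(2)]
  note deg' = deg[OF C A] deg[OF C B] deg[OF A C] deg[OF B C]
  from cond show ?thesis
    using I.classify_path_single[OF args] I.classify_path_double[OF args] I.classify_triangle[OF args]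
    unfolding deg' empty by blast
qed

lemma classify_path:
  assumes ABC: "A \<noteq> B" "A \<noteq> C" "B \<noteq> C" and C: "0 < n C" and A: "0 < n A" and B: "0 < n B"
    and adj: "D C A \<noteq> {}" "D C B \<noteq> {}" and nonadj: "D A B = {}" and G: "pair_graph \<Gamma>" "cubic \<Gamma>"
  shows "\<exists>S. listed_shape S \<and> graph_iso \<Gamma> (scheme_graph S)"
proof -
  have pos: "0 < deg C A" "0 < deg C B" using deg_zero_iff[OF C A] deg_zero_iff[OF C B] adj by simp_all
  have nonadj': "D B A = {}" using nonadj empty_sym[OF A B] by simp
  have "deg C A + deg C B \<le> 3" using deg_sum[OF ABC C] by simp
  then consider "deg C A = 1" "deg C B = 1" "deg A C \<le> deg B C" | "deg C A = 1" "deg C B = 2"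
    | "deg C B = 1" "deg C A = 1" "deg B C \<le> deg A C" | "deg C B = 1" "deg C A = 2"
    using pos by fastforce
  then show ?thesis
  proof cases
    case 1 then show ?thesis using classify_star[OF ABC C A B adj _ G] nonadj by simp
  next
    case 2 then show ?thesis using classify_star[OF ABC C A B adj _ G] nonadj by simp
  next
    case 3
    then show ?thesis
      using classify_star[OF ABC(1)[symmetric] ABC(3,2) C B A adj(2,1) _ G] nonadj' by simp
  next
    case 4
    then show ?thesis
      using classify_star[OF ABC(1)[symmetric] ABC(3,2) C B A adj(2,1) _ G] nonadj' by simp
  qed
qed

text \<open>
  Otherwise each of the three orbits sends two edges to one of the others and one edge to the third.
  The resulting ratios of sizes around the triangle are then powers of \<open>2\<close> that do not multiply
  to \<open>1\<close>.
\<close>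

lemma triangle_centre:
  assumes ABC: "A \<noteq> B" "A \<noteq> C" "B \<noteq> C" and C: "0 < n C" and A: "0 < n A" and B: "0 < n B"
    and adj: "D C A \<noteq> {}" "D C B \<noteq> {}" "D A B \<noteq> {}"
  shows "deg C A = 1 \<and> deg C B = 1 \<or> deg A B = 1 \<and> deg A C = 1 \<or> deg B A = 1 \<and> deg B C = 1"
proof (rule ccontr)
  assume no: "\<not> ?thesis"
  have pos: "0 < deg C A" "0 < deg C B" "0 < deg A B"
    using deg_zero_iff[OF C A] deg_zero_iff[OF C B] deg_zero_iff[OF A B] adj by simp_all
  have pos': "0 < deg A C" "0 < deg B C" "0 < deg B A"
    using join_sizes(1)[OF C A pos(1) deg_le[OF C] deg_le[OF A]]
      join_sizes(1)[OF C B pos(2) deg_le[OF C] deg_le[OF B]]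
      join_sizes(1)[OF A B pos(3) deg_le[OF A] deg_le[OF B]] by simp_all
  have sums: "deg C A + deg C B \<le> 3" "deg A B + deg A C \<le> 3" "deg B A + deg B C \<le> 3"
    using deg_sum[OF ABC C] deg_sum[OF ABC A] deg_sum[OF ABC B] by linarith+
  have ratio: "n X * deg X Y = n Y * deg Y X" if "0 < n X" "0 < n Y" "0 < deg X Y" for X Y
    using join_sizes(2,3)[OF that deg_le[OF that(1)] deg_le[OF that(2)]]
    by (cases "deg X Y = deg Y X") (simp, metis mult.assoc mult.commute)
  have C': "deg C A = 1 \<and> deg C B = 2 \<or> deg C A = 2 \<and> deg C B = 1"
    and A': "deg A B = 1 \<and> deg A C = 2 \<or> deg A B = 2 \<and> deg A C = 1"
    and B': "deg B A = 1 \<and> deg B C = 2 \<or> deg B A = 2 \<and> deg B C = 1"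
    using no pos pos' sums by linarith+
  show False
    using C' A' B' ratio[OF C A pos(1)] ratio[OF C B pos(2)] ratio[OF A B pos(3)] A B C
    by (elim disjE conjE) simp_all
qed

text \<open>
  Three connected orbits form a path or a triangle; only the choice of the middle orbit remains.
\<close>

lemma classify_three_orbits:
  assumes all: "0 < n FU" "0 < n FV" "0 < n FW" and conn: "connected (with_proj \<Gamma>)"
    and G: "pair_graph \<Gamma>" "cubic \<Gamma>"
  shows "\<exists>S. listed_shape S \<and> graph_iso \<Gamma> (scheme_graph S)"
proof -
  have present: "0 < n X" for X using all by (cases X) simp_all
  have sym: "D X Y = {} \<longleftrightarrow> D Y X = {}" for X Y by (rule empty_sym[OF present present])
  have out: "(\<exists>Y. Y \<noteq> X \<and> D X Y \<noteq> {})" for X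
  proof -
    obtain Z where "Z \<noteq> X" by (cases X) auto
    obtain V Y where "V \<in> {X}" "Y \<notin> {X}" "D V Y \<noteq> {}"
      by (rule connected_adjacent[OF conn present[of X] _ present[of Z], of "{X}"]) (use \<open>Z \<noteq> X\<close> in simp_all)
    then show ?thesis by auto
  qed
  have path: ?thesis if "A \<noteq> B" "A \<noteq> C" "B \<noteq> C" "D C A \<noteq> {}" "D C B \<noteq> {}" "D A B = {}" for A B C
    by (rule classify_path[OF that(1-3) present present present that(4-6) G])
  have star: ?thesis if "A \<noteq> B" "A \<noteq> C" "B \<noteq> C" "D C A \<noteq> {}" "D C B \<noteq> {}" "D A B \<noteq> {}"
    "deg C A = 1" "deg C B = 1" for A B C
    using classify_star[OF that(1-3) present present present that(4,5) _ G] that(6-8) by blast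
  show ?thesis
  proof (cases "D FU FV \<noteq> {} \<and> D FU FW \<noteq> {} \<and> D FV FW \<noteq> {}")
    case True
    then have adj: "D FU FV \<noteq> {}" "D FU FW \<noteq> {}" "D FV FW \<noteq> {}" "D FV FU \<noteq> {}" "D FW FU \<noteq> {}" "D FW FV \<noteq> {}"
      using sym by blast+
    have "deg FW FU = 1 \<and> deg FW FV = 1 \<or> deg FU FV = 1 \<and> deg FU FW = 1 \<or> deg FV FU = 1 \<and> deg FV FW = 1"
      by (rule triangle_centre) (use present adj in auto)
    then show ?thesis
    proof (elim disjE conjE)
      assume "deg FW FU = 1" "deg FW FV = 1"
      then show ?thesis by (intro star[of FU FV FW]) (simp_all add: adj)
    next
      assume "deg FU FV = 1" "deg FU FW = 1"
      then show ?thesis by (intro star[of FV FW FU]) (simp_all add: adj)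
    next
      assume "deg FV FU = 1" "deg FV FW = 1"
      then show ?thesis by (intro star[of FU FW FV]) (simp_all add: adj)
    qed
  next
    case False
    have other: "D X A \<noteq> {} \<or> D X B \<noteq> {}" if "X \<noteq> A" "X \<noteq> B" "A \<noteq> B" for X A B
    proof -
      obtain Y where Y: "Y \<noteq> X" "D X Y \<noteq> {}" using out by blast
      have "Y = A \<or> Y = B" using that Y(1) by (cases X; cases A; cases B; cases Y) simp_all
      then show ?thesis using Y(2) by (elim disjE) simp_all
    qed
    have nonempty: "D FU FV \<noteq> {} \<or> D FU FW \<noteq> {}" "D FU FV \<noteq> {} \<or> D FV FW \<noteq> {}"
      "D FU FW \<noteq> {} \<or> D FV FW \<noteq> {}"
      using other[of FU FV FW] other[of FV FU FW] other[of FW FU FV] sym[of FV FU] sym[of FW FU] sym[of FW FV]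
      by simp_all
    show ?thesis
    proof (cases "D FU FV = {}")
      case True
      then show ?thesis
        by (intro path[of FU FV FW]) (use nonempty sym[of FW FU] sym[of FW FV] in simp_all)
    next
      case UV: False
      show ?thesis
      proof (cases "D FU FW = {}")
        case True
        then show ?thesis
          by (intro path[of FU FW FV]) (use nonempty UV sym[of FV FU] in simp_all)
      next
        case UW: False
        then have "D FV FW = {}" using False UV by blast
        then show ?thesis
          by (intro path[of FV FW FU]) (use UV UW in simp_all)
      qed
    qed
  qed
qed

lemma classify:
  assumes conn: "connected (with_proj \<Gamma>)" and G: "pair_graph \<Gamma>" "cubic \<Gamma>"
  shows "\<exists>S. listed_shape S \<and> graph_iso \<Gamma> (scheme_graph S)"
proof -
  have two: ?thesis if ABC: "A \<noteq> B" "A \<noteq> C" "B \<noteq> C" and C: "0 < n C" and A: "0 < n A" and B: "n B = 0" for A B C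
  proof -
    have fib: "X = A \<or> X = B \<or> X = C" for X using ABC by (cases A; cases B; cases C; cases X) simp_all
    obtain X Y where "0 < n X" "0 < n Y" "X \<in> {C}" "Y \<notin> {C}" "D X Y \<noteq> {}"
      by (rule connected_adjacent[OF conn C _ A, of "{C}"]) (use ABC in auto)
    then have adj: "D C A \<noteq> {}" using fib[of Y] B by auto
    then have adj': "D A C \<noteq> {}" using empty_sym[OF C A] by simp
    show ?thesis
    proof (cases "deg C A \<le> deg A C")
      case True
      show ?thesis by (rule classify_two_orbits_ordered[OF ABC C A B adj True G])
    next
      case False
      then have le: "deg A C \<le> deg C A" by simp
      show ?thesis
        by (rule classify_two_orbits_ordered[OF ABC(3)[symmetric] ABC(2)[symmetric] ABC(1)[symmetric] A C B adj' le G])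
    qed
  qed
  have one: ?thesis if "A \<noteq> B" "A \<noteq> C" "B \<noteq> C" "0 < n C" "n A = 0" "n B = 0" for A B C
    by (rule classify_one_orbit[OF that])
  have "\<exists>X. 0 < n X" using conn verts unfolding connected_iff_rtrancl[OF pseudo] by blast
  then have "0 < n FU \<or> 0 < n FV \<or> 0 < n FW" by (metis fibre.exhaust)
  then consider (three) "0 < n FU" "0 < n FV" "0 < n FW" | (VW) "n FU = 0" "0 < n FV" "0 < n FW"
    | (UW) "n FV = 0" "0 < n FU" "0 < n FW" | (UV) "n FW = 0" "0 < n FU" "0 < n FV"
    | (U) "0 < n FU" "n FV = 0" "n FW = 0" | (V) "0 < n FV" "n FU = 0" "n FW = 0"
    | (W) "0 < n FW" "n FU = 0" "n FV = 0"
    by fastforce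
  then show ?thesis
  proof cases
    case three then show ?thesis by (rule classify_three_orbits[OF _ _ _ conn G])
  next
    case VW then show ?thesis using two[of FV FU FW] by simp
  next
    case UW then show ?thesis using two[of FU FV FW] by simp
  next
    case UV then show ?thesis using two[of FU FW FV] by simp
  next
    case U then show ?thesis using one[of FV FW FU] by simp
  next
    case V then show ?thesis using one[of FU FW FV] by simp
  next
    case W then show ?thesis using one[of FU FV FW] by simp
  qed
qed

end

section \<open>Coprimality conditions of the families\<close>

lemma ball_dvd_iff_eq_1: "(\<forall>d :: nat. d dvd x \<longrightarrow> d = 1) \<longleftrightarrow> x = 1"
  by (metis dvd_refl dvd_1_iff_1 One_nat_def)

text \<open>
  The common divisors of sizes and parameters are the divisors of a single number.
\<close>

lemma scheme_coprimeI:
  assumes "\<And>d. (\<forall>X. d dvd size_of S X) \<and> (\<forall>e \<in> set (rules S). d dvd rule_param (size_of S) e) \<longleftrightarrow> d dvd x"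
  shows "scheme_coprime S \<longleftrightarrow> x = 1"
proof -
  have "scheme_coprime S \<longleftrightarrow> (\<forall>d. d dvd x \<longrightarrow> d = 1)" unfolding scheme_coprime_def assms[symmetric] by blast
  then show ?thesis by (simp only: ball_dvd_iff_eq_1)
qed

lemma dvd_from_multiples:
  fixes d h :: nat
  shows "d dvd 2 * h \<Longrightarrow> d dvd 6 * h"
    and "d dvd 3 * h \<Longrightarrow> d dvd 2 * h \<Longrightarrow> d dvd h"
    and "d dvd 3 * h \<Longrightarrow> d dvd 4 * h \<Longrightarrow> d dvd h"
    and "d dvd 3 * h \<Longrightarrow> d dvd 8 * h \<Longrightarrow> d dvd h"
proof -
  show "d dvd 2 * h \<Longrightarrow> d dvd 6 * h" using dvd_mult[of d "2 * h" 3] by simp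
  show "d dvd 3 * h \<Longrightarrow> d dvd 2 * h \<Longrightarrow> d dvd h" using dvd_diff_nat[of d "3 * h" "2 * h"] by simp
  show "d dvd 3 * h \<Longrightarrow> d dvd 4 * h \<Longrightarrow> d dvd h" using dvd_diff_nat[of d "4 * h" "3 * h"] by simp
  show "d dvd 3 * h \<Longrightarrow> d dvd 8 * h \<Longrightarrow> d dvd h"
    using dvd_diff_nat[OF dvd_mult[of d "3 * h" 3], of "8 * h"] by simp
qed

lemma coprime_even:
  assumes "even m"
  shows "scheme_coprime (Gamma1 m r) \<longleftrightarrow> gcd (m div 2) r = 1"
    "scheme_coprime (Gamma3 m r) \<longleftrightarrow> gcd (m div 2) r = 1"
    "scheme_coprime (Gamma5 m r) \<longleftrightarrow> gcd (m div 2) r = 1"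
    "scheme_coprime (Gamma12 m r) \<longleftrightarrow> gcd (m div 2) r = 1"
    "scheme_coprime (Gamma13 m r) \<longleftrightarrow> gcd (m div 2) r = 1"
    "scheme_coprime (Gamma14 m r) \<longleftrightarrow> gcd (m div 2) r = 1"
    "scheme_coprime (Gamma18 m r) \<longleftrightarrow> gcd (m div 2) r = 1"
    "scheme_coprime (Gamma20 m r) \<longleftrightarrow> gcd (m div 2) r = 1"
    "scheme_coprime (Gamma21 m r) \<longleftrightarrow> gcd (m div 2) r = 1"
    "scheme_coprime (Gamma22 m r s) \<longleftrightarrow> gcd (m div 2) (gcd r s) = 1"
    "scheme_coprime (Gamma23 m r s) \<longleftrightarrow> gcd (m div 2) (gcd r s) = 1"
    "scheme_coprime (Gamma24 m r) \<longleftrightarrow> gcd (m div 2) r = 1"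
    "scheme_coprime (Gamma25 m r s) \<longleftrightarrow> gcd (m div 2) (gcd r s) = 1"
  by (rule scheme_coprimeI; use assms in \<open>auto simp: Gamma_defs all_fibre elim!: evenE intro: dvd_from_multiples(1,2)\<close>)+

lemma coprime_any:
  "scheme_coprime (Gamma2 m r s) \<longleftrightarrow> gcd m (gcd r s) = 1"
  "scheme_coprime (Gamma4 m r s) \<longleftrightarrow> gcd m (gcd r s) = 1"
  "scheme_coprime (Gamma6 m r) \<longleftrightarrow> gcd m r = 1"
  "scheme_coprime (Gamma8 m r) \<longleftrightarrow> gcd m r = 1"
  "scheme_coprime (Gamma17 m r s) \<longleftrightarrow> gcd m (gcd r s) = 1"
  "scheme_coprime (Gamma19 m r) \<longleftrightarrow> gcd m r = 1"
  by (rule scheme_coprimeI; auto simp: Gamma_defs all_fibre)+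

lemma coprime_exceptional:
  "scheme_coprime (Scheme (6 * j) (4 * j) 0 (rules Gamma7_2)) \<longleftrightarrow> j = 1"
  "scheme_coprime (Scheme (4 * j) (2 * j) (2 * j) (rules Gamma9_4)) \<longleftrightarrow> j = 1"
  "scheme_coprime (Scheme (6 * j) (2 * j) (2 * j) (rules Gamma10_2)) \<longleftrightarrow> j = 1"
  "scheme_coprime (Scheme (12 * j) (6 * j) (4 * j) (rules Gamma11_4)) \<longleftrightarrow> j = 1"
  "scheme_coprime (Scheme (12 * j) (8 * j) (6 * j) (rules Gamma15_6)) \<longleftrightarrow> j = 1"
  "scheme_coprime (Scheme (3 * j) (2 * j) (1 * j) (rules Gamma16_1)) \<longleftrightarrow> j = 1"
  by (rule scheme_coprimeI; auto simp: Gamma_defs all_fibre intro: dvd_from_multiples)+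

text \<open>
  Both directions of the classification at the level of families: the analysis of orbits produces the
  shape, and connectedness is equivalent to its coprimality condition.
\<close>

lemma admissible_iff_shape:
  assumes "pair_pseudo_graph \<Gamma>"
  shows "pair_graph \<Gamma> \<and> connected (with_proj \<Gamma>) \<and> cubic \<Gamma> \<and> (\<exists>k \<le> 3. cyclic_aut_group_with_orbits \<Gamma> k) \<longleftrightarrow>
    (\<exists>S. listed_shape S \<and> scheme_coprime S \<and> graph_iso \<Gamma> (scheme_graph S))" (is "?L \<longleftrightarrow> ?R")
proof
  assume L: ?L
  then obtain n D \<phi> where idx: "indexing \<Gamma> n D \<phi>" using exists_indexing[OF assms] by blast
  interpret cubic_indexing \<Gamma> n D \<phi> by (rule indexing.cubic_indexingI[OF idx]) (use L in simp_all)
  obtain S where S: "listed_shape S" "graph_iso \<Gamma> (scheme_graph S)"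
    using classify L by blast
  obtain C where C: "star_scheme S C" using listed_shape_sound(2)[OF S(1)] by blast
  obtain \<psi> where \<psi>: "indexing \<Gamma> (size_of S) (scheme_diffs S) \<psi>"
    using S graph_iso_scheme_iff[OF listed_shape_wf assms] by blast
  have "scheme_coprime S"
    using scheme_connected_iff[OF listed_shape_wf[OF S(1)] C \<psi>] L by blast
  with S show ?R by blast
next
  assume ?R
  then obtain S where S: "listed_shape S" "scheme_coprime S" "graph_iso \<Gamma> (scheme_graph S)" by blast
  obtain C where C: "star_scheme S C" using listed_shape_sound(2)[OF S(1)] by blast
  show ?L by (rule scheme_graph_sound[OF assms listed_shape_sound(1)[OF S(1)] C S(2,3)])
qed

section \<open>The list with its conditions\<close>

text \<open>
  The eleven alternatives of the theorem as one predicate on schemes.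
\<close>

inductive listed_scheme :: "scheme \<Rightarrow> bool" where
  exceptional: "S \<in> {Gamma7_2, Gamma9_4, Gamma10_2, Gamma11_4, Gamma15_6, Gamma16_1} \<Longrightarrow> listed_scheme S"
| family_1: "even m \<Longrightarrow> m \<ge> 4 \<Longrightarrow> r \<noteq> 0 \<Longrightarrow> gcd (m div 2) r = 1 \<Longrightarrow> params_ok (Gamma1 m r) \<Longrightarrow>
    listed_scheme (Gamma1 m r)"
| family_half: "F \<in> {Gamma3, Gamma12, Gamma13, Gamma14, Gamma18, Gamma20, Gamma21} \<Longrightarrow> m > 0 \<Longrightarrow> even m \<Longrightarrow>
    r \<noteq> 0 \<Longrightarrow> gcd (m div 2) r = 1 \<Longrightarrow> params_ok (F m r) \<Longrightarrow> listed_scheme (F m r)"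
| family_full: "F \<in> {Gamma6, Gamma19} \<Longrightarrow> m > 0 \<Longrightarrow> r \<noteq> 0 \<Longrightarrow> gcd m r = 1 \<Longrightarrow> params_ok (F m r) \<Longrightarrow>
    listed_scheme (F m r)"
| family_8: "m > 0 \<Longrightarrow> gcd m r = 1 \<Longrightarrow> params_ok (Gamma8 m r) \<Longrightarrow> listed_scheme (Gamma8 m r)"
| family_full2: "F \<in> {Gamma2, Gamma17} \<Longrightarrow> m \<ge> 3 \<Longrightarrow> r \<noteq> 0 \<Longrightarrow> s \<noteq> 0 \<Longrightarrow> gcd m (gcd r s) = 1 \<Longrightarrow>
    params_ok (F m r s) \<Longrightarrow> listed_scheme (F m r s)"
| family_4: "m \<ge> 3 \<Longrightarrow> 0 < r \<Longrightarrow> r < s \<Longrightarrow> gcd m (gcd r s) = 1 \<Longrightarrow> params_ok (Gamma4 m r s) \<Longrightarrow>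
    listed_scheme (Gamma4 m r s)"
| family_5: "m > 0 \<Longrightarrow> even m \<Longrightarrow> r \<noteq> 0 \<Longrightarrow> gcd (m div 2) r = 1 \<Longrightarrow> params_ok (Gamma5 m r) \<Longrightarrow>
    listed_scheme (Gamma5 m r)"
| family_23: "m > 0 \<Longrightarrow> even m \<Longrightarrow> r \<noteq> s \<Longrightarrow> gcd (m div 2) (gcd r s) = 1 \<Longrightarrow> params_ok (Gamma23 m r s) \<Longrightarrow>
    listed_scheme (Gamma23 m r s)"
| family_24: "m > 0 \<Longrightarrow> even m \<Longrightarrow> gcd (m div 2) r = 1 \<Longrightarrow> params_ok (Gamma24 m r) \<Longrightarrow>
    listed_scheme (Gamma24 m r)"
| family_half2: "F \<in> {Gamma22, Gamma25} \<Longrightarrow> even m \<Longrightarrow> m \<ge> 4 \<Longrightarrow> r \<noteq> 0 \<Longrightarrow> s \<noteq> 0 \<Longrightarrow>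
    gcd (m div 2) (gcd r s) = 1 \<Longrightarrow> params_ok (F m r s) \<Longrightarrow> listed_scheme (F m r s)"

text \<open>
  A loop in a fibre of even size \<open>m\<close> needs \<open>m \<ge> 4\<close>, as the only residue other than \<open>0\<close> modulo \<open>2\<close> is
  half the size.
\<close>

lemma even_ge_4: "even m \<Longrightarrow> 0 < r \<Longrightarrow> r < m \<Longrightarrow> 2 * r \<noteq> m \<Longrightarrow> 4 \<le> m" for m r :: nat
  by presburger

lemma params_ok_Gamma:
  "params_ok (Gamma1 m r) \<longleftrightarrow> r < m \<and> r \<noteq> 0 \<and> 2 * r \<noteq> m"
  "params_ok (Gamma2 m r s) \<longleftrightarrow> r < m \<and> r \<noteq> 0 \<and> 2 * r \<noteq> m \<and> s < m \<and> s \<noteq> 0 \<and> 2 * s \<noteq> m"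
  "params_ok (Gamma3 m r) \<longleftrightarrow> r < m"
  "params_ok (Gamma4 m r s) \<longleftrightarrow> r < m \<and> s < m"
  "params_ok (Gamma5 m r) \<longleftrightarrow> r < 2 * m \<and> r \<noteq> 0 \<and> r \<noteq> m"
  "params_ok (Gamma6 m r) \<longleftrightarrow> r < 3 * m \<and> r \<noteq> 0 \<and> 2 * r \<noteq> 3 * m"
  "params_ok (Gamma8 m r) \<longleftrightarrow> r < m"
  "params_ok (Gamma12 m r) \<longleftrightarrow> r < 2 * m \<and> r \<noteq> 0 \<and> r \<noteq> m"
  "params_ok (Gamma13 m r) \<longleftrightarrow> r < 3 * m \<and> r \<noteq> 0 \<and> 2 * r \<noteq> 3 * m"
  "params_ok (Gamma14 m r) \<longleftrightarrow> r < 3 * m div 2 \<and> r \<noteq> 0 \<and> 2 * r \<noteq> 3 * m div 2"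
  "params_ok (Gamma17 m r s) \<longleftrightarrow> r < m \<and> r \<noteq> 0 \<and> 2 * r \<noteq> m \<and> s < 2 * m \<and> s \<noteq> 0 \<and> s \<noteq> m"
  "params_ok (Gamma18 m r) \<longleftrightarrow> r < 4 * m \<and> r \<noteq> 0 \<and> r \<noteq> 2 * m"
  "params_ok (Gamma19 m r) \<longleftrightarrow> r < 6 * m \<and> r \<noteq> 0 \<and> r \<noteq> 3 * m"
  "params_ok (Gamma20 m r) \<longleftrightarrow> r < 3 * m"
  "params_ok (Gamma21 m r) \<longleftrightarrow> r < 2 * m"
  "params_ok (Gamma22 m r s) \<longleftrightarrow> s < m \<and> s \<noteq> 0 \<and> 2 * s \<noteq> m \<and> r < m"
  "params_ok (Gamma23 m r s) \<longleftrightarrow> r < m \<and> s < m"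
  "params_ok (Gamma24 m r) \<longleftrightarrow> r < m"
  "params_ok (Gamma25 m r s) \<longleftrightarrow> r < m \<and> r \<noteq> 0 \<and> 2 * r \<noteq> m \<and> s < m \<and> s \<noteq> 0 \<and> 2 * s \<noteq> m"
  by (auto simp: params_ok_def Gamma_defs)

lemma listed_scheme_imp_shape:
  assumes "listed_scheme S"
  shows "listed_shape S \<and> scheme_coprime S"
  using assms
proof cases
  case exceptional
  have "listed_shape Gamma7_2 \<and> scheme_coprime Gamma7_2"
    using listed_shape.intros(7)[of 1] coprime_exceptional(1)[of 1] by (simp add: Gamma7_2_def)
  moreover have "listed_shape Gamma9_4 \<and> scheme_coprime Gamma9_4"
    using listed_shape.intros(9)[of 1] coprime_exceptional(2)[of 1] by (simp add: Gamma9_4_def)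
  moreover have "listed_shape Gamma10_2 \<and> scheme_coprime Gamma10_2"
    using listed_shape.intros(10)[of 1] coprime_exceptional(3)[of 1] by (simp add: Gamma10_2_def)
  moreover have "listed_shape Gamma11_4 \<and> scheme_coprime Gamma11_4"
    using listed_shape.intros(11)[of 1] coprime_exceptional(4)[of 1] by (simp add: Gamma11_4_def)
  moreover have "listed_shape Gamma15_6 \<and> scheme_coprime Gamma15_6"
    using listed_shape.intros(15)[of 1] coprime_exceptional(5)[of 1] by (simp add: Gamma15_6_def)
  moreover have "listed_shape Gamma16_1 \<and> scheme_coprime Gamma16_1"
    using listed_shape.intros(16)[of 1] coprime_exceptional(6)[of 1] by (simp add: Gamma16_1_def)
  ultimately show ?thesis using exceptional by blast
next
  case (family_half F m r)
  obtain h where h: "m = 2 * h" using family_half(4) by (elim evenE)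
  from family_half(2) show ?thesis
  proof (elim insertE emptyE)
    assume "F = Gamma14"
    then show ?thesis
      using family_half listed_shape.intros(14)[of r h] coprime_even(6)[of m r]
      by (simp add: params_ok_Gamma h)
  qed (use family_half in \<open>simp_all add: params_ok_Gamma coprime_even listed_shape.intros\<close>)
next
  case (family_full F m r)
  from family_full(2) show ?thesis
    by (elim insertE emptyE) (use family_full in \<open>simp_all add: params_ok_Gamma coprime_any listed_shape.intros\<close>)
next
  case (family_full2 F m r s)
  from family_full2(2) show ?thesis
    by (elim insertE emptyE) (use family_full2 in \<open>simp_all add: params_ok_Gamma coprime_any listed_shape.intros\<close>)
next
  case (family_half2 F m r s)
  from family_half2(2) show ?thesis
    by (elim insertE emptyE) (use family_half2 in \<open>simp_all add: params_ok_Gamma coprime_even listed_shape.intros\<close>)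
qed (simp_all add: params_ok_Gamma coprime_even coprime_any listed_shape.intros)

lemma shape_imp_listed_scheme:
  assumes "listed_shape S" and cop: "scheme_coprime S"
  shows "listed_scheme S"
  using assms(1)
proof cases
  case (1 m r)
  show ?thesis
    unfolding 1(1)
    by (rule family_1) (use 1 cop even_ge_4[of m r] in \<open>simp_all add: params_ok_Gamma coprime_even coprime_any\<close>)
next
  case (2 r m s)
  show ?thesis
    unfolding 2(1)
    by (rule family_full2[where F = Gamma2]) (use 2 cop in \<open>simp_all add: params_ok_Gamma coprime_even coprime_any\<close>)
next
  case (3 m r)
  show ?thesis
    unfolding 3(1)
    by (rule family_half[where F = Gamma3]) (use 3 cop in \<open>simp_all add: params_ok_Gamma coprime_even coprime_any\<close>)
next
  case (4 r s m)
  show ?thesis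
    unfolding 4(1)
    by (rule family_4) (use 4 cop in \<open>simp_all add: params_ok_Gamma coprime_even coprime_any\<close>)
next
  case (5 m r)
  show ?thesis
    unfolding 5(1)
    by (rule family_5) (use 5 cop in \<open>simp_all add: params_ok_Gamma coprime_even coprime_any\<close>)
next
  case (6 r m)
  show ?thesis
    unfolding 6(1)
    by (rule family_full[where F = Gamma6]) (use 6 cop in \<open>simp_all add: params_ok_Gamma coprime_even coprime_any\<close>)
next
  case (7 j)
  then have "S = Gamma7_2" using cop coprime_exceptional(1)[of j] by (simp add: Gamma7_2_def)
  then show ?thesis by (intro exceptional) simp
next
  case (8 r m)
  show ?thesis
    unfolding 8(1)
    by (rule family_8) (use 8 cop in \<open>simp_all add: params_ok_Gamma coprime_even coprime_any\<close>)
next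
  case (9 j)
  then have "S = Gamma9_4" using cop coprime_exceptional(2)[of j] by (simp add: Gamma9_4_def)
  then show ?thesis by (intro exceptional) simp
next
  case (10 j)
  then have "S = Gamma10_2" using cop coprime_exceptional(3)[of j] by (simp add: Gamma10_2_def)
  then show ?thesis by (intro exceptional) simp
next
  case (11 j)
  then have "S = Gamma11_4" using cop coprime_exceptional(4)[of j] by (simp add: Gamma11_4_def)
  then show ?thesis by (intro exceptional) simp
next
  case (12 m r)
  show ?thesis
    unfolding 12(1)
    by (rule family_half[where F = Gamma12]) (use 12 cop in \<open>simp_all add: params_ok_Gamma coprime_even coprime_any\<close>)
next
  case (13 m r)
  show ?thesis
    unfolding 13(1)
    by (rule family_half[where F = Gamma13]) (use 13 cop in \<open>simp_all add: params_ok_Gamma coprime_even coprime_any\<close>)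
next
  case (14 r h)
  show ?thesis
    unfolding 14(1)
    by (rule family_half[where F = Gamma14]) (use 14 cop in \<open>simp_all add: params_ok_Gamma coprime_even coprime_any\<close>)
next
  case (15 j)
  then have "S = Gamma15_6" using cop coprime_exceptional(5)[of j] by (simp add: Gamma15_6_def)
  then show ?thesis by (intro exceptional) simp
next
  case (16 j)
  then have "S = Gamma16_1" using cop coprime_exceptional(6)[of j] by (simp add: Gamma16_1_def)
  then show ?thesis by (intro exceptional) simp
next
  case (17 r m s)
  show ?thesis
    unfolding 17(1)
    by (rule family_full2[where F = Gamma17]) (use 17 cop in \<open>simp_all add: params_ok_Gamma coprime_even coprime_any\<close>)
next
  case (18 m r)
  show ?thesis
    unfolding 18(1)
    by (rule family_half[where F = Gamma18]) (use 18 cop in \<open>simp_all add: params_ok_Gamma coprime_even coprime_any\<close>)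
next
  case (19 r m)
  show ?thesis
    unfolding 19(1)
    by (rule family_full[where F = Gamma19]) (use 19 cop in \<open>simp_all add: params_ok_Gamma coprime_even coprime_any\<close>)
next
  case (20 m r)
  show ?thesis
    unfolding 20(1)
    by (rule family_half[where F = Gamma20]) (use 20 cop in \<open>simp_all add: params_ok_Gamma coprime_even coprime_any\<close>)
next
  case (21 m r)
  show ?thesis
    unfolding 21(1)
    by (rule family_half[where F = Gamma21]) (use 21 cop in \<open>simp_all add: params_ok_Gamma coprime_even coprime_any\<close>)
next
  case (22 m r s)
  show ?thesis
    unfolding 22(1)
    by (rule family_half2[where F = Gamma22]) (use 22 cop even_ge_4[of m s] in \<open>simp_all add: params_ok_Gamma coprime_even coprime_any\<close>)
next
  case (23 m r s)
  show ?thesis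
    unfolding 23(1)
    by (rule family_23) (use 23 cop in \<open>simp_all add: params_ok_Gamma coprime_even coprime_any\<close>)
next
  case (24 m r)
  show ?thesis
    unfolding 24(1)
    by (rule family_24) (use 24 cop in \<open>simp_all add: params_ok_Gamma coprime_even coprime_any\<close>)
next
  case (25 m r s)
  show ?thesis
    unfolding 25(1)
    by (rule family_half2[where F = Gamma25]) (use 25 cop even_ge_4[of m r] in \<open>simp_all add: params_ok_Gamma coprime_even coprime_any\<close>)
qed

theorem theorem4p2:
  fixes \<Gamma> :: "'a pair_pre_digraph"
  assumes "pair_pseudo_graph \<Gamma>"
  shows
    "(pair_graph \<Gamma> \<and> connected (with_proj \<Gamma>) \<and> cubic \<Gamma> \<and>
      (\<exists>k \<le> 3. cyclic_aut_group_with_orbits \<Gamma> k))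
     \<longleftrightarrow>
     (\<exists>S \<in> {Gamma7_2, Gamma9_4, Gamma10_2, Gamma11_4, Gamma15_6, Gamma16_1}.
        graph_iso \<Gamma> (scheme_graph S))
   \<or> (\<exists>m r. even m \<and> m \<ge> 4 \<and> r \<noteq> 0 \<and> gcd (m div 2) r = 1 \<and>
        params_ok (Gamma1 m r) \<and> graph_iso \<Gamma> (scheme_graph (Gamma1 m r)))
   \<or> (\<exists>F \<in> {Gamma3, Gamma12, Gamma13, Gamma14, Gamma18, Gamma20, Gamma21}.
        \<exists>m r. m > 0 \<and> even m \<and> r \<noteq> 0 \<and> gcd (m div 2) r = 1 \<and>
        params_ok (F m r) \<and> graph_iso \<Gamma> (scheme_graph (F m r)))
   \<or> (\<exists>F \<in> {Gamma6, Gamma19}.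
        \<exists>m r. m > 0 \<and> r \<noteq> 0 \<and> gcd m r = 1 \<and>
        params_ok (F m r) \<and> graph_iso \<Gamma> (scheme_graph (F m r)))
   \<or> (\<exists>m r. m > 0 \<and> gcd m r = 1 \<and>
        params_ok (Gamma8 m r) \<and> graph_iso \<Gamma> (scheme_graph (Gamma8 m r)))
   \<or> (\<exists>F \<in> {Gamma2, Gamma17}.
        \<exists>m r s. m \<ge> 3 \<and> r \<noteq> 0 \<and> s \<noteq> 0 \<and> gcd m (gcd r s) = 1 \<and>
        params_ok (F m r s) \<and> graph_iso \<Gamma> (scheme_graph (F m r s)))
   \<or> (\<exists>m r s. m \<ge> 3 \<and> 0 < r \<and> r < s \<and> gcd m (gcd r s) = 1 \<and>
        params_ok (Gamma4 m r s) \<and> graph_iso \<Gamma> (scheme_graph (Gamma4 m r s)))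
   \<or> (\<exists>m r. m > 0 \<and> even m \<and> r \<noteq> 0 \<and> gcd (m div 2) r = 1 \<and>
        params_ok (Gamma5 m r) \<and> graph_iso \<Gamma> (scheme_graph (Gamma5 m r)))
   \<or> (\<exists>m r s. m > 0 \<and> even m \<and> r \<noteq> s \<and> gcd (m div 2) (gcd r s) = 1 \<and>
        params_ok (Gamma23 m r s) \<and> graph_iso \<Gamma> (scheme_graph (Gamma23 m r s)))
   \<or> (\<exists>m r. m > 0 \<and> even m \<and> gcd (m div 2) r = 1 \<and>
        params_ok (Gamma24 m r) \<and> graph_iso \<Gamma> (scheme_graph (Gamma24 m r)))
   \<or> (\<exists>F \<in> {Gamma22, Gamma25}.
        \<exists>m r s. even m \<and> m \<ge> 4 \<and> r \<noteq> 0 \<and> s \<noteq> 0 \<and> gcd (m div 2) (gcd r s) = 1 \<and>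
        params_ok (F m r s) \<and> graph_iso \<Gamma> (scheme_graph (F m r s)))"
    (is "?L \<longleftrightarrow> ?R1 \<or> ?R2 \<or> ?R3 \<or> ?R4 \<or> ?R5 \<or> ?R6 \<or> ?R7 \<or> ?R8 \<or> ?R9 \<or> ?R10 \<or> ?R11")
proof -
  have "?L \<longleftrightarrow> (\<exists>S. listed_scheme S \<and> graph_iso \<Gamma> (scheme_graph S))"
    using admissible_iff_shape[OF assms] listed_scheme_imp_shape shape_imp_listed_scheme by blast
  also have "\<dots> \<longleftrightarrow> ?R1 \<or> ?R2 \<or> ?R3 \<or> ?R4 \<or> ?R5 \<or> ?R6 \<or> ?R7 \<or> ?R8 \<or> ?R9 \<or> ?R10 \<or> ?R11"
  proof
    assume "\<exists>S. listed_scheme S \<and> graph_iso \<Gamma> (scheme_graph S)"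
    then obtain S where S: "listed_scheme S" and iso: "graph_iso \<Gamma> (scheme_graph S)" by blast
    from S show "?R1 \<or> ?R2 \<or> ?R3 \<or> ?R4 \<or> ?R5 \<or> ?R6 \<or> ?R7 \<or> ?R8 \<or> ?R9 \<or> ?R10 \<or> ?R11"
    proof cases
      case exceptional
      then have "?R1" using iso by blast
      then show ?thesis by (rule disjI1)
    next
      case (family_1 m r)
      then have "?R2" using iso by (intro exI[of _ m] exI[of _ r]) simp_all
      then show ?thesis by (rule disjI2[OF disjI1])
    next
      case (family_half F m r)
      then have "?R3" using iso by (intro bexI[of _ F] exI[of _ m] exI[of _ r]) simp_all
      then show ?thesis by (rule disjI2[OF disjI2[OF disjI1]])
    next
      case (family_full F m r)
      then have "?R4" using iso by (intro bexI[of _ F] exI[of _ m] exI[of _ r]) simp_all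
      then show ?thesis by (rule disjI2[OF disjI2[OF disjI2[OF disjI1]]])
    next
      case (family_8 m r)
      then have "?R5" using iso by (intro exI[of _ m] exI[of _ r]) simp_all
      then show ?thesis by (rule disjI2[OF disjI2[OF disjI2[OF disjI2[OF disjI1]]]])
    next
      case (family_full2 F m r s)
      then have "?R6" using iso by (intro bexI[of _ F] exI[of _ m] exI[of _ r] exI[of _ s]) simp_all
      then show ?thesis by (rule disjI2[OF disjI2[OF disjI2[OF disjI2[OF disjI2[OF disjI1]]]]])
    next
      case (family_4 m r s)
      then have "?R7" using iso by (intro exI[of _ m] exI[of _ r] exI[of _ s]) simp_all
      then show ?thesis by (rule disjI2[OF disjI2[OF disjI2[OF disjI2[OF disjI2[OF disjI2[OF disjI1]]]]]])
    next
      case (family_5 m r)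
      then have "?R8" using iso by (intro exI[of _ m] exI[of _ r]) simp_all
      then show ?thesis by (rule disjI2[OF disjI2[OF disjI2[OF disjI2[OF disjI2[OF disjI2[OF disjI2[OF disjI1]]]]]]])
    next
      case (family_23 m r s)
      then have "?R9" using iso by (intro exI[of _ m] exI[of _ r] exI[of _ s]) simp_all
      then show ?thesis by (rule disjI2[OF disjI2[OF disjI2[OF disjI2[OF disjI2[OF disjI2[OF disjI2[OF disjI2[OF disjI1]]]]]]]])
    next
      case (family_24 m r)
      then have "?R10" using iso by (intro exI[of _ m] exI[of _ r]) simp_all
      then show ?thesis by (rule disjI2[OF disjI2[OF disjI2[OF disjI2[OF disjI2[OF disjI2[OF disjI2[OF disjI2[OF disjI2[OF disjI1]]]]]]]]])
    next
      case (family_half2 F m r s)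
      then have "?R11" using iso by (intro bexI[of _ F] exI[of _ m] exI[of _ r] exI[of _ s]) simp_all
      then show ?thesis by (rule disjI2[OF disjI2[OF disjI2[OF disjI2[OF disjI2[OF disjI2[OF disjI2[OF disjI2[OF disjI2[OF disjI2]]]]]]]]])
    qed
  next
    assume "?R1 \<or> ?R2 \<or> ?R3 \<or> ?R4 \<or> ?R5 \<or> ?R6 \<or> ?R7 \<or> ?R8 \<or> ?R9 \<or> ?R10 \<or> ?R11"
    then show "\<exists>S. listed_scheme S \<and> graph_iso \<Gamma> (scheme_graph S)"
    proof (elim disjE)
      assume "?R1"
      then show ?thesis using listed_scheme.exceptional by blast
    next
      assume "?R2"
      then show ?thesis
        by (elim exE conjE) (rule exI, rule conjI, rule listed_scheme.family_1)
    next
      assume "?R3"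
      then show ?thesis
      proof (elim bexE exE conjE)
        fix F m r
        assume "graph_iso \<Gamma> (scheme_graph (F m r))" and "F \<in> {Gamma3, Gamma12, Gamma13, Gamma14, Gamma18, Gamma20, Gamma21}"
          "0 < m" "even m" "r \<noteq> 0" "gcd (m div 2) r = 1" "params_ok (F m r)"
        moreover from this(2-) have "listed_scheme (F m r)" by (intro listed_scheme.family_half)
        ultimately show ?thesis by blast
      qed
    next
      assume "?R4"
      then show ?thesis
      proof (elim bexE exE conjE)
        fix F m r
        assume "graph_iso \<Gamma> (scheme_graph (F m r))" and "F \<in> {Gamma6, Gamma19}"
          "0 < m" "r \<noteq> 0" "gcd m r = 1" "params_ok (F m r)"
        moreover from this(2-) have "listed_scheme (F m r)" by (intro listed_scheme.family_full)
        ultimately show ?thesis by blast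
      qed
    next
      assume "?R5"
      then show ?thesis
        by (elim exE conjE) (rule exI, rule conjI, rule listed_scheme.family_8)
    next
      assume "?R6"
      then show ?thesis
      proof (elim bexE exE conjE)
        fix F m r s
        assume "graph_iso \<Gamma> (scheme_graph (F m r s))" and "F \<in> {Gamma2, Gamma17}"
          "3 \<le> m" "r \<noteq> 0" "s \<noteq> 0" "gcd m (gcd r s) = 1" "params_ok (F m r s)"
        moreover from this(2-) have "listed_scheme (F m r s)" by (intro listed_scheme.family_full2)
        ultimately show ?thesis by blast
      qed
    next
      assume "?R7"
      then show ?thesis
        by (elim exE conjE) (rule exI, rule conjI, rule listed_scheme.family_4)
    next
      assume "?R8"
      then show ?thesis
        by (elim exE conjE) (rule exI, rule conjI, rule listed_scheme.family_5)
    next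
      assume "?R9"
      then show ?thesis
        by (elim exE conjE) (rule exI, rule conjI, rule listed_scheme.family_23)
    next
      assume "?R10"
      then show ?thesis
        by (elim exE conjE) (rule exI, rule conjI, rule listed_scheme.family_24)
    next
      assume "?R11"
      then show ?thesis
      proof (elim bexE exE conjE)
        fix F m r s
        assume "graph_iso \<Gamma> (scheme_graph (F m r s))" and "F \<in> {Gamma22, Gamma25}"
          "even m" "4 \<le> m" "r \<noteq> 0" "s \<noteq> 0" "gcd (m div 2) (gcd r s) = 1" "params_ok (F m r s)"
        moreover from this(2-) have "listed_scheme (F m r s)" by (intro listed_scheme.family_half2)
        ultimately show ?thesis by blast
      qed
    qed
  qed
  finally show ?thesis .
qed

end
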